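(* Let $d\ge3$ and let $V:(0,1)\to\mathbb{C}$ be measurable with $\int_0^1 r|V(r)|\,dr<\infty$. Suppose that $V\in L^{s}_{d-1}(0,1)$, where $s=\max\{2,\tfrac d2\}$, and that $V$ is almost bounded from below. Then the Dirichlet problem $$u\in\operatorname{Sol}_V^w(\mathbb{B}^d),\qquad \operatorname{tr}_{\mathbb{S}^{d-1}}u=\varphi$$ admits a unique solution (for every $\varphi\in W^{\frac12,2}(\mathbb{S}^{d-1})$) if and only if the map $\operatorname{tr}_{\mathbb{S}^{d-1}}:\operatorname{Sol}_V^w(\mathbb{B}^d)\to W^{\frac12,2}(\mathbb{S}^{d-1})$ is surjective.
   Context: $\mathbb{B}^d$ and $\mathbb{S}^{d-1}$ are the open unit ball and unit sphere of $\mathbb{R}^d$. $L^p_\alpha(0,1)$ is the $L^p$ space on $(0,1)$ with respect to $r^\alpha\,dr$. $V$ is almost bounded from below if there is a constant $C>0$ with $\operatorname{Re}V(r)\ge-C$ for a.e. $r\in(0,1)$. $\operatorname{Sol}_V^w(\mathbb{B}^d)$ is the space of weak solutions of $-\Delta u+V(|x|)u=0$: those $u\in W^{1,2}(\mathbb{B}^d)$ (complex valued) such that $\int_{\mathbb{B}^d}(\nabla u\cdot\nabla\phi+V(|x|)u\phi)\,dx=0$ for all $\phi\in C_0^\infty(\mathbb{B}^d)$, with $\nabla u\cdot\nabla\phi=\sum_i\partial_iu\,\partial_i\phi$. $\operatorname{tr}_{\mathbb{S}^{d-1}}:W^{1,2}(\mathbb{B}^d)\to L^2(\mathbb{S}^{d-1})$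 is the trace operator and $W^{\frac12,2}(\mathbb{S}^{d-1})$ denotes its image. *)

theory Defs
  imports "HOL-Analysis.Analysis"
begin

abbreviation unit_ball_measure :: "'a::euclidean_space measure" where
  "unit_ball_measure \<equiv> lebesgue_on (ball 0 1)"

text \<open>Complex-valued functions are differentiated in the real sense, so
  \<open>dir_deriv f b x\<close> with \<open>b \<in> Basis\<close> is the classical partial derivative.\<close>

definition dir_deriv :: "('a::euclidean_space \<Rightarrow> complex) \<Rightarrow> 'a \<Rightarrow> 'a \<Rightarrow> complex" where
  "dir_deriv f b x = frechet_derivative f (at x) b"

primrec C_diff :: "nat \<Rightarrow> ('a::euclidean_space \<Rightarrow> complex) \<Rightarrow> bool" where
  "C_diff 0 f \<longleftrightarrow> continuous_on UNIV f"
| "C_diff (Suc k) f \<longleftrightarrow>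
     f differentiable_on UNIV \<and> (\<forall>b\<in>Basis. C_diff k (dir_deriv f b))"

definition smooth :: "('a::euclidean_space \<Rightarrow> complex) \<Rightarrow> bool" where
  "smooth f \<longleftrightarrow> (\<forall>k. C_diff k f)"

definition test_functions :: "('a::euclidean_space \<Rightarrow> complex) set" where
  "test_functions =
     {\<phi>. smooth \<phi> \<and> (\<exists>K. compact K \<and> K \<subseteq> ball 0 1 \<and> (\<forall>x. x \<notin> K \<longrightarrow> \<phi> x = 0))}"

text \<open>Elements of \<open>L\<^sup>2\<close> and of the Sobolev space are represented by functions;
  equality of the corresponding classes is equality almost everywhere.\<close>

definition L2 :: "'a measure \<Rightarrow> ('a \<Rightarrow> complex) set" where
  "L2 M = {f \<in> borel_measurable M. integrable M (\<lambda>x. (norm (f x))\<^sup>2)}"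

definition has_weak_partial ::
  "('a::euclidean_space \<Rightarrow> complex) \<Rightarrow> 'a \<Rightarrow> ('a \<Rightarrow> complex) \<Rightarrow> bool" where
  "has_weak_partial u b g \<longleftrightarrow>
     u \<in> L2 unit_ball_measure \<and> g \<in> L2 unit_ball_measure \<and>
     (\<forall>\<phi>\<in>test_functions.
        (LINT x|unit_ball_measure. u x * dir_deriv \<phi> b x) =
        - (LINT x|unit_ball_measure. g x * \<phi> x))"

text \<open>\<open>G b\<close> is the weak partial derivative in direction \<open>b\<close>; it is unique almost everywhere.\<close>

definition has_weak_gradient ::
  "('a::euclidean_space \<Rightarrow> complex) \<Rightarrow> ('a \<Rightarrow> 'a \<Rightarrow> complex) \<Rightarrow> bool" where
  "has_weak_gradient u G \<longleftrightarrow> (\<forall>b\<in>Basis. has_weak_partial u b (G b))"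

definition W12 :: "('a::euclidean_space \<Rightarrow> complex) set" where
  "W12 = {u. \<exists>G. has_weak_gradient u G}"

text \<open>\<open>has_bochner_integral\<close> asserts that the integrand is integrable as well as that
  its integral vanishes.\<close>

definition Sol :: "(real \<Rightarrow> complex) \<Rightarrow> ('a::euclidean_space \<Rightarrow> complex) set" where
  "Sol V = {u \<in> W12. \<exists>G. has_weak_gradient u G \<and>
     (\<forall>\<phi>\<in>test_functions.
        has_bochner_integral unit_ball_measure
          (\<lambda>x. (\<Sum>b\<in>Basis. G b x * dir_deriv \<phi> b x) + V (norm x) * u x * \<phi> x) 0)}"

text \<open>Surface measure of the unit sphere as the cone measure
  \<open>\<sigma>(A) = d \<cdot> |{x. 0 < |x| < 1 \<and> x/|x| \<in> A}|\<close>.\<close>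

definition sphere_measure :: "'a::euclidean_space measure" where
  "sphere_measure = scale_measure (of_nat DIM('a))
     (distr (restrict_space lborel (ball 0 1 - {0})) (restrict_space borel (sphere 0 1)) sgn)"

lemma sgn_measurable_sphere:
  "sgn \<in> restrict_space lborel (ball 0 1 - {0}) \<rightarrow>\<^sub>M
     restrict_space borel (sphere 0 (1::real) :: 'a::euclidean_space set)"
proof -
  have "(sgn :: 'a \<Rightarrow> 'a) \<in> borel_measurable borel"
    by (simp add: sgn_div_norm[abs_def])
  then have "(sgn :: 'a \<Rightarrow> 'a) \<in> borel_measurable (restrict_space lborel (ball 0 1 - {0}))"
    by (simp add: measurable_restrict_space1)
  then show ?thesis
    by (auto intro!: measurable_restrict_space2 simp: space_restrict_space norm_sgn)
qed

lemma emeasure_sphere_measure: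
  fixes A :: "'a::euclidean_space set"
  assumes "A \<in> sets borel" "A \<subseteq> sphere 0 1"
  shows "emeasure sphere_measure A =
    of_nat DIM('a) * emeasure lborel {x \<in> ball 0 1 - {0}. sgn x \<in> A}"
proof -
  have "A \<in> sets (restrict_space borel (sphere 0 1))"
    using assms by (simp add: sets_restrict_space_iff)
  moreover have "sgn -` A \<inter> (ball 0 1 - {0}) = {x \<in> ball 0 1 - {0}. sgn x \<in> A}"
    by auto
  moreover have "emeasure (restrict_space lborel (ball 0 1 - {0})) {x \<in> ball 0 1 - {0}. sgn x \<in> A} =
      emeasure lborel {x \<in> ball 0 1 - {0}. sgn x \<in> A}"
    by (rule emeasure_restrict_space) auto
  ultimately show ?thesis
    unfolding sphere_measure_def
    by (simp add: emeasure_distr[OF sgn_measurable_sphere] space_restrict_space del: mem_ball_0)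
qed

text \<open>The trace operator is the continuous extension to \<open>W\<^sup>1\<^sup>,\<^sup>2\<close> of the restriction
  map \<open>w \<mapsto> w|\<^bsub>S\<^esub>\<close> on functions smooth up to the boundary: \<open>has_trace u f\<close> says that
  some such \<open>w\<^sub>k\<close> tend to \<open>u\<close> in \<open>W\<^sup>1\<^sup>,\<^sup>2\<close> while \<open>w\<^sub>k|\<^bsub>S\<^esub>\<close> tend to \<open>f\<close> in \<open>L\<^sup>2\<close> of the
  sphere. By the trace theorem every \<open>u\<close> in \<open>W\<^sup>1\<^sup>,\<^sup>2\<close> has exactly one trace up to
  equality almost everywhere.\<close>

definition has_trace ::
  "('a::euclidean_space \<Rightarrow> complex) \<Rightarrow> ('a \<Rightarrow> complex) \<Rightarrow> bool" where
  "has_trace u f \<longleftrightarrow>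
     u \<in> W12 \<and> f \<in> L2 sphere_measure \<and>
     (\<exists>G w. has_weak_gradient u G \<and> (\<forall>k::nat. smooth (w k)) \<and>
        (\<lambda>k. LINT x|unit_ball_measure. (norm (w k x - u x))\<^sup>2) \<longlonglongrightarrow> 0 \<and>
        (\<forall>b\<in>Basis. (\<lambda>k. LINT x|unit_ball_measure.
            (norm (dir_deriv (w k) b x - G b x))\<^sup>2) \<longlonglongrightarrow> 0) \<and>
        (\<lambda>k. LINT x|sphere_measure. (norm (w k x - f x))\<^sup>2) \<longlonglongrightarrow> 0)"

definition W_half :: "('a::euclidean_space \<Rightarrow> complex) set" where
  "W_half = {f. \<exists>u\<in>W12. has_trace u f}"

definition almost_bounded_below :: "(real \<Rightarrow> complex) \<Rightarrow> bool" where
  "almost_bounded_below V \<longleftrightarrow> (\<exists>C>0. AE r in lebesgue_on {0<..<1}. Re (V r) \<ge> - C)"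

definition weighted_Lp :: "real \<Rightarrow> real \<Rightarrow> (real \<Rightarrow> complex) set" where
  "weighted_Lp p \<alpha> = {f \<in> borel_measurable (lebesgue_on {0<..<1}).
     integrable (lebesgue_on {0<..<1}) (\<lambda>r. norm (f r) powr p * r powr \<alpha>)}"

end

theory Submission
  imports Defs "HOL-Probability.Probability"
begin

text \<open>Only one implication has content: if the trace maps the weak solutions onto its whole image, then two
solutions \<open>u\<close>, \<open>v\<close> with the same trace coincide. Since the potential is radial, this can be decided
on ordinary differential equations.

For a homogeneous polynomial \<open>p\<close> of degree \<open>k\<close> let \<open>F(r)\<close> be the integral of \<open>(v - u)(r\<omega>) p(\<omega>)\<close> over the
unit sphere. Testing the equation with \<open>\<xi>(|x|\<^sup>2) p(x)\<close> shows that \<open>F\<close> solves the radial equation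
\<open>F'' + (d-1)/r F' - k(k+d-2)/r\<^sup>2 F = V F\<close> on \<open>(0,1)\<close>, up to a term that contains the corresponding
integral for the Laplacian of \<open>p\<close> (\<open>moment_radial_solution\<close>). The Laplacian has degree \<open>k - 2\<close>, so an
induction over the degree removes this term. In this way all polynomials are treated directly and no
decomposition into spherical harmonics occurs. The equal traces say that \<open>F(1) = 0\<close>
(\<open>trace_radial_moments\<close>).

Surjectivity supplies the missing second condition at \<open>r = 1\<close>. Let \<open>h = (x\<^sub>a + i x\<^sub>b)\<^sup>k\<close>, a harmonic
polynomial, and let \<open>y\<close> be a solution whose trace is the complex conjugate of \<open>h\<close>. Its integral \<open>H(r)\<close> against
\<open>h\<close> solves the same radial equation, and \<open>H(1)\<close> is the integral of \<open>|h|\<^sup>2\<close> over the sphere, which is not zero. The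
Wronskian \<open>r\<^sup>d\<^sup>-\<^sup>1 (F' H - F H')\<close> is constant. Both functions have finite energy near the origin, which
bounds them by a multiple of \<open>r\<^sup>-\<^sup>(\<^sup>d\<^sup>-\<^sup>2\<^sup>)\<^sup>/\<^sup>2\<close>; hence the constant \<open>W\<close> makes \<open>|W|\<^sup>2/r\<close> integrable on \<open>(0,1)\<close>, and
so \<open>W = 0\<close>. At \<open>r = 1\<close> this gives \<open>F'(1) H(1) = 0\<close>. Now both Cauchy data of \<open>F\<close> vanish at \<open>1\<close>, and a Gronwall
argument gives \<open>F = 0\<close> (\<open>radial_solution_unique\<close>).

So \<open>v - u\<close> is orthogonal to all polynomials on the ball, and the theorem of Weierstrass gives
\<open>v = u\<close> almost everywhere (\<open>vanishing_moments_imp_AE_zero\<close>). Since \<open>r |V(r)|\<close> is merely integrable, all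
equations on \<open>(0,1)\<close> are kept in integrated form.\<close>

section \<open>Integration preliminaries\<close>

text \<open>The measures with the densities \<open>max 0 f\<close> and \<open>max 0 (- f)\<close> agree on the boxes, which
  generate the Borel sets and are stable under intersection. Hence the two densities agree almost
  everywhere, and then both vanish.\<close>

lemma AE_zero_real_if_box_integrals_zero:
  fixes f :: "'a::euclidean_space \<Rightarrow> real"
  assumes f: "integrable lborel f"
    and zero: "\<And>a b. (LINT x:box a b|lborel. f x) = 0"
  shows "AE x in lborel. f x = 0"
proof -
  let ?p = "\<lambda>x. max 0 (f x)" and ?m = "\<lambda>x. max 0 (- f x)"
  have ip: "integrable lborel ?p" and im: "integrable lborel ?m"
    using f by (auto intro!: integrable_max)
  have em: "emeasure (density lborel (\<lambda>x. ennreal (g x))) B = ennreal (LINT x:B|lborel. g x)"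
    if "integrable lborel g" "\<And>x. 0 \<le> g x" "B \<in> sets borel" for g :: "'a \<Rightarrow> real" and B
  proof -
    have "emeasure (density lborel (\<lambda>x. ennreal (g x))) B = (\<integral>\<^sup>+x. ennreal (g x) * indicator B x \<partial>lborel)"
      using that by (subst emeasure_density) auto
    also have "\<dots> = (\<integral>\<^sup>+x. ennreal (indicator B x * g x) \<partial>lborel)"
      by (intro nn_integral_cong) (auto simp: indicator_def)
    also have "\<dots> = ennreal (LINT x:B|lborel. g x)"
      unfolding set_lebesgue_integral_def real_scaleR_def
      using that by (intro nn_integral_eq_integral integrable_mult_indicator[where 'b=real, simplified]) auto
    finally show ?thesis .
  qed
  have "density lborel (\<lambda>x. ennreal (?p x)) = density lborel (\<lambda>x. ennreal (?m x))"
  proof (rule measure_eqI_generator_eq)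
    let ?E = "range (\<lambda>(a, b). box a b :: 'a set)"
    let ?A = "\<lambda>n::nat. box (- (real n *\<^sub>R One)) (real n *\<^sub>R One) :: 'a set"
    show "Int_stable ?E"
      by (auto simp: Int_stable_def box_Int_box)
    show "?E \<subseteq> Pow UNIV" "sets (density lborel (\<lambda>x. ennreal (?p x))) = sigma_sets UNIV ?E"
       "sets (density lborel (\<lambda>x. ennreal (?m x))) = sigma_sets UNIV ?E"
      by (simp_all add: borel_eq_box)
    show "range ?A \<subseteq> ?E" "(\<Union>i. ?A i) = UNIV"
      unfolding UN_box_eq_UNIV by auto
    show "emeasure (density lborel (\<lambda>x. ennreal (?p x))) (?A i) \<noteq> \<infinity>" for i
      by (subst em) (use ip in auto)
    show "emeasure (density lborel (\<lambda>x. ennreal (?p x))) X = emeasure (density lborel (\<lambda>x. ennreal (?m x))) X"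
      if "X \<in> ?E" for X
    proof -
      have X: "X \<in> sets borel" and z: "(LINT x:X|lborel. f x) = 0" using that zero by auto
      have "(LINT x:X|lborel. f x) = (LINT x:X|lborel. ?p x - ?m x)"
        by (intro arg_cong2[where f="set_lebesgue_integral lborel"] refl ext) auto
      also have "\<dots> = (LINT x:X|lborel. ?p x) - (LINT x:X|lborel. ?m x)"
        using ip im X by (intro set_integral_diff) (simp_all add: set_integrable_def integrable_mult_indicator del: real_scaleR_def)
      moreover have "emeasure (density lborel (\<lambda>x. ennreal (?p x))) X = ennreal (LINT x:X|lborel. ?p x)"
        "emeasure (density lborel (\<lambda>x. ennreal (?m x))) X = ennreal (LINT x:X|lborel. ?m x)"
        by (intro em ip im X max.cobounded1)+
      ultimately show ?thesis using z by simp
    qed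
  qed
  then have "AE x in lborel. ennreal (?p x) = ennreal (?m x)"
    using f by (intro sigma_finite_measure.density_unique[OF sigma_finite_lborel]) auto
  then show ?thesis
    by eventually_elim (auto simp: max_def split: if_splits)
qed

lemma AE_zero_if_box_integrals_zero:
  fixes f :: "'a::euclidean_space \<Rightarrow> complex"
  assumes f: "integrable lborel f"
    and zero: "\<And>a b. (LINT x:box a b|lborel. f x) = 0"
  shows "AE x in lborel. f x = 0"
proof -
  have i: "integrable lborel (\<lambda>x. indicator (box a b) x *\<^sub>R f x)" for a b
    using f by (intro integrable_mult_indicator) auto
  have "AE x in lborel. Re (f x) = 0"
    using f zero integral_Re[OF i] 
    by (intro AE_zero_real_if_box_integrals_zero) (auto simp: set_lebesgue_integral_def integrable_Re)
  moreover have "AE x in lborel. Im (f x) = 0"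
    using f zero integral_Im[OF i] 
    by (intro AE_zero_real_if_box_integrals_zero) (auto simp: set_lebesgue_integral_def integrable_Im)
  ultimately show ?thesis by eventually_elim (simp add: complex_eq_iff)
qed

text \<open>The polynomial \<open>t \<mapsto> \<integral> (f - t)\<^sup>2\<close> is nonnegative, so its discriminant is not positive. This is the
  Cauchy-Schwarz inequality against the constant 1.\<close>

lemma (in finite_measure) integral_power2_le:
  fixes f :: "'a \<Rightarrow> real"
  assumes f: "integrable M f" and f2: "integrable M (\<lambda>x. (f x)\<^sup>2)"
  shows "(LINT x|M. f x)\<^sup>2 \<le> measure M (space M) * (LINT x|M. (f x)\<^sup>2)"
proof -
  let ?I = "LINT x|M. f x" and ?S = "LINT x|M. (f x)\<^sup>2" and ?m = "measure M (space M)"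
  have q: "0 \<le> ?S - 2 * t * ?I + t\<^sup>2 * ?m" for t
  proof -
    have "0 \<le> (LINT x|M. (f x - t)\<^sup>2)" by simp
    also have "(\<lambda>x. (f x - t)\<^sup>2) = (\<lambda>x. (f x)\<^sup>2 - 2 * t * f x + t\<^sup>2)"
      by (simp add: power2_eq_square algebra_simps fun_eq_iff)
    also have "(LINT x|M. (f x)\<^sup>2 - 2 * t * f x + t\<^sup>2) = ?S - 2 * t * ?I + t\<^sup>2 * ?m"
      using f f2 by simp
    finally show ?thesis .
  qed
  show ?thesis
  proof (cases "?m = 0")
    case True
    have "?I = 0"
    proof (rule ccontr)
      assume "?I \<noteq> 0"
      with q[of "(?S + 1) / (2 * ?I)"] True show False by simp
    qed
    with True show ?thesis by simp
  next
    case False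
    then have "?m > 0" by (simp add: zero_less_measure_iff)
    then show ?thesis using q[of "?I / ?m"] by (simp add: field_simps power2_eq_square)
  qed
qed

lemma set_integral_mono_subset:
  fixes f :: "'a \<Rightarrow> real"
  assumes "set_integrable M B f" "A \<in> sets M" "A \<subseteq> B" "\<And>x. x \<in> B \<Longrightarrow> 0 \<le> f x"
  shows "(LINT x:A|M. f x) \<le> (LINT x:B|M. f x)"
  unfolding set_lebesgue_integral_def
proof (rule integral_mono)
  show "integrable M (\<lambda>x. indicator A x *\<^sub>R f x)" "integrable M (\<lambda>x. indicator B x *\<^sub>R f x)"
    using set_integrable_subset[OF assms(1-3)] assms(1) by (simp_all add: set_integrable_def)
  show "indicator A x *\<^sub>R f x \<le> indicator B x *\<^sub>R f x" for x
    using assms(3,4) by (auto simp: indicator_def)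
qed

lemma set_borel_measurable_subset:
  fixes f :: "real \<Rightarrow> complex"
  assumes f: "set_borel_measurable borel S f" and T: "T \<in> sets borel" "T \<subseteq> S"
  shows "set_borel_measurable borel T f"
proof -
  define g where "g = (\<lambda>x. indicator S x *\<^sub>R f x)"
  have "g \<in> borel_measurable borel" using f by (simp add: g_def set_borel_measurable_def)
  then have "(\<lambda>x. indicator T x *\<^sub>R g x) \<in> borel_measurable borel" using T by measurable
  also have "(\<lambda>x. indicator T x *\<^sub>R g x) = (\<lambda>x. indicator T x *\<^sub>R f x)"
    using T(2) by (auto simp: indicator_def fun_eq_iff g_def)
  finally show ?thesis by (simp add: set_borel_measurable_def)
qed

lemma set_borel_measurable_continuous_subset:
  fixes f :: "real \<Rightarrow> complex"
  assumes "continuous_on S f" "S \<in> sets borel" "T \<in> sets borel" "T \<subseteq> S"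
  shows "set_borel_measurable borel T f"
  using borel_measurable_continuous_on_indicator[OF assms(2,1)]
  by (intro set_borel_measurable_subset[OF _ assms(3,4)]) (simp add: set_borel_measurable_def)

lemma set_integrable_mult_continuous:
  fixes h g :: "real \<Rightarrow> complex"
  assumes h: "set_integrable lborel S h" and g: "continuous_on {a..b} g" and S: "S \<subseteq> {a..b}"
  shows "set_integrable lborel S (\<lambda>r. h r * g r)"
proof -
  obtain B where B: "\<And>x. x \<in> {a..b} \<Longrightarrow> norm (g x) \<le> B"
    using compact_imp_bounded[OF compact_continuous_image[OF g]] by (force simp: bounded_iff)
  define h' where "h' = (\<lambda>r. indicator S r *\<^sub>R h r)"
  define g' where "g' = (\<lambda>r. indicator {a..b} r *\<^sub>R g r)"
  have h': "integrable lborel h'" using h by (simp add: set_integrable_def h'_def)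
  have [measurable]: "g' \<in> borel_measurable lborel" "h' \<in> borel_measurable lborel"
    using borel_measurable_continuous_on_indicator[OF _ g] borel_measurable_integrable[OF h'] by (auto simp: g'_def)
  have "integrable lborel (\<lambda>r. h' r * g' r)"
  proof (rule Bochner_Integration.integrable_bound)
    show "integrable lborel (\<lambda>r. B *\<^sub>R h' r)" using h' by (rule integrable_scaleR_right)
    have "norm (h' r * g' r) \<le> norm (B *\<^sub>R h' r)" for r
    proof (cases "r \<in> S")
      case True
      then have "norm (g r) \<le> \<bar>B\<bar>" using B[of r] S by force
      then show ?thesis using True S by (auto simp: norm_mult g'_def h'_def mult.commute mult_right_mono)
    qed (auto simp: h'_def)
    then show "AE r in lborel. norm (h' r * g' r) \<le> norm (B *\<^sub>R h' r)" by simp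
  qed measurable
  also have "(\<lambda>r. h' r * g' r) = (\<lambda>r. indicator S r *\<^sub>R (h r * g r))"
    using S by (auto simp: h'_def g'_def indicator_def fun_eq_iff)
  finally show ?thesis by (simp add: set_integrable_def)
qed

text \<open>Polar coordinates produce integrals over the open unit interval, whereas integration by parts
  takes place on a compact interval; for integrands that vanish near the origin the two agree.\<close>

lemma set_integral_Ioo_eq_Icc:
  fixes f :: "real \<Rightarrow> complex"
  assumes e: "0 \<le> e" "e \<le> 1" and f: "set_integrable lborel {e..1} f" and f0: "\<And>r. 0 < r \<Longrightarrow> r < e \<Longrightarrow> f r = 0"
  shows "(LINT r:{0<..<1}|lborel. f r) = (LINT r:{e..1}|lborel. f r)"
  unfolding set_lebesgue_integral_def
proof (rule integral_cong_AE)
  have f0': "f r = 0" if "0 < r" "\<not> e \<le> r" for r using f0[of r] that by simp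
  define h where "h = (\<lambda>r. indicator {e..1} r *\<^sub>R f r)"
  have [measurable]: "h \<in> borel_measurable borel"
    using borel_measurable_integrable[OF f[unfolded set_integrable_def]] by (simp add: h_def)
  show "(\<lambda>r. indicator {e..1} r *\<^sub>R f r) \<in> borel_measurable lborel"
    using borel_measurable_integrable[OF f[unfolded set_integrable_def]] .
  have "(\<lambda>r. indicator {0<..<1} r *\<^sub>R h r) \<in> borel_measurable lborel" by measurable
  also have "(\<lambda>r. indicator {0<..<1} r *\<^sub>R h r) = (\<lambda>r. indicator {0<..<1} r *\<^sub>R f r)"
    using e f0' by (auto simp: h_def indicator_def fun_eq_iff)
  finally show "(\<lambda>r. indicator {0<..<1} r *\<^sub>R f r) \<in> borel_measurable lborel" .
  show "AE r in lborel. indicator {0<..<1} r *\<^sub>R f r = indicator {e..1} r *\<^sub>R f r"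
    using AE_lborel_singleton[of "0::real"] AE_lborel_singleton[of "1::real"]
    by eventually_elim (use e f0' in \<open>auto simp: indicator_def\<close>)
qed

text \<open>The relevant functions are integrable up to \<open>1\<close> but possibly not up to the origin, so
  primitives are anchored at \<open>1\<close>.\<close>

lemma continuous_on_tail_integral:
  fixes A :: "real \<Rightarrow> complex"
  assumes A: "\<And>e. 0 < e \<Longrightarrow> set_integrable lborel {e..1} A"
  shows "continuous_on {0<..1} (\<lambda>r. LINT s:{r..1}|lborel. A s)"
proof -
  let ?H = "\<lambda>r. LINT s:{r..1}|lborel. A s"
  have c: "continuous_on {e..1} ?H" if e: "0 < e" for e
  proof -
    have bi: "A integrable_on {e..1}" by (rule set_borel_integral_eq_integral(1)[OF A[OF e]])
    have "continuous_on {e..1} (\<lambda>r. integral {e..1} A - integral {e..r} A)"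
      by (intro continuous_intros indefinite_integral_continuous_1 bi)
    also have "continuous_on {e..1} (\<lambda>r. integral {e..1} A - integral {e..r} A) \<longleftrightarrow> continuous_on {e..1} ?H"
    proof (rule continuous_on_cong[OF refl])
      fix r assume r: "r \<in> {e..1}"
      have "integral {e..r} A + integral {r..1} A = integral {e..1} A"
        using r by (intro Henstock_Kurzweil_Integration.integral_combine bi) auto
      moreover have "?H r = integral {r..1} A"
        by (rule set_borel_integral_eq_integral(2)[OF A]) (use r e in auto)
      ultimately show "integral {e..1} A - integral {e..r} A = ?H r" by (simp add: algebra_simps)
    qed
    finally show ?thesis .
  qed
  show ?thesis
    unfolding continuous_on_eq_continuous_within
  proof
    fix x :: real assume x: "x \<in> {0<..1}"
    have "continuous (at x within {x/2..1}) ?H"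
      using c[of "x/2"] x by (auto simp: continuous_on_eq_continuous_within)
    moreover have "at x within {x/2..1} = at x within {0<..1}"
    proof (rule at_within_nhd)
      show "x \<in> {x/2<..}" "open {x/2<..}" using x by auto
      show "{x/2..1} \<inter> {x/2<..} - {x} = {0<..1} \<inter> {x/2<..} - {x}" using x by auto
    qed
    ultimately show "continuous (at x within {0<..1}) ?H" by simp
  qed
qed

text \<open>One factor is only the integral of an integrable function and need not be differentiable at
  every point. The formula is Fubini's theorem on the triangle \<open>a \<le> r \<le> s \<le> c\<close>.\<close>

lemma integral_by_parts_indefinite:
  fixes A Y Y' :: "real \<Rightarrow> complex"
  assumes ac: "a \<le> c" and A: "set_integrable lborel {a..c} A"
    and Y: "\<And>x. x \<in> {a..c} \<Longrightarrow> (Y has_vector_derivative Y' x) (at x within {a..c})"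
    and Y': "continuous_on {a..c} Y'"
  shows "(LINT r:{a..c}|lborel. (LINT s:{r..c}|lborel. A s) * Y' r)
       = (LINT s:{a..c}|lborel. A s * (Y s - Y a))"
proof -
  define k where "k r s = (if r \<le> s then (indicator {a..c} s *\<^sub>R A s) * (indicator {a..c} r *\<^sub>R Y' r) else 0)" for r s
  have Y'i: "integrable lborel (\<lambda>r. indicator {a..c} r *\<^sub>R Y' r)"
    using borel_integrable_atLeastAtMost'[OF Y'] by (simp add: set_integrable_def)
  have Ai: "integrable lborel (\<lambda>s. indicator {a..c} s *\<^sub>R A s)"
    using A by (simp add: set_integrable_def)
  have prod_int: "integrable (lborel \<Otimes>\<^sub>M lborel) (\<lambda>(r, s). g r * h s)"
    if [measurable]: "integrable lborel g" "integrable lborel h" for g h :: "real \<Rightarrow> complex"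
    by (rule lborel_pair.Fubini_integrable) (use that in \<open>auto simp: norm_mult\<close>)
  have meas: "case_prod k \<in> borel_measurable (lborel \<Otimes>\<^sub>M lborel)"
    unfolding k_def case_prod_unfold using borel_measurable_integrable[OF Ai] borel_measurable_integrable[OF Y'i]
    by measurable
  have "integrable (lborel \<Otimes>\<^sub>M lborel) (\<lambda>(r, s). (indicator {a..c} r *\<^sub>R Y' r) * (indicator {a..c} s *\<^sub>R A s))"
    by (rule prod_int[OF Y'i Ai])
  then have int: "integrable (lborel \<Otimes>\<^sub>M lborel) (case_prod k)"
    by (rule Bochner_Integration.integrable_bound[OF _ meas]) (auto simp: k_def norm_mult)
  have FTC: "(LINT r|lborel. indicator {a..s} r *\<^sub>R Y' r) = Y s - Y a" if "s \<in> {a..c}" for s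
    using that by (intro integral_FTC_atLeastAtMost has_vector_derivative_within_subset[OF Y]
        continuous_on_subset[OF Y']) auto
  have "(LINT s|lborel. (LINT r|lborel. k r s)) = (LINT r|lborel. (LINT s|lborel. k r s))"
    by (rule lborel_pair.Fubini_integral[OF int])
  moreover have "(LINT s|lborel. (LINT r|lborel. k r s)) = (LINT s:{a..c}|lborel. A s * (Y s - Y a))"
    unfolding set_lebesgue_integral_def
  proof (intro Bochner_Integration.integral_cong refl)
    fix s
    have "(LINT r|lborel. k r s) = (LINT r|lborel. (indicator {a..c} s *\<^sub>R A s) * (indicator {a..s} r *\<^sub>R Y' r))"
      by (intro Bochner_Integration.integral_cong refl) (auto simp: k_def indicator_def)
    also have "\<dots> = (indicator {a..c} s *\<^sub>R A s) * (LINT r|lborel. indicator {a..s} r *\<^sub>R Y' r)"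
      by (rule integral_mult_right_zero)
    also have "\<dots> = indicator {a..c} s *\<^sub>R (A s * (Y s - Y a))"
      using FTC by (auto simp: indicator_def)
    finally show "(LINT r|lborel. k r s) = indicator {a..c} s *\<^sub>R (A s * (Y s - Y a))" .
  qed
  moreover have "(LINT r|lborel. (LINT s|lborel. k r s)) = (LINT r:{a..c}|lborel. (LINT s:{r..c}|lborel. A s) * Y' r)"
    unfolding set_lebesgue_integral_def
  proof (intro Bochner_Integration.integral_cong refl)
    fix r
    have "(LINT s|lborel. k r s) = (LINT s|lborel. (indicator {r..c} s *\<^sub>R A s) * (indicator {a..c} r *\<^sub>R Y' r))"
      by (intro Bochner_Integration.integral_cong refl) (auto simp: k_def indicator_def)
    also have "\<dots> = (LINT s|lborel. (indicator {r..c} s *\<^sub>R A s)) * (indicator {a..c} r *\<^sub>R Y' r)"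
      by (rule integral_mult_left_zero)
    finally show "(LINT s|lborel. k r s) = indicator {a..c} r *\<^sub>R ((LINT s|lborel. (indicator {r..c} s *\<^sub>R A s)) * Y' r)"
      by (simp add: indicator_def)
  qed
  ultimately show ?thesis by simp
qed

section \<open>Functions of finite weighted energy on the unit interval\<close>

lemma integral_inverse_power_le:
  assumes d: "3 \<le> (d::nat)" and r: "0 < r" "r \<le> 1"
  shows "(LINT s:{r..1}|lborel. 1 / s ^ (d - 1)) \<le> 1 / r ^ (d - 2)"
    and "set_integrable lborel {r..1} (\<lambda>s. 1 / s ^ (d - 1) :: real)"
proof -
  obtain n where n: "d = n + 3" using d by (metis add.commute le_Suc_ex)
  let ?P = "\<lambda>s::real. (- 1 / (n + 1)) * inverse s ^ (n + 1)"
  have cont: "continuous_on {r..1} (\<lambda>s. 1 / s ^ (d - 1) :: real)"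
    using r by (intro continuous_intros) auto
  show "set_integrable lborel {r..1} (\<lambda>s. 1 / s ^ (d - 1) :: real)"
    by (rule borel_integrable_atLeastAtMost'[OF cont])
  have "(LINT s:{r..1}|lborel. 1 / s ^ (d - 1)) = ?P 1 - ?P r"
    unfolding set_lebesgue_integral_def
  proof (rule integral_FTC_atLeastAtMost[OF r(2)])
    fix x assume x: "r \<le> x" "x \<le> 1"
    then have "x > 0" using r by auto
    then have "(?P has_real_derivative (- 1 / (n + 1)) * (real (n + 1) * (- (inverse x ^ Suc (Suc 0)) * inverse x ^ (n + 1 - Suc 0)))) (at x within {r..1})"
      by (intro DERIV_cmult DERIV_power DERIV_inverse DERIV_subset[OF DERIV_inverse]) auto
    also have "(- 1 / (n + 1)) * (real (n + 1) * (- (inverse x ^ Suc (Suc 0)) * inverse x ^ (n + 1 - Suc 0))) = 1 / x ^ (d - 1)"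
      using \<open>x > 0\<close> by (simp add: n field_simps)
    finally have "(?P has_real_derivative 1 / x ^ (d - 1)) (at x within {r..1})" .
    then show "(?P has_vector_derivative 1 / x ^ (d - 1)) (at x within {r..1})"
      by (simp add: has_real_derivative_iff_has_vector_derivative)
  qed (fact cont)
  also have "\<dots> \<le> 0 - ?P r" by simp
  also have "0 - ?P r = 1 / ((n + 1) * r ^ (n + 1))" by (simp add: power_inverse divide_inverse)
  also have "\<dots> \<le> 1 / (1 * r ^ (n + 1))"
    using r by (intro divide_left_mono mult_right_mono) auto
  finally show "(LINT s:{r..1}|lborel. 1 / s ^ (d - 1)) \<le> 1 / r ^ (d - 2)" by (simp add: n)
qed

text \<open>Young's inequality \<open>|A| \<le> l t |A|\<^sup>2 + 1 / (l t)\<close> with \<open>t = s\<^sup>d\<^sup>-\<^sup>1\<close> splits the integral into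
  a multiple of the energy and the integral of \<open>s\<^sup>1\<^sup>-\<^sup>d\<close>, which is at most \<open>r\<^sup>2\<^sup>-\<^sup>d\<close> for \<open>d \<ge> 3\<close>. The choice
  \<open>l = r\<^sup>-\<^sup>(\<^sup>d\<^sup>-\<^sup>2\<^sup>)\<^sup>/\<^sup>2\<close> gives both parts the same size.\<close>

lemma weighted_square_integrable_tail:
  fixes A :: "real \<Rightarrow> complex"
  assumes d: "3 \<le> d" and A: "set_borel_measurable borel {0<..<1} A"
    and K: "set_integrable lborel {0<..<1} (\<lambda>r. r ^ (d - 1) * (norm (A r))\<^sup>2)"
    and r: "0 < r" "r \<le> 1"
  shows "set_integrable lborel {r..1} A"
    and "norm (LINT s:{r..1}|lborel. A s) \<le>
      (1 + (LINT r:{0<..<1}|lborel. r ^ (d - 1) * (norm (A r))\<^sup>2)) / sqrt (r ^ (d - 2))"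
proof -
  let ?K = "LINT r:{0<..<1}|lborel. r ^ (d - 1) * (norm (A r))\<^sup>2"
  let ?l = "1 / sqrt (r ^ (d - 2))"
  have l: "?l > 0" using r by simp
  note pb = integral_inverse_power_le[OF d r]
  have Kr: "set_integrable lborel {r..<1} (\<lambda>r. r ^ (d - 1) * (norm (A r))\<^sup>2)"
    by (rule set_integrable_subset[OF K]) (use r in auto)
  have pbr: "set_integrable lborel {r..<1} (\<lambda>s. 1 / s ^ (d - 1) :: real)"
    by (rule set_integrable_subset[OF pb(2)]) auto
  have meas: "set_borel_measurable lborel {r..<1} A"
  proof -
    have "{r..<1} \<subseteq> {0<..<1}" using r by auto
    from set_borel_measurable_subset[OF A _ this] show ?thesis by (simp add: set_borel_measurable_def)
  qed
  have amgm: "x \<le> l * (t * x\<^sup>2) + (1 / l) * (1 / t)" if "0 < l" "0 < t" for l t x :: real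
  proof -
    have "0 \<le> (l * t * x - 1)\<^sup>2 + (l * t * x)\<^sup>2" by simp
    then have "x * (l * t) \<le> (l * (t * x\<^sup>2)) * (l * t) + 1"
      by (simp add: power2_eq_square algebra_simps)
    then have "x \<le> ((l * (t * x\<^sup>2)) * (l * t) + 1) / (l * t)"
      using that by (subst pos_le_divide_eq) auto
    also have "\<dots> = l * (t * x\<^sup>2) + (1 / l) * (1 / t)"
      using that by (simp add: add_divide_distrib)
    finally show ?thesis .
  qed
  have bnd: "norm (A s) \<le> ?l * (s ^ (d - 1) * (norm (A s))\<^sup>2) + (1 / ?l) * (1 / s ^ (d - 1))"
    if s: "s \<in> {r..<1}" for s
  proof -
    have s0: "s ^ (d - 1) > 0" using r s by auto
    show ?thesis by (rule amgm[OF l s0])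
  qed
  have ib: "set_integrable lborel {r..<1} (\<lambda>s. ?l * (s ^ (d - 1) * (norm (A s))\<^sup>2) + (1 / ?l) * (1 / s ^ (d - 1)))"
    by (intro set_integral_add(1) set_integrable_mult_right impI Kr pbr)
  have iA: "set_integrable lborel {r..<1} A"
    by (rule set_integrable_bound[OF ib meas]) (use bnd in \<open>auto simp del: times_divide_eq_left times_divide_eq_right intro: order.trans[OF _ abs_ge_self]\<close>)
  have ae: "AE s in lborel. indicator {r..<1} s *\<^sub>R A s = indicator {r..1} s *\<^sub>R A s"
    using AE_lborel_singleton[of "1::real"] by eventually_elim (auto simp: indicator_def)
  have "{r..1} = {r..<1} \<union> {1}" using r by auto
  have A1: "set_borel_measurable lborel {r..1} A"
  proof -
    have "(\<lambda>x. indicator {r..<1} x *\<^sub>R A x + indicator {1} x *\<^sub>R A 1) \<in> borel_measurable borel"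
      using meas by (auto simp: set_borel_measurable_def)
    also have "(\<lambda>x. indicator {r..<1} x *\<^sub>R A x + indicator {1} x *\<^sub>R A 1) = (\<lambda>x. indicator {r..1} x *\<^sub>R A x)"
      using r by (auto simp: indicator_def fun_eq_iff)
    finally show ?thesis by (simp add: set_borel_measurable_def)
  qed
  show "set_integrable lborel {r..1} A"
    using iA integrable_cong_AE[OF _ _ ae] A1 meas unfolding set_integrable_def set_borel_measurable_def by blast
  have "norm (LINT s:{r..1}|lborel. A s) = norm (LINT s:{r..<1}|lborel. A s)"
    unfolding set_lebesgue_integral_def using integral_cong_AE[OF _ _ ae] A1 meas
    unfolding set_borel_measurable_def by simp
  also have "\<dots> \<le> (LINT s:{r..<1}|lborel. norm (A s))"
    by (rule set_integral_norm_bound[OF iA])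
  also have "\<dots> \<le> (LINT s:{r..<1}|lborel. ?l * (s ^ (d - 1) * (norm (A s))\<^sup>2) + (1 / ?l) * (1 / s ^ (d - 1)))"
    by (rule set_integral_mono[OF set_integrable_norm[OF iA] ib bnd])
  also have "\<dots> = ?l * (LINT s:{r..<1}|lborel. s ^ (d - 1) * (norm (A s))\<^sup>2) + (1 / ?l) * (LINT s:{r..<1}|lborel. 1 / s ^ (d - 1))"
    by (subst set_integral_add(2)) (intro set_integrable_mult_right impI Kr pbr, intro set_integrable_mult_right impI Kr pbr, simp only: set_integral_mult_right)
  also have "\<dots> \<le> ?l * ?K + (1 / ?l) * (1 / r ^ (d - 2))"
  proof (intro add_mono mult_left_mono)
    show "(LINT s:{r..<1}|lborel. s ^ (d - 1) * (norm (A s))\<^sup>2) \<le> ?K"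
      by (rule set_integral_mono_subset[OF K]) (use r in \<open>auto\<close>)
    have "(LINT s:{r..<1}|lborel. 1 / s ^ (d - 1)) \<le> (LINT s:{r..1}|lborel. 1 / s ^ (d - 1))"
      by (rule set_integral_mono_subset[OF pb(2)]) (use r in \<open>auto\<close>)
    also note pb(1)
    finally show "(LINT s:{r..<1}|lborel. 1 / s ^ (d - 1)) \<le> 1 / r ^ (d - 2)" .
  qed (use l in auto)
  also have "(1 / ?l) * (1 / r ^ (d - 2)) = ?l"
  proof -
    have "sqrt (r ^ (d - 2)) * sqrt (r ^ (d - 2)) = r ^ (d - 2)" using r by simp
    then show ?thesis using r by (simp add: field_simps)
  qed
  finally show "norm (LINT s:{r..1}|lborel. A s) \<le> (1 + ?K) / sqrt (r ^ (d - 2))"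
    by (simp add: field_simps add_divide_distrib)
qed

text \<open>Finite energy halves the exponent of the growth \<open>r\<^sup>2\<^sup>-\<^sup>d\<close> that the fundamental solution has at the
  origin. This excludes the singular solutions of the radial equation.\<close>

lemma growth_of_primitive:
  fixes A :: "real \<Rightarrow> complex"
  assumes d: "3 \<le> d" and A: "set_borel_measurable borel {0<..<1} A"
    and K: "set_integrable lborel {0<..<1} (\<lambda>r. r ^ (d - 1) * (norm (A r))\<^sup>2)"
  obtains C where "\<And>r. r \<in> {0<..1} \<Longrightarrow> norm (c - (LINT s:{r..1}|lborel. A s)) * sqrt (r ^ (d - 2)) \<le> C"
proof
  fix r :: real assume r: "r \<in> {0<..1}"
  define K where "K = (LINT r:{0<..<1}|lborel. r ^ (d - 1) * (norm (A r))\<^sup>2)"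
  define q where "q = sqrt (r ^ (d - 2))"
  have q: "0 < q" "q \<le> 1" using r by (auto simp: power_le_one q_def)
  have "norm (c - (LINT s:{r..1}|lborel. A s)) \<le> norm c + (1 + K) / q"
    using norm_triangle_ineq4[of c "LINT s:{r..1}|lborel. A s"] weighted_square_integrable_tail(2)[OF d A K, of r] r
    by (auto simp: q_def K_def)
  moreover have K: "(1 + K) / q * q = 1 + K" using q by simp
  ultimately have "norm (c - (LINT s:{r..1}|lborel. A s)) * q \<le> (norm c + (1 + K) / q) * q"
    using q by (intro mult_right_mono) auto
  also have "\<dots> = norm c * q + (1 + K)" by (simp only: distrib_right K)
  also have "\<dots> \<le> norm c * 1 + (1 + K)" using q by (intro add_right_mono mult_left_mono) auto
  finally show "norm (c - (LINT s:{r..1}|lborel. A s)) * sqrt (r ^ (d - 2)) \<le> norm c * 1 + (1 + (LINT r:{0<..<1}|lborel. r ^ (d - 1) * (norm (A r))\<^sup>2))" by (simp add: q_def K_def)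
qed

lemma not_set_integrable_inverse: 
  assumes "c > 0" shows "\<not> set_integrable lborel {0<..<1} (\<lambda>r. c / r :: real)"
proof
  assume i: "set_integrable lborel {0<..<1} (\<lambda>r. c / r :: real)"
  let ?I = "LINT r:{0<..<1}|lborel. c / r"
  have b: "c * (ln b - ln a) \<le> ?I" if ab: "0 < a" "a < b" "b < 1" for a b
  proof -
    have "(LINT r:{a..b}|lborel. c / r) = c * ln b - c * ln a"
      unfolding set_lebesgue_integral_def
    proof (rule integral_FTC_atLeastAtMost)
      fix x assume x: "a \<le> x" "x \<le> b"
      then have "((\<lambda>x. c * ln x) has_real_derivative c / x) (at x within {a..b})"
        using ab by (auto intro!: derivative_eq_intros)
      then show "((\<lambda>x. c * ln x) has_vector_derivative c / x) (at x within {a..b})"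
        by (simp add: has_real_derivative_iff_has_vector_derivative)
    qed (use ab in \<open>auto intro!: continuous_intros\<close>)
    moreover have "(LINT r:{a..b}|lborel. c / r) \<le> ?I"
      by (rule set_integral_mono_subset[OF i]) (use assms ab in \<open>auto\<close>)
    ultimately show ?thesis by (simp add: algebra_simps)
  qed
  \<comment> \<open>Between \<open>exp (- t) / 2\<close> and \<open>1 / 2\<close> the integral is \<open>c t\<close>, which exceeds the supposed value.\<close>
  define t where "t = (\<bar>?I\<bar> + 1) / c"
  have t: "t > 0" using assms by (simp add: t_def add_nonneg_pos)
  have "c * (ln (1/2) - ln (exp (- t) / 2)) \<le> ?I"
    by (rule b) (use t in auto)
  also have "ln (exp (- t) / 2) = - t - ln 2" by (simp add: ln_div)
  finally have "c * t \<le> ?I" by (simp add: ln_div)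
  then show False using assms by (simp add: t_def)
qed

section \<open>The radial equation\<close>

text \<open>The derivative of \<open>F\<close>, recovered from the flux \<open>Q = r\<^sup>2\<^sup>k\<^sup>+\<^sup>d\<^sup>-\<^sup>1 (r\<^sup>-\<^sup>k F)'\<close>.\<close>

definition radial_slope :: "nat \<Rightarrow> nat \<Rightarrow> (real \<Rightarrow> complex) \<Rightarrow> (real \<Rightarrow> complex) \<Rightarrow> real \<Rightarrow> complex" where
  "radial_slope d k F Q r = of_real (1 / r ^ (d - 1 + k)) * Q r + of_real (real k / r) * F r"

text \<open>The equation \<open>F'' + (d-1)/r F' - k(k+d-2)/r\<^sup>2 F = V F\<close> on \<open>(0,1]\<close> as a first-order system for
  \<open>F\<close> and its flux \<open>Q\<close>. The potential is merely integrable near \<open>1\<close>, so that \<open>Q\<close> need not be differentiable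
  everywhere; hence the integrated form. The last condition is finite energy at the origin.\<close>

definition radial_solution :: "nat \<Rightarrow> nat \<Rightarrow> (real \<Rightarrow> complex) \<Rightarrow> (real \<Rightarrow> complex) \<Rightarrow> (real \<Rightarrow> complex) \<Rightarrow> bool" where
  "radial_solution d k V F Q \<longleftrightarrow>
     continuous_on {0<..1} F \<and> continuous_on {0<..1} Q \<and>
     (\<forall>r\<in>{0<..1}. F r = F 1 - (LINT s:{r..1}|lborel. radial_slope d k F Q s)) \<and>
     (\<forall>r\<in>{0<..1}. Q r = Q 1 - (LINT s:{r..1}|lborel. of_real (s ^ (d - 1 + k)) * V s * F s)) \<and>
     set_integrable lborel {0<..<1} (\<lambda>r. r ^ (d - 1) * (norm (radial_slope d k F Q r))\<^sup>2)"

text \<open>Let \<open>c\<close> be the infimum of the points to the right of which \<open>y\<close> vanishes. If \<open>a < c\<close>, then \<open>w\<close>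
  has mass less than one half on a short interval to the left of \<open>c\<close>, and the maximum of \<open>y\<close> on that
  interval is at most half of itself.\<close>

lemma gronwall_zero:
  fixes y w :: "real \<Rightarrow> real"
  assumes a: "a \<le> b" and y: "continuous_on {a..b} y" "\<And>r. r \<in> {a..b} \<Longrightarrow> 0 \<le> y r"
    and w: "set_integrable lborel {a..b} w" "\<And>r. r \<in> {a..b} \<Longrightarrow> 0 \<le> w r"
    and le: "\<And>r. r \<in> {a..b} \<Longrightarrow> y r \<le> (LINT s:{r..b}|lborel. w s * y s)"
  shows "\<forall>r\<in>{a..b}. y r = 0"
proof -
  have wint: "w integrable_on {a..b}" by (rule set_borel_integral_eq_integral(1)[OF w(1)])
  define T where "T = {r\<in>{a..b}. \<forall>s\<in>{r..b}. y s = 0}"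
  have yb: "y b = 0"
  proof -
    have "(LINT s:{b..b}|lborel. w s * y s) = 0"
      unfolding set_lebesgue_integral_def
      by (rule integral_eq_zero_AE) (use AE_lborel_singleton[of b] in \<open>eventually_elim, auto simp: indicator_def\<close>)
    then show ?thesis using le[of b] y(2)[of b] a by auto
  qed
  then have bT: "b \<in> T" using a by (auto simp: T_def)
  \<comment> \<open>\<open>y\<close> vanishes on the part of the interval to the right of \<open>c\<close>.\<close>
  define c where "c = Inf T"
  have bdd: "bdd_below T" by (auto simp: T_def bdd_below_def)
  have c: "a \<le> c" "c \<le> b" using bT bdd
    by (auto simp: c_def T_def intro!: cInf_greatest cInf_lower)
  have zero: "y s = 0" if s: "c < s" "s \<le> b" for s
  proof -
    obtain t where "t \<in> T" "t < s" using s bT cInf_lessD[of T s] unfolding c_def by blast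
    then show ?thesis using s by (auto simp: T_def)
  qed
  have "c = a"
  proof (rule ccontr)
    assume "c \<noteq> a"
    with c have ca: "a < c" by simp
    have "continuous_on {a..b} (\<lambda>r. integral {a..r} w)"
      by (rule indefinite_integral_continuous_1[OF wint])
    then have "continuous (at c within {a..b}) (\<lambda>r. integral {a..r} w)"
      using c by (auto simp: continuous_on_eq_continuous_within)
    then obtain dl where dl: "dl > 0" "\<And>x. x \<in> {a..b} \<Longrightarrow> dist x c < dl \<Longrightarrow> dist (integral {a..x} w) (integral {a..c} w) < 1/2"
      unfolding continuous_within_eps_delta by (metis half_gt_zero zero_less_one)
    define e where "e = max a (c - dl / 2)"
    have e: "a \<le> e" "e < c" "dist e c < dl" using ca dl by (auto simp: e_def dist_real_def)
    have we: "set_integrable lborel {e..c} w"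
      by (rule set_integrable_subset[OF w(1)]) (use e c in auto)
    have we2: "(LINT s:{e..c}|lborel. w s) < 1/2"
    proof -
      have "(LINT s:{e..c}|lborel. w s) = integral {e..c} w"
        by (rule set_borel_integral_eq_integral(2)[OF we])
      also have "integral {a..e} w + integral {e..c} w = integral {a..c} w"
        using e c by (intro Henstock_Kurzweil_Integration.integral_combine integrable_on_subinterval[OF wint]) auto
      then have "integral {e..c} w = integral {a..c} w - integral {a..e} w" by simp
      also have "\<dots> < 1/2"
      proof -
        have "\<bar>integral {a..e} w - integral {a..c} w\<bar> < 1/2"
          using dl(2)[of e] e c by (auto simp: dist_real_def)
        then show ?thesis by linarith
      qed
      finally show ?thesis .
    qed
    have "continuous_on {e..c} y" by (rule continuous_on_subset[OF y(1)]) (use e c in auto)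
    then obtain q where q: "q \<in> {e..c}" "\<And>s. s \<in> {e..c} \<Longrightarrow> y s \<le> y q"
      using continuous_attains_sup[of "{e..c}" y] e by auto
    have qab: "q \<in> {a..b}" using q e c by auto
    have wyint: "set_integrable lborel {q..c} (\<lambda>s. w s * y q)"
      by (intro set_integrable_mult_left impI set_integrable_subset[OF w(1)]) (use qab c in auto)
    have "y q \<le> (LINT s:{q..b}|lborel. w s * y s)" by (rule le[OF qab])
    also have "\<dots> = (LINT s:{q..c}|lborel. w s * y s)"
      unfolding set_lebesgue_integral_def
      by (intro Bochner_Integration.integral_cong refl) (use zero c q in \<open>auto simp: indicator_def\<close>)
    also have "\<dots> \<le> (LINT s:{q..c}|lborel. w s * y q)"
    proof (rule set_integral_mono[OF _ wyint])
      show "w s * y s \<le> w s * y q" if "s \<in> {q..c}" for s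
        using that q w(2)[of s] qab c by (intro mult_left_mono) auto
      have "set_borel_measurable lborel {q..c} w"
        using wint set_integrable_subset[OF w(1), of "{q..c}"] qab c
        by (auto simp: set_integrable_def set_borel_measurable_def)
      moreover have "set_borel_measurable borel {q..c} y"
        unfolding set_borel_measurable_def
        by (intro borel_measurable_continuous_on_indicator continuous_on_subset[OF y(1)]) (use qab c in auto)
      ultimately have "(\<lambda>x. (indicator {q..c} x *\<^sub>R w x) * (indicator {q..c} x *\<^sub>R y x)) \<in> borel_measurable borel"
        unfolding set_borel_measurable_def by auto
      also have "(\<lambda>x. (indicator {q..c} x *\<^sub>R w x) * (indicator {q..c} x *\<^sub>R y x)) = (\<lambda>x. indicator {q..c} x *\<^sub>R (w x * y x))"
        by (auto simp: indicator_def)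
      finally have m: "set_borel_measurable lborel {q..c} (\<lambda>s. w s * y s)"
        by (simp add: set_borel_measurable_def)
      show "set_integrable lborel {q..c} (\<lambda>s. w s * y s)"
      proof (rule set_integrable_bound[OF wyint m], intro AE_I2 impI)
        fix s assume s: "s \<in> {q..c}"
        then have "0 \<le> w s" "0 \<le> y s" "y s \<le> y q" using q w(2)[of s] y(2)[of s] qab c by auto
        then show "norm (w s * y s) \<le> norm (w s * y q)" by (simp add: mult_left_mono)
      qed
    qed
    also have "\<dots> = (LINT s:{q..c}|lborel. w s) * y q" by simp
    also have "\<dots> \<le> (1/2) * y q"
    proof (rule mult_right_mono)
      have "(LINT s:{q..c}|lborel. w s) \<le> (LINT s:{e..c}|lborel. w s)"
        by (rule set_integral_mono_subset[OF we]) (use q w(2) e c in \<open>auto\<close>)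
      then show "(LINT s:{q..c}|lborel. w s) \<le> 1/2" using we2 by simp
    qed (use y(2)[OF qab] in auto)
    finally have "y q = 0" using y(2)[OF qab] by simp
    then have "y s = 0" if "s \<in> {e..b}" for s
      using that q(2)[of s] zero[of s] y(2)[of s] e by force
    then have "e \<in> T" using e c by (auto simp: T_def)
    then have "c \<le> e" unfolding c_def by (rule cInf_lower[OF _ bdd])
    with e show False by simp
  qed
  moreover have "y a = 0"
  proof (rule antisym)
    have "(LINT s:{a..b}|lborel. w s * y s) = 0"
      unfolding set_lebesgue_integral_def
    proof (rule integral_eq_zero_AE)
      show "AE s in lborel. indicator {a..b} s *\<^sub>R (w s * y s) = 0"
        using AE_lborel_singleton[of a] by eventually_elim (use zero \<open>c = a\<close> in \<open>auto simp: indicator_def\<close>)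
    qed
    then show "y a \<le> 0" using le[of a] a by auto
  qed (use y(2) a in auto)
  ultimately show ?thesis using zero by (metis atLeastAtMost_iff order_le_less)
qed

lemma set_integrable_away_from_zero:
  fixes V :: "real \<Rightarrow> complex"
  assumes V[measurable]: "V \<in> borel_measurable borel" and rV: "set_integrable lborel {0<..<1} (\<lambda>r. of_real r * V r)"
    and a: "0 < a" and g: "continuous_on {a..1} g"
  shows "set_integrable lborel {a..1} (\<lambda>s. V s * g s)"
proof -
  obtain B where B: "\<And>s. s \<in> {a..1} \<Longrightarrow> norm (g s) \<le> B"
    using compact_imp_bounded[OF compact_continuous_image[OF g]] by (force simp: bounded_iff)
  have m: "set_borel_measurable borel {a..1} (\<lambda>s. V s * g s)"
  proof -
    define h where "h = (\<lambda>s. indicator {a..1} s *\<^sub>R g s)"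
    have [measurable]: "h \<in> borel_measurable borel"
      using borel_measurable_continuous_on_indicator[OF _ g] by (simp add: h_def)
    have "(\<lambda>s. V s * h s) \<in> borel_measurable borel" by measurable
    then show ?thesis by (simp add: set_borel_measurable_def h_def)
  qed
  have i: "integrable lborel (\<lambda>s. (B / a) *\<^sub>R (indicator {0<..<1} s *\<^sub>R (of_real s * V s)))"
    using rV by (intro integrable_scaleR_right) (simp add: set_integrable_def)
  show ?thesis unfolding set_integrable_def
  proof (rule Bochner_Integration.integrable_bound[OF i])
    show "(\<lambda>s. indicator {a..1} s *\<^sub>R (V s * g s)) \<in> borel_measurable lborel"
      using m by (simp add: set_borel_measurable_def)
    show "AE s in lborel. norm (indicator {a..1} s *\<^sub>R (V s * g s)) \<le> norm ((B / a) *\<^sub>R (indicator {0<..<1} s *\<^sub>R (of_real s * V s)))"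
      using AE_lborel_singleton[of "1::real"]
    proof eventually_elim
      fix s :: real assume s1: "s \<noteq> 1"
      show "norm (indicator {a..1} s *\<^sub>R (V s * g s)) \<le> norm ((B / a) *\<^sub>R (indicator {0<..<1} s *\<^sub>R (of_real s * V s)))"
      proof (cases "s \<in> {a..1}")
        case True
        then have "0 \<le> B" using B[OF True] norm_ge_zero order_trans by blast
        moreover have "norm (V s) * norm (g s) \<le> norm (V s) * (B * (s / a))"
        proof (intro mult_left_mono)
          have "norm (g s) \<le> B * 1" using B[OF True] by simp
          also have "\<dots> \<le> B * (s / a)" using True a \<open>0 \<le> B\<close> by (intro mult_left_mono) auto
          finally show "norm (g s) \<le> B * (s / a)" .
        qed auto
        ultimately show ?thesis using True s1 a by (auto simp: norm_mult field_simps)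
      qed auto
    qed
  qed
qed

lemma radial_solutionD:
  assumes "radial_solution d k V F Q"
  shows "continuous_on {0<..1} F" "continuous_on {0<..1} Q"
    and "r \<in> {0<..1} \<Longrightarrow> F r = F 1 - (LINT s:{r..1}|lborel. radial_slope d k F Q s)"
    and "r \<in> {0<..1} \<Longrightarrow> Q r = Q 1 - (LINT s:{r..1}|lborel. of_real (s ^ (d - 1 + k)) * V s * F s)"
    and "set_integrable lborel {0<..<1} (\<lambda>r. r ^ (d - 1) * (norm (radial_slope d k F Q r))\<^sup>2)"
  using assms unfolding radial_solution_def by blast+

text \<open>Division by \<open>r\<^sup>k\<close> cancels the term \<open>k F / r\<close> of the slope; the derivative of \<open>r\<^sup>-\<^sup>k F\<close> is a
  positive multiple of the flux alone.\<close>

lemma radial_solution_derivative: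
  assumes F: "radial_solution d k V F Q" and a: "0 < a"
  shows "continuous_on {a..1} F" "continuous_on {a..1} Q" "continuous_on {a..1} (radial_slope d k F Q)"
    and "r \<in> {a..1} \<Longrightarrow> (F has_vector_derivative radial_slope d k F Q r) (at r within {a..1})"
    and "r \<in> {a..1} \<Longrightarrow> ((\<lambda>s. inverse (s ^ k) *\<^sub>R F s) has_vector_derivative (1 / r ^ (d - 1 + 2 * k)) *\<^sub>R Q r) (at r within {a..1})"
proof -
  have sub: "{a..1} \<subseteq> {0<..1}" using a by auto
  show cF: "continuous_on {a..1} F" and cQ: "continuous_on {a..1} Q"
    using continuous_on_subset[OF _ sub] radial_solutionD(1,2)[OF F] by blast+
  show cA: "continuous_on {a..1} (radial_slope d k F Q)"
    unfolding radial_slope_def using a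
    by (intro continuous_intros cF cQ continuous_on_of_real) auto
  let ?A = "radial_slope d k F Q"
  have Fr: "F s = (F 1 - integral {a..1} ?A) + integral {a..s} ?A" if s: "s \<in> {a..1}" for s
  proof -
    have "F s = F 1 - (LINT s:{s..1}|lborel. ?A s)"
      using s sub by (intro radial_solutionD(3)[OF F]) auto
    also have "(LINT s:{s..1}|lborel. ?A s) = integral {s..1} ?A"
      by (intro set_borel_integral_eq_integral borel_integrable_atLeastAtMost' continuous_on_subset[OF cA])
        (use s in auto)
    also have "integral {a..s} ?A + integral {s..1} ?A = integral {a..1} ?A"
      using s by (intro Henstock_Kurzweil_Integration.integral_combine integrable_continuous_real cA) auto
    then have "integral {s..1} ?A = integral {a..1} ?A - integral {a..s} ?A" by (simp add: algebra_simps)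
    finally show ?thesis by simp
  qed
  {
  assume r: "r \<in> {a..1}"
  have dI: "((\<lambda>s. (F 1 - integral {a..1} ?A) + integral {a..s} ?A) has_vector_derivative (0 + ?A r)) (at r within {a..1})"
    by (intro has_vector_derivative_add has_vector_derivative_const integral_has_vector_derivative cA r)
  show dF: "(F has_vector_derivative ?A r) (at r within {a..1})"
    by (rule has_vector_derivative_transform[OF r Fr, OF _ dI[unfolded add_0_left]])
  have r0: "r > 0" using a r by auto
  have "((\<lambda>s. inverse (s ^ k) *\<^sub>R F s) has_vector_derivative
     (inverse (r ^ k) *\<^sub>R ?A r + (- (real k * inverse (r ^ (k + 1)))) *\<^sub>R F r)) (at r within {a..1})"
  proof (rule has_vector_derivative_scaleR[OF _ dF])
    show "((\<lambda>s. inverse (s ^ k)) has_real_derivative - (real k * inverse (r ^ (k + 1)))) (at r within {a..1})"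
    proof -
      have "((\<lambda>s. inverse s ^ k) has_real_derivative real k * (- (inverse r ^ Suc (Suc 0)) * inverse r ^ (k - Suc 0))) (at r within {a..1})"
        using r0 by (intro DERIV_power DERIV_subset[OF DERIV_inverse]) auto
      also have "real k * (- (inverse r ^ Suc (Suc 0)) * inverse r ^ (k - Suc 0)) = - (real k * inverse (r ^ (k + 1)))"
        by (cases k) (auto simp: power_inverse)
      finally show ?thesis by (simp add: power_inverse)
    qed
  qed
  also have "inverse (r ^ k) *\<^sub>R ?A r + (- (real k * inverse (r ^ (k + 1)))) *\<^sub>R F r = (1 / r ^ (d - 1 + 2 * k)) *\<^sub>R Q r"
    using r0 by (simp add: radial_slope_def scaleR_conv_of_real field_simps power_add mult_2 mult_2_right)
  finally show "((\<lambda>s. inverse (s ^ k) *\<^sub>R F s) has_vector_derivative (1 / r ^ (d - 1 + 2 * k)) *\<^sub>R Q r) (at r within {a..1})" .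
  }
qed

text \<open>Integration by parts of \<open>Q1\<close> against \<open>r\<^sup>-\<^sup>k F2\<close>. The right-hand side is symmetric in the two
  solutions, so the difference of this identity and the one with exchanged roles says that the Wronskian
  takes the same value at \<open>a\<close> and at \<open>1\<close>.\<close>

lemma wronskian_half:
  assumes V: "V \<in> borel_measurable borel" "set_integrable lborel {0<..<1} (\<lambda>r. of_real r * V r)"
    and s1: "radial_solution d k V F1 Q1" and s2: "radial_solution d k V F2 Q2"
    and a: "0 < a" "a \<le> 1"
  shows "Q1 1 * F2 1 - Q1 a * (inverse (a ^ k) *\<^sub>R F2 a) =
     (LINT s:{a..1}|lborel. (1 / s ^ (d - 1 + 2 * k)) *\<^sub>R (Q1 s * Q2 s)) +
     (LINT s:{a..1}|lborel. (s ^ (d - 1 + k) * inverse (s ^ k)) *\<^sub>R (V s * (F1 s * F2 s)))"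
proof -
  let ?b = "\<lambda>s. of_real (s ^ (d - 1 + k)) * V s * F1 s"
  let ?f = "\<lambda>s. inverse (s ^ k) *\<^sub>R F2 s" and ?f' = "\<lambda>s. (1 / s ^ (d - 1 + 2 * k)) *\<^sub>R Q2 s"
  note c1 = radial_solution_derivative(1,2)[OF s1 a(1)]
  note c2 = radial_solution_derivative(1,2,5)[OF s2 a(1)]
  have cf': "continuous_on {a..1} ?f'" using a c2 by (auto intro!: continuous_intros)
  have cf: "continuous_on {a..1} ?f" using a c2(1) by (intro continuous_intros) auto
  have b: "set_integrable lborel {a..1} ?b"
  proof -
    have "set_integrable lborel {a..1} (\<lambda>s. V s * (of_real (s ^ (d - 1 + k)) * F1 s))"
      using a c1 by (intro set_integrable_away_from_zero[OF V]) (auto intro!: continuous_intros)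
    then show ?thesis by (simp add: mult_ac)
  qed
  have bf: "set_integrable lborel {a..1} (\<lambda>s. ?b s * ?f s)"
  proof -
    have "set_integrable lborel {a..1} (\<lambda>s. V s * (of_real (s ^ (d - 1 + k)) * F1 s * ?f s))"
      by (intro set_integrable_away_from_zero[OF V a(1)] continuous_on_mult continuous_on_of_real
          continuous_on_power continuous_on_id c1 cf)
    then show ?thesis by (simp add: mult_ac)
  qed
  have Q: "(LINT s:{r..1}|lborel. ?b s) = Q1 1 - Q1 r" if "r \<in> {a..1}" for r
    using radial_solutionD(4)[OF s1, of r] that a by simp
  have f'i: "set_integrable lborel {a..1} ?f'" "set_integrable lborel {a..1} (\<lambda>s. Q1 s * ?f' s)"
    by (intro borel_integrable_atLeastAtMost' continuous_on_mult c1 cf')+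
  have "(LINT r:{a..1}|lborel. (LINT s:{r..1}|lborel. ?b s) * ?f' r) = (LINT s:{a..1}|lborel. ?b s * (?f s - ?f a))"
    by (rule integral_by_parts_indefinite[OF a(2) b c2(3) cf']) auto
  also have "\<dots> = (LINT s:{a..1}|lborel. ?b s * ?f s - ?b s * ?f a)"
    by (simp add: right_diff_distrib)
  also have "\<dots> = (LINT s:{a..1}|lborel. ?b s * ?f s) - (LINT s:{a..1}|lborel. ?b s) * ?f a"
    by (subst set_integral_diff) (use b bf in auto)
  finally have 1: "(LINT r:{a..1}|lborel. (LINT s:{r..1}|lborel. ?b s) * ?f' r) = 
     (LINT s:{a..1}|lborel. ?b s * ?f s) - (Q1 1 - Q1 a) * ?f a" using Q[of a] a by simp
  have "(LINT r:{a..1}|lborel. (LINT s:{r..1}|lborel. ?b s) * ?f' r) = (LINT r:{a..1}|lborel. Q1 1 * ?f' r - Q1 r * ?f' r)"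
    by (rule set_lebesgue_integral_cong) (simp, intro allI impI, simp only: Q left_diff_distrib)
  also have "\<dots> = Q1 1 * (LINT r:{a..1}|lborel. ?f' r) - (LINT r:{a..1}|lborel. Q1 r * ?f' r)"
    by (subst set_integral_diff(2)[OF _ f'i(2)]) (intro set_integrable_mult_right impI f'i(1), simp only: set_integral_mult_right)
  also have "(LINT r:{a..1}|lborel. ?f' r) = ?f 1 - ?f a"
    unfolding set_lebesgue_integral_def by (rule integral_FTC_atLeastAtMost[OF a(2)]) (use c2(3) cf' in auto)
  finally have "Q1 1 * (?f 1 - ?f a) - (LINT r:{a..1}|lborel. Q1 r * ?f' r) = (LINT s:{a..1}|lborel. ?b s * ?f s) - (Q1 1 - Q1 a) * ?f a"
    using 1 by simp
  then have "Q1 1 * ?f 1 - Q1 a * ?f a = (LINT r:{a..1}|lborel. Q1 r * ?f' r) + (LINT s:{a..1}|lborel. ?b s * ?f s)"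
    by (simp add: algebra_simps)
  moreover have "(\<lambda>r. Q1 r * ?f' r) = (\<lambda>s. (1 / s ^ (d - 1 + 2 * k)) *\<^sub>R (Q1 s * Q2 s))" by simp
  moreover have "(\<lambda>s. ?b s * ?f s) = (\<lambda>s. (s ^ (d - 1 + k) * inverse (s ^ k)) *\<^sub>R (V s * (F1 s * F2 s)))"
    by (simp add: scaleR_conv_of_real mult_ac)
  ultimately show ?thesis by simp
qed

text \<open>The Wronskian \<open>W\<close> is constant. By the growth bound for finite energy, \<open>|W|\<^sup>2/r\<close> is at most a
  multiple of \<open>r\<^sup>d\<^sup>-\<^sup>1 (|F1'|\<^sup>2 + |F2'|\<^sup>2)\<close>, which is integrable on \<open>(0,1)\<close>; so \<open>W = 0\<close>. At \<open>1\<close> the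
  Wronskian is \<open>Q1 1 * F2 1\<close>. Hence the flux of \<open>F1\<close> also vanishes at \<open>1\<close>, and Gronwall's lemma applies to
  \<open>|F1| + |Q1|\<close>.\<close>

theorem radial_solution_unique:
  assumes d: "3 \<le> d"
    and V: "V \<in> borel_measurable borel" "set_integrable lborel {0<..<1} (\<lambda>r. of_real r * V r)"
    and s1: "radial_solution d k V F1 Q1" and s2: "radial_solution d k V F2 Q2"
    and F1: "F1 1 = 0" and F2: "F2 1 \<noteq> 0"
  shows "\<forall>r\<in>{0<..1}. F1 r = 0"
proof -
  let ?A1 = "radial_slope d k F1 Q1" and ?A2 = "radial_slope d k F2 Q2"
  define W where "W = Q1 1 * F2 1"
  have W_const: "W = (r ^ (d - 1)) *\<^sub>R (?A1 r * F2 r - ?A2 r * F1 r)" if r: "r \<in> {0<..1}" for r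
  proof -
    have "Q1 1 * F2 1 - Q1 r * (inverse (r ^ k) *\<^sub>R F2 r) = Q2 1 * F1 1 - Q2 r * (inverse (r ^ k) *\<^sub>R F1 r)"
      using r by (subst wronskian_half[OF V s1 s2], simp, simp) (subst wronskian_half[OF V s2 s1], simp, simp, simp add: mult_ac)
    then have "W = inverse (r ^ k) *\<^sub>R (Q1 r * F2 r - Q2 r * F1 r)"
      using F1 by (simp add: W_def scaleR_diff_right algebra_simps)
    also have "\<dots> = (r ^ (d - 1)) *\<^sub>R (?A1 r * F2 r - ?A2 r * F1 r)"
      using r by (simp add: radial_slope_def scaleR_conv_of_real field_simps power_add)
    finally show ?thesis .
  qed
  have meas: "set_borel_measurable borel {0<..<1} (radial_slope d k F Q)" if "radial_solution d k V F Q" for F Q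
  proof (rule set_borel_measurable_continuous_subset)
    show "continuous_on {0<..1} (radial_slope d k F Q)"
      unfolding radial_slope_def
      by (intro continuous_intros continuous_on_of_real radial_solutionD(1,2)[OF that]) auto
  qed auto
  have bound: "\<exists>C. \<forall>r\<in>{0<..1}. r ^ (d - 2) * (norm (F r))\<^sup>2 \<le> C" if s: "radial_solution d k V F Q" for F Q
  proof -
    obtain C where C: "\<And>r. r \<in> {0<..1} \<Longrightarrow> norm (F 1 - (LINT s:{r..1}|lborel. radial_slope d k F Q s)) * sqrt (r ^ (d - 2)) \<le> C"
      using growth_of_primitive[OF d meas[OF s] radial_solutionD(5)[OF s]] by blast
    have "r ^ (d - 2) * (norm (F r))\<^sup>2 \<le> C\<^sup>2" if r: "r \<in> {0<..1}" for r
    proof -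
      have "norm (F r) * sqrt (r ^ (d - 2)) \<le> C" using C[OF r] radial_solutionD(3)[OF s r] by simp
      then have "(norm (F r) * sqrt (r ^ (d - 2)))\<^sup>2 \<le> C\<^sup>2"
        using r by (intro power_mono) auto
      then show ?thesis using r by (simp add: power_mult_distrib mult_ac)
    qed
    then show ?thesis by blast
  qed
  obtain C1 C2 where C1: "\<And>r. r\<in>{0<..1} \<Longrightarrow> r ^ (d - 2) * (norm (F1 r))\<^sup>2 \<le> C1"
    and C2: "\<And>r. r\<in>{0<..1} \<Longrightarrow> r ^ (d - 2) * (norm (F2 r))\<^sup>2 \<le> C2"
    using bound[OF s1] bound[OF s2] by blast
  have "W = 0"
  proof (rule ccontr)
    assume W: "W \<noteq> 0"
    let ?g = "\<lambda>r. (2 * C2) * (r ^ (d - 1) * (norm (?A1 r))\<^sup>2) + (2 * C1) * (r ^ (d - 1) * (norm (?A2 r))\<^sup>2)"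
    have g: "set_integrable lborel {0<..<1} ?g"
      by (intro set_integral_add(1) set_integrable_mult_right impI radial_solutionD(5)[OF s1] radial_solutionD(5)[OF s2])
    have le: "(norm W)\<^sup>2 / r \<le> ?g r" if r: "r \<in> {0<..<1}" for r
    proof -
      let ?x = "norm (?A1 r) * norm (F2 r)" and ?y = "norm (?A2 r) * norm (F1 r)"
      have "norm W \<le> r ^ (d - 1) * (?x + ?y)"
        using W_const[of r] r norm_triangle_ineq4[of "?A1 r * F2 r" "?A2 r * F1 r"] by (simp add: norm_mult mult_left_mono)
      then have "(norm W)\<^sup>2 \<le> (r ^ (d - 1) * (?x + ?y))\<^sup>2" by (intro power_mono) auto
      also have "\<dots> \<le> (r ^ (d - 1))\<^sup>2 * (2 * ?x\<^sup>2 + 2 * ?y\<^sup>2)"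
      proof -
        have "0 \<le> (?x - ?y)\<^sup>2" by simp
        then have "(?x + ?y)\<^sup>2 \<le> 2 * ?x\<^sup>2 + 2 * ?y\<^sup>2" unfolding power2_sum power2_diff by linarith
        then show ?thesis by (simp add: power_mult_distrib mult_left_mono)
      qed
      also have "(r ^ (d - 1))\<^sup>2 = r * (r ^ (d - 1) * r ^ (d - 2))"
      proof -
        obtain n where "d = n + 2" using d by (metis add.commute le_Suc_ex numeral_2_eq_2 Suc_leD numeral_3_eq_3)
        then show ?thesis by (simp add: power2_eq_square)
      qed
      finally have "(norm W)\<^sup>2 / r \<le> (r ^ (d - 1) * r ^ (d - 2)) * (2 * ?x\<^sup>2 + 2 * ?y\<^sup>2)"
        using r by (simp add: divide_le_eq mult_ac)
      also have "\<dots> = 2 * (r ^ (d - 2) * (norm (F2 r))\<^sup>2) * (r ^ (d - 1) * (norm (?A1 r))\<^sup>2)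
          + 2 * (r ^ (d - 2) * (norm (F1 r))\<^sup>2) * (r ^ (d - 1) * (norm (?A2 r))\<^sup>2)"
        by (simp add: power_mult_distrib algebra_simps)
      also have "\<dots> \<le> 2 * C2 * (r ^ (d - 1) * (norm (?A1 r))\<^sup>2) + 2 * C1 * (r ^ (d - 1) * (norm (?A2 r))\<^sup>2)"
        using C1[of r] C2[of r] r by (intro add_mono mult_right_mono mult_left_mono) auto
      finally show ?thesis .
    qed
    have m: "set_borel_measurable lborel {0<..<1} (\<lambda>r. (norm W)\<^sup>2 / r)"
      unfolding set_borel_measurable_def by measurable
    have "set_integrable lborel {0<..<1} (\<lambda>r. (norm W)\<^sup>2 / r)"
    proof (rule set_integrable_bound[OF g m], intro AE_I2 impI)
      fix r :: real assume r: "r \<in> {0<..<1}"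
      then have "norm ((norm W)\<^sup>2 / r) = (norm W)\<^sup>2 / r" by simp
      also have "\<dots> \<le> norm (?g r)" using le[OF r] unfolding real_norm_def by (rule order_trans[OF _ abs_ge_self])
      finally show "norm ((norm W)\<^sup>2 / r) \<le> norm (?g r)" .
    qed
    then show False using not_set_integrable_inverse[of "(norm W)\<^sup>2"] W by auto
  qed
  then have Q1: "Q1 1 = 0" using F2 by (simp add: W_def)
  show ?thesis
  proof
    fix a :: real assume a: "a \<in> {0<..1}"
    let ?b = "\<lambda>s. of_real (s ^ (d - 1 + k)) * V s * F1 s"
    let ?y = "\<lambda>s. norm (F1 s) + norm (Q1 s)"
    let ?w = "\<lambda>s. 1 / s ^ (d - 1 + k) + real k / s + s ^ (d - 1 + k) * norm (V s)"
    have a0: "0 < a" "a \<le> 1" using a by auto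
    note c1 = radial_solution_derivative(1,2)[OF s1 a0(1)] and cA = radial_solution_derivative(3)[OF s1 a0(1)]
    have w1: "set_integrable lborel {a..1} (\<lambda>s. V s * of_real (s ^ (d - 1 + k)))"
      using a0 by (intro set_integrable_away_from_zero[OF V]) (auto intro!: continuous_intros)
    have w2: "set_integrable lborel {a..1} (\<lambda>s. s ^ (d - 1 + k) * norm (V s))"
      by (rule set_integrable_norm[OF w1, THEN set_integrable_cong[THEN iffD1, rotated -1]])
        (use a0 in \<open>auto simp: norm_mult norm_power\<close>)
    have w: "set_integrable lborel {a..1} ?w"
      using a0 by (intro set_integral_add(1) w2 borel_integrable_atLeastAtMost') (auto intro!: continuous_intros)
    have "\<forall>r\<in>{a..1}. ?y r = 0"
    proof (rule gronwall_zero[OF a0(2) _ _ w])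
      show "continuous_on {a..1} ?y" using c1 a0 by (auto intro!: continuous_intros)
      show "0 \<le> ?w r" if "r \<in> {a..1}" for r using that a0 by simp
      fix r assume r: "r \<in> {a..1}"
      have sub: "{r..1} \<subseteq> {a..1}" using r by auto
      have bi: "set_integrable lborel {r..1} ?b"
      proof -
        have "set_integrable lborel {a..1} (\<lambda>s. V s * (of_real (s ^ (d - 1 + k)) * F1 s))"
          using a c1 by (intro set_integrable_away_from_zero[OF V]) (auto intro!: continuous_intros)
        then have "set_integrable lborel {a..1} ?b" by (simp add: mult_ac)
        then show ?thesis by (rule set_integrable_subset[OF _ _ sub]) auto
      qed
      have Ai: "set_integrable lborel {r..1} ?A1"
        by (rule borel_integrable_atLeastAtMost'[OF continuous_on_subset[OF cA sub]])
      have yi: "set_integrable lborel {r..1} (\<lambda>s. ?w s * ?y s)"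
      proof -
        have "set_integrable lborel {a..1} (\<lambda>s. V s * of_real (s ^ (d - 1 + k) * ?y s))"
          using a c1 by (intro set_integrable_away_from_zero[OF V]) (auto intro!: continuous_intros)
        from set_integrable_norm[OF this] have "set_integrable lborel {a..1} (\<lambda>s. s ^ (d - 1 + k) * norm (V s) * ?y s)"
          by (rule set_integrable_cong[THEN iffD1, rotated -1]) (use a0 in \<open>auto simp: norm_mult norm_power abs_mult simp del: of_real_add of_real_mult\<close>)
        moreover have "set_integrable lborel {a..1} (\<lambda>s. (1 / s ^ (d - 1 + k) + real k / s) * ?y s)"
          using a0 c1 by (intro borel_integrable_atLeastAtMost') (auto intro!: continuous_intros)
        ultimately have "set_integrable lborel {a..1} (\<lambda>s. (1 / s ^ (d - 1 + k) + real k / s) * ?y s + s ^ (d - 1 + k) * norm (V s) * ?y s)"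
          by (intro set_integral_add(1))
        then have "set_integrable lborel {a..1} (\<lambda>s. ?w s * ?y s)" by (simp only: distrib_right)
        then show ?thesis by (rule set_integrable_subset[OF _ _ sub]) auto
      qed
      have "?y r \<le> norm (LINT s:{r..1}|lborel. ?A1 s) + norm (LINT s:{r..1}|lborel. ?b s)"
        using radial_solutionD(3,4)[OF s1, of r] r a0 F1 Q1 by simp
      also have "\<dots> \<le> (LINT s:{r..1}|lborel. norm (?A1 s)) + (LINT s:{r..1}|lborel. norm (?b s))"
        by (intro add_mono set_integral_norm_bound bi Ai)
      also have "\<dots> = (LINT s:{r..1}|lborel. norm (?A1 s) + norm (?b s))"
        by (rule set_integral_add(2)[symmetric]; intro set_integrable_norm bi Ai)
      also have "\<dots> \<le> (LINT s:{r..1}|lborel. ?w s * ?y s)"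
      proof (rule set_integral_mono[OF _ yi])
        show "set_integrable lborel {r..1} (\<lambda>s. norm (?A1 s) + norm (?b s))"
          by (intro set_integral_add(1) set_integrable_norm bi Ai)
        fix s assume "s \<in> {r..1}"
        then have s: "s > 0" using r a0 by auto
        have "norm (?A1 s) \<le> 1 / s ^ (d - 1 + k) * norm (Q1 s) + real k / s * norm (F1 s)"
          unfolding radial_slope_def using s by (intro norm_triangle_mono) (auto simp: norm_mult norm_divide norm_power)
        moreover have "norm (?b s) = s ^ (d - 1 + k) * norm (V s) * norm (F1 s)"
          using s by (simp add: norm_mult norm_power)
        moreover have "0 \<le> 1 / s ^ (d - 1 + k) * norm (F1 s)" "0 \<le> real k / s * norm (Q1 s)"
            "0 \<le> s ^ (d - 1 + k) * norm (V s) * norm (Q1 s)" using s by auto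
        ultimately show "norm (?A1 s) + norm (?b s) \<le> ?w s * ?y s"
          unfolding distrib_left distrib_right by linarith
      qed
      finally show "?y r \<le> (LINT s:{r..1}|lborel. ?w s * ?y s)" .
    qed auto
    then have "?y a = 0" using a0 by auto
    then show "F1 a = 0" by (simp add: add_nonneg_eq_0_iff)
  qed
qed

section \<open>Polar coordinates\<close>

definition radial_measure :: "nat \<Rightarrow> real measure" where
  "radial_measure d = density lborel (\<lambda>r. ennreal (indicator {0<..<1} r * r ^ (d - 1)))"

lemma space_sphere_measure: "space (sphere_measure :: 'a::euclidean_space measure) = sphere 0 1"
  and sets_sphere_measure: "sets (sphere_measure :: 'a::euclidean_space measure) = sets (restrict_space borel (sphere 0 1))"
  by (simp_all add: sphere_measure_def space_scale_measure space_restrict_space)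

lemma borel_measurable_sgn_euclidean [measurable]: "(sgn :: 'a::euclidean_space \<Rightarrow> 'a) \<in> borel_measurable borel"
  by (simp add: sgn_div_norm[abs_def])

lemma finite_sphere_measure: "finite_measure (sphere_measure :: 'a::euclidean_space measure)"
proof
  have "emeasure sphere_measure (sphere 0 1 :: 'a set) =
     of_nat DIM('a) * emeasure lborel {x \<in> ball 0 1 - {0} :: 'a set. sgn x \<in> sphere 0 1}"
    by (rule emeasure_sphere_measure) auto
  also have "\<dots> \<le> of_nat DIM('a) * emeasure lborel (ball 0 1 :: 'a set)"
    by (intro mult_left_mono emeasure_mono) auto
  also have "\<dots> < \<infinity>" using emeasure_lborel_ball_finite[of "0::'a" 1] by (auto simp: ennreal_mult_less_top of_nat_less_top)
  finally show "emeasure sphere_measure (space sphere_measure :: 'a set) \<noteq> \<infinity>"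
    by (simp add: space_sphere_measure)
qed

text \<open>Up to the null sphere of radius \<open>x\<close>, the truncated cone is the image of the unit cone under the
  dilation by \<open>x\<close>.\<close>

lemma emeasure_truncated_cone:
  fixes C :: "'a::euclidean_space set"
  assumes C[measurable]: "C \<in> sets borel" and x: "0 < x" "x \<le> 1"
  shows "emeasure lborel {y \<in> ball 0 1 - {0}. norm y \<le> x \<and> sgn y \<in> C}
       = ennreal (x ^ DIM('a)) * emeasure lborel {y \<in> ball 0 1 - {0}. sgn y \<in> C}"
proof -
  let ?A = "{y::'a. 0 < norm y \<and> norm y < x \<and> sgn y \<in> C}"
  have A[measurable]: "?A \<in> sets borel" by measurable
  have "emeasure lborel {y \<in> ball 0 1 - {0}. norm y \<le> x \<and> sgn y \<in> C} = emeasure lborel ?A"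
  proof (rule emeasure_eq_AE)
    have "sphere (0::'a) x \<in> null_sets lborel" "sphere (0::'a) 1 \<in> null_sets lborel"
      using negligible_sphere by (auto simp: negligible_iff_null_sets null_sets_completion_iff)
    from this[THEN AE_not_in]
    show "AE y in lborel. y \<in> {y \<in> ball 0 1 - {0}. norm y \<le> x \<and> sgn y \<in> C} \<longleftrightarrow> y \<in> ?A"
      by eventually_elim (use x in \<open>auto simp: order_le_less\<close>)
  qed auto
  also have "\<dots> = emeasure (density (distr lborel borel (\<lambda>y. 0 + x *\<^sub>R y)) (\<lambda>_. ennreal (\<bar>x\<bar> ^ DIM('a)))) ?A"
    using lborel_affine[of x "0::'a"] x by simp
  also have "\<dots> = ennreal (\<bar>x\<bar> ^ DIM('a)) * emeasure (distr lborel borel (\<lambda>y. 0 + x *\<^sub>R y)) ?A"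
    by (subst emeasure_density) (auto simp: nn_integral_cmult_indicator)
  also have "emeasure (distr lborel borel (\<lambda>y. 0 + x *\<^sub>R y)) ?A = emeasure lborel {y \<in> ball 0 1 - {0}. sgn y \<in> C}"
  proof -
    have "(\<lambda>y. 0 + x *\<^sub>R y) -` ?A = {y \<in> ball 0 1 - {0}. sgn y \<in> C}"
      using x by (auto simp: sgn_scaleR)
    then show ?thesis by (subst emeasure_distr) auto
  qed
  finally show ?thesis using x by simp
qed

lemma emeasure_radial_measure_atMost:
  assumes d: "1 \<le> d"
  shows "emeasure (radial_measure d) {..x} = (if x \<le> 0 then 0 else ennreal (min x 1 ^ d / d))"
proof -
  have "emeasure (radial_measure d) {..x} = (\<integral>\<^sup>+r. ennreal (indicator {0<..<1} r * r ^ (d - 1)) * indicator {..x} r \<partial>lborel)"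
    unfolding radial_measure_def by (subst emeasure_density) auto
  also have "\<dots> = (if x \<le> 0 then 0 else ennreal (min x 1 ^ d / d))"
  proof (cases "x \<le> 0")
    case True
    then have "(\<lambda>r. ennreal (indicator {0<..<1} r * r ^ (d - 1)) * indicator {..x} r) = (\<lambda>r. 0)"
      by (auto simp: indicator_def)
    then show ?thesis using True by simp
  next
    case False
    let ?m = "min x 1"
    have "(\<integral>\<^sup>+r. ennreal (indicator {0<..<1} r * r ^ (d - 1)) * indicator {..x} r \<partial>lborel) = (\<integral>\<^sup>+r. ennreal (r ^ (d - 1)) * indicator {0..?m} r \<partial>lborel)"
    proof (rule nn_integral_cong_AE)
      show "AE r in lborel. ennreal (indicator {0<..<1} r * r ^ (d - 1)) * indicator {..x} r = ennreal (r ^ (d - 1)) * indicator {0..?m} r"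
        using AE_lborel_singleton[of "0::real"] AE_lborel_singleton[of "1::real"]
        by eventually_elim (auto simp: indicator_def)
    qed
    also have "\<dots> = ?m ^ d / d - 0 ^ d / d"
    proof (rule nn_integral_FTC_Icc)
      fix r :: real assume "r \<in> {0..?m}"
      show "((\<lambda>r. r ^ d / d) has_real_derivative r ^ (d - 1)) (at r)"
        using d by (auto intro!: derivative_eq_intros)
    qed (use False in auto)
    also have "(0::real) ^ d = 0" using d by simp
    finally show ?thesis using False by simp
  qed
  finally show ?thesis .
qed

lemma finite_radial_measure: 
  assumes "1 \<le> d" shows "finite_measure (radial_measure d)"
proof
  have "emeasure (radial_measure d) {..1} = emeasure (radial_measure d) UNIV"
  proof (rule emeasure_eq_AE)
    show "AE x in radial_measure d. x \<in> {..1} \<longleftrightarrow> x \<in> UNIV" unfolding radial_measure_def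
      by (subst AE_density) (auto intro!: AE_I2 simp: indicator_def split: if_splits)
  qed (auto simp: radial_measure_def)
  then show "emeasure (radial_measure d) (space (radial_measure d)) \<noteq> \<infinity>"
    using emeasure_radial_measure_atMost[OF assms, of 1] by (auto simp: radial_measure_def)
qed

text \<open>It suffices to compare rectangles \<open>A \<times> C\<close>. For fixed \<open>C\<close> both sides are finite measures in \<open>A\<close>, and
  their distribution functions agree because the measure of a truncated cone scales with the radius.\<close>

lemma polar_pair_measure:
  "radial_measure DIM('a) \<Otimes>\<^sub>M (sphere_measure :: 'a::euclidean_space measure) =
     distr (restrict_space lborel (ball 0 1 - {0})) (borel \<Otimes>\<^sub>M restrict_space borel (sphere 0 1)) (\<lambda>x. (norm x, sgn x))"
proof (rule pair_measure_eqI)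
  let ?R = "radial_measure DIM('a)" and ?S = "sphere_measure :: 'a measure"
  let ?B = "restrict_space lborel (ball 0 1 - {0::'a})"
  interpret S: finite_measure ?S by (rule finite_sphere_measure)
  have DIM: "1 \<le> DIM('a)" by (simp add: Suc_leI)
  have setsR: "sets ?R = sets borel" by (simp add: radial_measure_def)
  interpret R: finite_measure ?R by (rule finite_radial_measure[OF DIM])
  show "sigma_finite_measure ?R" "sigma_finite_measure ?S" by unfold_locales
  show "sets (?R \<Otimes>\<^sub>M ?S) = sets (distr ?B (borel \<Otimes>\<^sub>M restrict_space borel (sphere 0 1)) (\<lambda>x. (norm x, sgn x)))"
    by (simp add: setsR sets_sphere_measure cong: sets_pair_measure_cong)
  fix A :: "real set" and C :: "'a set" assume A: "A \<in> sets ?R" and "C \<in> sets ?S"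
  then have A[measurable]: "A \<in> sets borel" and C[measurable]: "C \<in> sets borel" and Cs: "C \<subseteq> sphere 0 1"
    by (auto simp: setsR sets_sphere_measure sets_restrict_space_iff sets.Int_space_eq2)
  let ?cone = "{y \<in> ball 0 1 - {0}. sgn y \<in> C}"
  have coneS[measurable]: "?cone \<in> sets borel" by measurable
  have fin: "emeasure lborel ?cone < \<infinity>"
    by (rule le_less_trans[OF emeasure_mono[of _ "ball 0 1"] emeasure_lborel_ball_finite[of "0::'a" 1]]) auto
  let ?M1 = "distr (restrict_space lborel ?cone) borel norm" and ?M2 = "scale_measure (emeasure ?S C) ?R"
  have M1: "emeasure ?M1 X = emeasure lborel {y \<in> ball 0 1 - {0}. norm y \<in> X \<and> sgn y \<in> C}" if X[measurable]: "X \<in> sets borel" for X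
  proof -
    have "emeasure ?M1 X = emeasure (restrict_space lborel ?cone) (norm -` X \<inter> ?cone)"
      by (subst emeasure_distr) (auto simp: space_restrict_space intro!: measurable_restrict_space1)
    also have "\<dots> = emeasure lborel (norm -` X \<inter> ?cone)"
      by (rule emeasure_restrict_space) auto
    also have "norm -` X \<inter> ?cone = {y \<in> ball 0 1 - {0}. norm y \<in> X \<and> sgn y \<in> C}" by auto
    finally show ?thesis .
  qed
  have SC: "emeasure ?S C = of_nat DIM('a) * emeasure lborel ?cone"
    by (rule emeasure_sphere_measure[OF C Cs])
  have "?M1 = ?M2"
  proof (rule cdf_unique')
    show "finite_borel_measure ?M1"
    proof (intro finite_borel_measure.intro finite_borel_measure_axioms.intro finite_measureI)
      have "emeasure ?M1 UNIV \<le> emeasure lborel ?cone" by (subst M1) (auto intro!: emeasure_mono)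
      then show "emeasure ?M1 (space ?M1) \<noteq> \<infinity>" using fin by (auto simp: top_unique)
    qed auto
    show "finite_borel_measure ?M2"
    proof (intro finite_borel_measure.intro finite_borel_measure_axioms.intro finite_measureI)
      show "emeasure ?M2 (space ?M2) \<noteq> \<infinity>"
        using S.emeasure_finite R.emeasure_finite by (auto simp: space_scale_measure ennreal_mult_eq_top_iff)
    qed (simp add: setsR)
    show "cdf ?M1 = cdf ?M2"
    proof
      fix x
      have "emeasure ?M1 {..x} = emeasure ?M2 {..x}"
      proof (cases "x \<le> 0")
        case True
        have empty: "{y \<in> ball 0 1 - {0::'a}. norm y \<in> {..x} \<and> sgn y \<in> C} = {}"
          using True by (auto dest: order_trans[of "norm _" x 0])
        have "emeasure ?M1 {..x} = 0" using M1[of "{..x}"] unfolding empty by simp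
        then show ?thesis using True by (simp add: emeasure_radial_measure_atMost[OF DIM])
      next
        case False
        let ?m = "min x 1"
        have "{y \<in> ball 0 1 - {0::'a}. norm y \<in> {..x} \<and> sgn y \<in> C} = {y \<in> ball 0 1 - {0::'a}. norm y \<le> ?m \<and> sgn y \<in> C}"
          by auto
        then have "emeasure ?M1 {..x} = ennreal (?m ^ DIM('a)) * emeasure lborel ?cone"
          using False emeasure_truncated_cone[OF C, of ?m] by (subst M1) auto
        also have "\<dots> = ennreal (real DIM('a) * (?m ^ DIM('a) / DIM('a))) * emeasure lborel ?cone"
          using DIM by simp
        also have "\<dots> = of_nat DIM('a) * emeasure lborel ?cone * ennreal (?m ^ DIM('a) / DIM('a))"
          by (subst ennreal_mult') (auto simp: ennreal_of_nat_eq_real_of_nat mult_ac)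
        also have "\<dots> = emeasure ?M2 {..x}"
          using False by (simp add: emeasure_radial_measure_atMost[OF DIM] SC)
        finally show ?thesis .
      qed
      then show "cdf ?M1 x = cdf ?M2 x" by (simp add: cdf_def measure_def)
    qed
  qed
  then have "emeasure ?R A * emeasure ?S C = emeasure ?M1 A"
    by (simp add: mult.commute)
  also have "\<dots> = emeasure (distr ?B (borel \<Otimes>\<^sub>M restrict_space borel (sphere 0 1)) (\<lambda>x. (norm x, sgn x))) (A \<times> C)"
  proof -
    have m: "(\<lambda>x. (norm x, sgn x)) \<in> ?B \<rightarrow>\<^sub>M borel \<Otimes>\<^sub>M restrict_space borel (sphere 0 1)"
      by (intro measurable_Pair sgn_measurable_sphere) (auto intro: measurable_restrict_space1)
    have CR: "C \<in> sets (restrict_space borel (sphere 0 1))"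
      using Cs by (auto simp: sets_restrict_space_iff)
    have "emeasure (distr ?B (borel \<Otimes>\<^sub>M restrict_space borel (sphere 0 1)) (\<lambda>x. (norm x, sgn x))) (A \<times> C)
       = emeasure ?B {y \<in> ball 0 1 - {0}. norm y \<in> A \<and> sgn y \<in> C}"
      using CR by (subst emeasure_distr[OF m]) (auto simp: space_restrict_space intro!: arg_cong[where f="emeasure ?B"])
    also have "\<dots> = emeasure lborel {y \<in> ball 0 1 - {0}. norm y \<in> A \<and> sgn y \<in> C}"
      by (rule emeasure_restrict_space) auto
    finally show ?thesis by (subst M1) auto
  qed
  finally show "emeasure ?R A * emeasure ?S C = emeasure (distr ?B (borel \<Otimes>\<^sub>M restrict_space borel (sphere 0 1)) (\<lambda>x. (norm x, sgn x))) (A \<times> C)" .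
qed

lemma integrable_lebesgue_on_iff_lborel:
  fixes f :: "'a::euclidean_space \<Rightarrow> 'b::{banach,second_countable_topology}"
  assumes f: "f \<in> borel_measurable borel" and S: "S \<in> sets borel"
  shows "integrable (lebesgue_on S) f \<longleftrightarrow> set_integrable lborel S f"
    and "(LINT x|lebesgue_on S. f x) = (LINT x:S|lborel. f x)"
proof -
  have m: "(\<lambda>x. indicator S x *\<^sub>R f x) \<in> borel_measurable lborel" using f S by simp
  have "integrable (lebesgue_on S) f \<longleftrightarrow> integrable lebesgue (\<lambda>x. indicator S x *\<^sub>R f x)"
    using S by (intro integrable_restrict_space) auto
  also have "\<dots> \<longleftrightarrow> integrable lborel (\<lambda>x. indicator S x *\<^sub>R f x)"
    using m by (rule integrable_completion)
  finally show "integrable (lebesgue_on S) f \<longleftrightarrow> set_integrable lborel S f" by (simp add: set_integrable_def)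
  have "(LINT x|lebesgue_on S. f x) = (LINT x|lebesgue. indicator S x *\<^sub>R f x)"
    using S by (intro integral_restrict_space) auto
  also have "\<dots> = (LINT x|lborel. indicator S x *\<^sub>R f x)" using m by (rule integral_completion)
  finally show "(LINT x|lebesgue_on S. f x) = (LINT x:S|lborel. f x)" by (simp add: set_lebesgue_integral_def)
qed

lemma measurable_scaleR_sphere [measurable]:
  fixes f :: "'a::euclidean_space \<Rightarrow> 'b::{banach,second_countable_topology}"
  assumes [measurable]: "f \<in> borel_measurable borel"
  shows "(\<lambda>(r, w). f (r *\<^sub>R w)) \<in> borel_measurable (borel \<Otimes>\<^sub>M restrict_space borel (sphere 0 1))"
    and "(\<lambda>(r, w). f (r *\<^sub>R w)) \<in> borel_measurable (lborel \<Otimes>\<^sub>M sphere_measure)"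
    and "(\<lambda>w. f (r *\<^sub>R w)) \<in> borel_measurable sphere_measure"
proof -
  have w: "(\<lambda>w. w) \<in> restrict_space borel (sphere (0::'a) 1) \<rightarrow>\<^sub>M borel"
    by (intro measurable_restrict_space1) auto
  have [measurable]: "snd \<in> borel \<Otimes>\<^sub>M restrict_space borel (sphere (0::'a) 1) \<rightarrow>\<^sub>M borel"
    by (rule measurable_compose[OF measurable_snd w])
  show 1: "(\<lambda>(r, w). f (r *\<^sub>R w)) \<in> borel_measurable (borel \<Otimes>\<^sub>M restrict_space borel (sphere 0 1))"
    unfolding case_prod_unfold by measurable
  have "sets (lborel \<Otimes>\<^sub>M (sphere_measure::'a measure)) = sets (borel \<Otimes>\<^sub>M restrict_space borel (sphere 0 1))"
    by (rule sets_pair_measure_cong) (auto simp: sets_sphere_measure)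
  from measurable_cong_sets[OF this refl] 1 show "(\<lambda>(r, w). f (r *\<^sub>R w)) \<in> borel_measurable (lborel \<Otimes>\<^sub>M sphere_measure)"
    by blast
  have "(\<lambda>w. f (r *\<^sub>R w)) \<in> borel_measurable (restrict_space borel (sphere 0 1))"
    by (rule measurable_restrict_space1) simp
  then show "(\<lambda>w. f (r *\<^sub>R w)) \<in> borel_measurable sphere_measure"
    by (simp add: sets_sphere_measure cong: measurable_cong_sets)
qed

text \<open>Borel functions are considered, as opposed to Lebesgue measurable ones, because their composition
  with \<open>(r, w) \<mapsto> r *\<^sub>R w\<close> is measurable for the product measure.\<close>

theorem polar_coordinates:
  fixes f :: "'a::euclidean_space \<Rightarrow> 'b::{banach,second_countable_topology}"
  assumes f[measurable]: "f \<in> borel_measurable borel" and int: "integrable unit_ball_measure f"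
  shows "AE r in lborel. r \<in> {0<..<1} \<longrightarrow> integrable sphere_measure (\<lambda>w. f (r *\<^sub>R w))"
    and "set_integrable lborel {0<..<1} (\<lambda>r. r ^ (DIM('a) - 1) *\<^sub>R (LINT w|sphere_measure. f (r *\<^sub>R w)))"
    and "(LINT x|unit_ball_measure. f x) = (LINT r:{0<..<1}|lborel. r ^ (DIM('a) - 1) *\<^sub>R (LINT w|sphere_measure. f (r *\<^sub>R w)))"
proof -
  let ?d = "DIM('a)"
  let ?R = "radial_measure ?d" and ?S = "sphere_measure :: 'a measure"
  let ?B = "restrict_space lborel (ball 0 1 - {0::'a})"
  have DIM: "1 \<le> ?d" by (simp add: Suc_leI)
  interpret S: finite_measure ?S by (rule finite_sphere_measure)
  interpret R: finite_measure ?R by (rule finite_radial_measure[OF DIM])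
  interpret RS: pair_sigma_finite ?R ?S ..
  have m: "(\<lambda>x. (norm x, sgn x)) \<in> ?B \<rightarrow>\<^sub>M borel \<Otimes>\<^sub>M restrict_space borel (sphere 0 1)"
    by (intro measurable_Pair sgn_measurable_sphere) (auto intro: measurable_restrict_space1)
  have fm: "(\<lambda>(r, w). f (r *\<^sub>R w)) \<in> borel_measurable (borel \<Otimes>\<^sub>M restrict_space borel (sphere 0 1))"
    by (rule measurable_scaleR_sphere(1)[OF f])
  have ae: "AE x in lborel. indicator (ball 0 1) x *\<^sub>R f x = indicator (ball 0 1 - {0}) x *\<^sub>R f x"
    using AE_lborel_singleton[of "0::'a"] by eventually_elim (auto simp: indicator_def)
  have mB: "(\<lambda>x. indicator B x *\<^sub>R f x) \<in> borel_measurable lborel" if "B \<in> sets borel" for B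
    using f that by (intro borel_measurable_scaleR borel_measurable_indicator) auto
  have i0: "integrable lborel (\<lambda>x. indicator (ball 0 1 - {0}) x *\<^sub>R f x)"
  proof (rule integrable_cong_AE_imp[OF _ _ ae])
    show "integrable lborel (\<lambda>x. indicator (ball 0 1) x *\<^sub>R f x)"
      using int unfolding integrable_lebesgue_on_iff_lborel(1)[OF f borel_open[OF open_ball]] set_integrable_def .
  qed (intro borel_measurable_scaleR borel_measurable_indicator, use f in auto)
  then have iB: "integrable ?B f" by (subst integrable_restrict_space) auto
  have polar: "norm x *\<^sub>R sgn x = x" for x :: 'a by (cases "x = 0") (auto simp: sgn_div_norm)
  have i1: "integrable (?R \<Otimes>\<^sub>M ?S) (\<lambda>(r, w). f (r *\<^sub>R w))"
    unfolding polar_pair_measure using iB by (subst integrable_distr_eq[OF m fm]) (simp add: polar)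
  have int_eq: "(LINT x|unit_ball_measure. f x) = (LINT x|(?R \<Otimes>\<^sub>M ?S). (\<lambda>(r, w). f (r *\<^sub>R w)) x)"
  proof -
    have "(LINT x|unit_ball_measure. f x) = (LINT x|lborel. indicator (ball 0 1) x *\<^sub>R f x)"
      by (simp add: integrable_lebesgue_on_iff_lborel(2)[OF f borel_open[OF open_ball]] set_lebesgue_integral_def)
    also have "\<dots> = (LINT x|lborel. indicator (ball 0 1 - {0}) x *\<^sub>R f x)"
      by (rule integral_cong_AE[OF mB mB ae]) auto
    also have "\<dots> = (LINT x|?B. f x)" by (subst integral_restrict_space) auto
    also have "\<dots> = (LINT x|(?R \<Otimes>\<^sub>M ?S). (\<lambda>(r, w). f (r *\<^sub>R w)) x)"
      unfolding polar_pair_measure by (subst integral_distr[OF m fm]) (simp add: polar)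
    finally show ?thesis .
  qed
  have "AE r in ?R. integrable ?S (\<lambda>w. f (r *\<^sub>R w))"
    using RS.AE_integrable_fst'[OF i1] by simp
  then show "AE r in lborel. r \<in> {0<..<1} \<longrightarrow> integrable ?S (\<lambda>w. f (r *\<^sub>R w))"
    unfolding radial_measure_def by (subst (asm) AE_density) (auto simp: indicator_def elim!: eventually_mono)
  have F: "(\<lambda>r. LINT w|?S. f (r *\<^sub>R w)) \<in> borel_measurable lborel"
    using S.borel_measurable_lebesgue_integral[OF measurable_scaleR_sphere(2)[OF f]] .
  have eq: "(\<lambda>r. (indicator {0<..<1} r * r ^ (?d - 1)) *\<^sub>R (LINT w|?S. f (r *\<^sub>R w))) = (\<lambda>r. indicator {0<..<1} r *\<^sub>R r ^ (?d - 1) *\<^sub>R (LINT w|?S. f (r *\<^sub>R w)))"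
    by simp
  have nn: "AE r in lborel. 0 \<le> indicator {0<..<1::real} r * r ^ (?d - 1)"
    by (auto intro!: AE_I2 simp: indicator_def)
  have i2: "integrable ?R (\<lambda>r. LINT w|?S. f (r *\<^sub>R w))"
    using RS.integrable_fst'[OF i1] by simp
  then show "set_integrable lborel {0<..<1} (\<lambda>r. r ^ (?d - 1) *\<^sub>R (LINT w|?S. f (r *\<^sub>R w)))"
    unfolding radial_measure_def set_integrable_def
    by (subst (asm) integrable_density[OF F _ nn]) (auto simp: eq)
  have "(LINT x|unit_ball_measure. f x) = (LINT r|?R. LINT w|?S. f (r *\<^sub>R w))"
    unfolding int_eq using RS.integral_fst'[OF i1] by simp
  also have "\<dots> = (LINT r:{0<..<1}|lborel. r ^ (?d - 1) *\<^sub>R (LINT w|?S. f (r *\<^sub>R w)))"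
    unfolding radial_measure_def set_lebesgue_integral_def
    by (subst integral_density[OF F _ nn]) (auto simp: eq)
  finally show "(LINT x|unit_ball_measure. f x) = (LINT r:{0<..<1}|lborel. r ^ (?d - 1) *\<^sub>R (LINT w|?S. f (r *\<^sub>R w)))" .
qed

section \<open>Smooth functions\<close>

definition smooth1 :: "(real \<Rightarrow> real) \<Rightarrow> bool" where
  "smooth1 f \<longleftrightarrow> (\<exists>D. D 0 = f \<and> (\<forall>n x. (D n has_real_derivative D (Suc n) x) (at x)))"

lemma smooth1_coinduct:
  assumes "P f" and step: "\<And>g. P g \<Longrightarrow> \<exists>g'. (\<forall>x. (g has_real_derivative g' x) (at x)) \<and> P g'"
  shows "smooth1 f"
proof -
  obtain N where N: "\<And>g x. P g \<Longrightarrow> (g has_real_derivative N g x) (at x)" "\<And>g. P g \<Longrightarrow> P (N g)"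
    using step by metis
  have "P ((N ^^ n) f)" for n by (induction n) (auto simp: assms(1) N(2))
  then show ?thesis unfolding smooth1_def by (intro exI[of _ "\<lambda>n. (N ^^ n) f"]) (auto intro: N(1))
qed

lemma smooth1_derivative:
  assumes "smooth1 f" obtains f' where "\<And>x. (f has_real_derivative f' x) (at x)" "smooth1 f'"
proof -
  obtain D where D: "D 0 = f" "\<And>n x. (D n has_real_derivative D (Suc n) x) (at x)"
    using assms by (auto simp: smooth1_def)
  show ?thesis
  proof (rule that[of "D (Suc 0)"])
    show "(f has_real_derivative D (Suc 0) x) (at x)" for x using D(2)[of 0] D(1) by simp
    show "smooth1 (D (Suc 0))" unfolding smooth1_def using D by (intro exI[of _ "\<lambda>n. D (Suc n)"]) auto
  qed
qed

lemma smooth1_antiderivative: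
  assumes "\<And>x. (f has_real_derivative f' x) (at x)" "smooth1 f'"
  shows "smooth1 f"
  by (rule smooth1_coinduct[of "\<lambda>g. g = f \<or> smooth1 g"]) (use assms in \<open>auto elim: smooth1_derivative\<close>)

lemma smooth1_continuous:
  assumes "smooth1 f" shows "continuous_on S f"
proof -
  obtain f' where "\<And>x. (f has_real_derivative f' x) (at x)" using smooth1_derivative[OF assms] by metis
  then show ?thesis by (intro continuous_at_imp_continuous_on ballI DERIV_isCont)
qed

text \<open>These functions span a space that is closed under differentiation and contains the standard
  smooth function \<open>exp (- 1 / x)\<close> that is flat at the origin.\<close>

definition flat_exp :: "nat \<Rightarrow> real \<Rightarrow> real" where
  "flat_exp j x = (if x \<le> 0 then 0 else exp (- (1 / x)) / x ^ j)"

lemma flat_tendsto_0: "(flat_exp j \<longlongrightarrow> 0) (at 0)"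
proof -
  have "((\<lambda>y::real. y ^ j / exp y) \<longlongrightarrow> 0) at_top" by (rule tendsto_power_div_exp_0)
  from filterlim_compose[OF this filterlim_inverse_at_top_right]
  have "((\<lambda>x::real. inverse x ^ j / exp (inverse x)) \<longlongrightarrow> 0) (at_right 0)" .
  then have "(flat_exp j \<longlongrightarrow> 0) (at_right 0)"
    by (rule Lim_transform_eventually)
      (auto simp: eventually_at_right_field flat_exp_def exp_minus field_simps intro!: exI[of _ 1])
  moreover have "(flat_exp j \<longlongrightarrow> 0) (at_left 0)"
    by (rule tendsto_eventually) (auto simp: eventually_at_left_field flat_exp_def intro!: exI[of _ "-1"])
  ultimately show ?thesis by (simp add: filterlim_split_at)
qed

text \<open>At the origin the difference quotient of \<open>flat_exp j\<close> is \<open>flat_exp (j + 1)\<close>, which tends to zero.\<close>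

lemma flat_derivative:
  "(flat_exp j has_real_derivative flat_exp (j + 2) x - real j * flat_exp (j + 1) x) (at x)"
proof -
  consider "x < 0" | "x = 0" | "x > 0" by linarith
  then show ?thesis
  proof cases
    case 1
    have "((\<lambda>_. 0) has_real_derivative 0) (at x)" by simp
    then have "(flat_exp j has_real_derivative 0) (at x)"
      by (rule has_field_derivative_transform_within_open[of _ _ _ "{..<0}"]) (use 1 in \<open>auto simp: flat_exp_def\<close>)
    then show ?thesis using 1 by (simp add: flat_exp_def)
  next
    case 2
    have "(\<lambda>h. (flat_exp j (0 + h) - flat_exp j 0) / h) = flat_exp (Suc j)"
      by (auto simp: flat_exp_def fun_eq_iff)
    then have "(flat_exp j has_real_derivative 0) (at 0)"
      unfolding DERIV_def using flat_tendsto_0[of "Suc j"] by (simp only:)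
    then show ?thesis using 2 by (simp add: flat_exp_def)
  next
    case 3
    have 1: "((\<lambda>x. exp (- inverse x) * inverse x ^ j) has_real_derivative
      exp (- inverse x) * (- (- (inverse x ^ Suc (Suc 0)))) * inverse x ^ j +
        real j * (- (inverse x ^ Suc (Suc 0)) * inverse x ^ (j - Suc 0)) * exp (- inverse x)) (at x)"
      using 3 by (intro DERIV_mult DERIV_power DERIV_inverse DERIV_chain2[OF DERIV_exp] DERIV_minus) auto
    have "exp (- inverse x) * (- (- (inverse x ^ Suc (Suc 0)))) * inverse x ^ j +
        real j * (- (inverse x ^ Suc (Suc 0)) * inverse x ^ (j - Suc 0)) * exp (- inverse x) = flat_exp (j + 2) x - real j * flat_exp (j + 1) x"
      using 3 by (cases j) (auto simp: flat_exp_def field_simps)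
    with 1 have "((\<lambda>x. exp (- inverse x) * inverse x ^ j) has_real_derivative flat_exp (j + 2) x - real j * flat_exp (j + 1) x) (at x)" by simp
    then show ?thesis
      by (rule has_field_derivative_transform_within_open[of _ _ _ "{0<..}"]) (use 3 in \<open>auto simp: flat_exp_def divide_inverse power_inverse\<close>)
  qed
qed

inductive flat_alg :: "(real \<Rightarrow> real) \<Rightarrow> bool" where
  const: "flat_alg (\<lambda>_. c)"
| flat_exp: "flat_alg (\<lambda>x. flat_exp j (a * x + b))"
| add: "flat_alg f \<Longrightarrow> flat_alg g \<Longrightarrow> flat_alg (\<lambda>x. f x + g x)"
| mult: "flat_alg f \<Longrightarrow> flat_alg g \<Longrightarrow> flat_alg (\<lambda>x. f x * g x)"

lemma flat_alg_derivative:
  "flat_alg f \<Longrightarrow> \<exists>f'. (\<forall>x. (f has_real_derivative f' x) (at x)) \<and> flat_alg f'"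
proof (induction rule: flat_alg.induct)
  case (const c)
  then show ?case by (intro exI[of _ "\<lambda>_. 0"]) (auto intro: flat_alg.const)
next
  case (flat_exp j a b)
  have "((\<lambda>x. flat_exp j (a * x + b)) has_real_derivative (flat_exp (j + 2) (a * x + b) + (- real j) * flat_exp (j + 1) (a * x + b)) * a) (at x)" for x
  proof -
    have "((\<lambda>x. flat_exp j (a * x + b)) has_real_derivative (flat_exp (j + 2) (a * x + b) - real j * flat_exp (j + 1) (a * x + b)) * a) (at x)"
      by (rule DERIV_chain2[OF flat_derivative]) (auto intro!: derivative_eq_intros)
    then show ?thesis by simp
  qed
  moreover have "flat_alg (\<lambda>x. (flat_exp (j + 2) (a * x + b) + (- real j) * flat_exp (j + 1) (a * x + b)) * a)"
    by (intro flat_alg.intros)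
  ultimately show ?case by (intro exI conjI allI) assumption+
next
  case (add f g)
  then obtain f' g' where "\<forall>x. (f has_real_derivative f' x) (at x)" "flat_alg f'" "\<forall>x. (g has_real_derivative g' x) (at x)" "flat_alg g'" by blast
  then show ?case by (intro exI[of _ "\<lambda>x. f' x + g' x"]) (auto intro!: flat_alg.intros DERIV_add)
next
  case (mult f g)
  then obtain f' g' where *: "\<forall>x. (f has_real_derivative f' x) (at x)" "flat_alg f'" "\<forall>x. (g has_real_derivative g' x) (at x)" "flat_alg g'" by blast
  then have "\<forall>x. ((\<lambda>x. f x * g x) has_real_derivative f' x * g x + g' x * f x) (at x)"
    by (auto intro: DERIV_mult)
  then show ?case using * mult.hyps by (intro exI[of _ "\<lambda>x. f' x * g x + g' x * f x"]) (auto intro!: flat_alg.add flat_alg.mult)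
qed

lemma flat_alg_smooth1: "flat_alg f \<Longrightarrow> smooth1 f"
  by (erule smooth1_coinduct) (rule flat_alg_derivative)

text \<open>Smooth functions supported in \<open>{a..b}\<close> that tend to the indicator function of the open interval as
  \<open>n\<close> grows. Scaling the argument of the flat function gives this without quotients of cut-off functions.\<close>

definition bump :: "real \<Rightarrow> real \<Rightarrow> nat \<Rightarrow> real \<Rightarrow> real" where
  "bump a b n t = flat_exp 0 (real n * t + (- real n * a)) * flat_exp 0 ((- real n) * t + real n * b)"

lemma bump_flat_alg: "flat_alg (bump a b n)"
  unfolding bump_def[abs_def] by (intro flat_alg.intros)

lemma flat_0_bounds: "0 \<le> flat_exp 0 x" "flat_exp 0 x \<le> 1" "x > 0 \<Longrightarrow> 0 < flat_exp 0 x"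
  by (simp_all add: flat_exp_def)

lemma bump_bounds: "0 \<le> bump a b n t" "bump a b n t \<le> 1"
  by (auto simp: bump_def flat_0_bounds mult_le_one)

lemma bump_eq_0: "t \<notin> {a<..<b} \<Longrightarrow> bump a b n t = 0"
proof -
  assume "t \<notin> {a<..<b}"
  then have "real n * t \<le> real n * a \<or> real n * b \<le> real n * t" by (auto intro!: mult_left_mono simp: not_less)
  then show ?thesis by (auto simp: bump_def flat_exp_def)
qed

lemma bump_pos: "t \<in> {a<..<b} \<Longrightarrow> 0 < n \<Longrightarrow> 0 < bump a b n t"
  unfolding bump_def by (intro mult_pos_pos flat_0_bounds) (auto simp: mult_strict_left_mono)

lemma bump_tendsto: "(\<lambda>n. bump a b n t) \<longlonglongrightarrow> indicator {a<..<b} t"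
proof (cases "t \<in> {a<..<b}")
  case True
  have lim: "(\<lambda>n. flat_exp 0 (real n * c)) \<longlonglongrightarrow> 1" if c: "c > 0" for c
  proof -
    have "(\<lambda>n. exp (- ((1 / c) * (1 / real n)))) \<longlonglongrightarrow> exp (- ((1 / c) * 0))"
      by (intro tendsto_intros lim_1_over_n)
    then have "(\<lambda>n. exp (- ((1 / c) * (1 / real n)))) \<longlonglongrightarrow> 1" by simp
    then show ?thesis
      by (rule Lim_transform_eventually)
       (use c in \<open>auto simp: eventually_sequentially flat_exp_def mult_le_0_iff field_simps intro!: exI[of _ 1]\<close>)
  qed
  have "(\<lambda>n. flat_exp 0 (real n * (t - a)) * flat_exp 0 (real n * (b - t))) \<longlonglongrightarrow> 1 * 1"
    using True by (intro tendsto_mult lim) auto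
  then show ?thesis using True by (simp add: bump_def algebra_simps)
qed (simp add: bump_eq_0)

text \<open>\<open>C_diff\<close> takes derivatives one at a time, so any class of differentiable functions that is closed
  under partial derivatives consists of smooth functions.\<close>

lemma smooth_coinduct:
  assumes "P f" and step: "\<And>f. P f \<Longrightarrow> f differentiable_on UNIV \<and> (\<forall>b\<in>Basis. P (dir_deriv f b))"
  shows "smooth f"
proof -
  have "P f \<Longrightarrow> C_diff k f" for k f
    by (induction k arbitrary: f) (auto dest: step simp: differentiable_imp_continuous_on)
  then show ?thesis using assms(1) by (simp add: smooth_def)
qed

lemma smooth_differentiable: "smooth f \<Longrightarrow> f differentiable at x"
  unfolding smooth_def by (drule spec[of _ "Suc 0"]) (auto simp: differentiable_on_def)

lemma smooth_dir_deriv: "smooth f \<Longrightarrow> b \<in> Basis \<Longrightarrow> smooth (dir_deriv f b)"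
  unfolding smooth_def
proof
  fix k assume "\<forall>k. C_diff k f" "b \<in> Basis"
  then have "C_diff (Suc k) f" by blast
  then show "C_diff k (dir_deriv f b)" using \<open>b \<in> Basis\<close> by simp
qed

lemma smooth_continuous: "smooth f \<Longrightarrow> continuous_on S f"
  by (meson continuous_on_subset differentiable_imp_continuous_on differentiable_on_def smooth_differentiable differentiable_at_withinI top_greatest)

lemma dir_deriv_eq: "(f has_derivative D) (at x) \<Longrightarrow> dir_deriv f b x = D b"
  unfolding dir_deriv_def by (simp add: frechet_derivative_at[symmetric])

lemma differentiable_has_derivative: "f differentiable at x \<Longrightarrow> (f has_derivative frechet_derivative f (at x)) (at x)"
  by (simp add: frechet_derivative_works[symmetric])

lemma dir_deriv_add:
  assumes "f differentiable at x" "g differentiable at x"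
  shows "dir_deriv (\<lambda>x. f x + g x) b x = dir_deriv f b x + dir_deriv g b x"
  using dir_deriv_eq[OF has_derivative_add[OF assms[THEN differentiable_has_derivative]]]
  by (simp add: dir_deriv_def)

lemma dir_deriv_mult:
  assumes "f differentiable at x" "g differentiable at x"
  shows "dir_deriv (\<lambda>x. f x * g x) b x = f x * dir_deriv g b x + dir_deriv f b x * g x"
  using dir_deriv_eq[OF has_derivative_mult[OF assms[THEN differentiable_has_derivative]]]
  by (simp add: dir_deriv_def)

lemma dir_deriv_const: "dir_deriv (\<lambda>_. c) b = (\<lambda>_. 0)"
  by (rule ext, subst dir_deriv_eq[OF has_derivative_const]) simp

lemma has_derivative_coord: "((\<lambda>x. complex_of_real (x \<bullet> c)) has_derivative (\<lambda>v. complex_of_real (v \<bullet> c))) (at x)"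
  by (intro has_derivative_of_real has_derivative_inner_left has_derivative_ident)

lemma dir_deriv_coord: "dir_deriv (\<lambda>x. complex_of_real (x \<bullet> c)) b = (\<lambda>_. of_real (b \<bullet> c))"
  by (rule ext, subst dir_deriv_eq[OF has_derivative_coord]) simp

lemma has_derivative_radial:
  assumes "\<And>t. (f has_real_derivative f' t) (at t)"
  shows "((\<lambda>x. complex_of_real (f (x \<bullet> x))) has_derivative (\<lambda>v. complex_of_real (2 * f' (x \<bullet> x) * (x \<bullet> v)))) (at x)"
proof -
  have "((\<lambda>x. x \<bullet> x) has_derivative (\<lambda>v. x \<bullet> v + v \<bullet> x)) (at x)"
    by (intro has_derivative_inner has_derivative_ident)
  from has_derivative_compose[OF this has_field_derivative_imp_has_derivative[OF assms]]
  have "((\<lambda>x. f (x \<bullet> x)) has_derivative (\<lambda>v. f' (x \<bullet> x) * (x \<bullet> v + v \<bullet> x))) (at x)" .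
  then have "((\<lambda>x. complex_of_real (f (x \<bullet> x))) has_derivative (\<lambda>v. complex_of_real (f' (x \<bullet> x) * (x \<bullet> v + v \<bullet> x)))) (at x)"
    by (rule has_derivative_of_real)
  also have "(\<lambda>v. complex_of_real (f' (x \<bullet> x) * (x \<bullet> v + v \<bullet> x))) = (\<lambda>v. complex_of_real (2 * f' (x \<bullet> x) * (x \<bullet> v)))"
    by (simp add: fun_eq_iff inner_commute)
  finally show ?thesis .
qed

text \<open>The product rule keeps this class closed under partial derivatives, so all its members are
  smooth. This settles polynomials, smooth functions of \<open>|x|\<^sup>2\<close> and products of smooth functions at once.\<close>

inductive smooth_alg :: "('a::euclidean_space \<Rightarrow> complex) \<Rightarrow> bool" where
  smooth: "smooth f \<Longrightarrow> smooth_alg f"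
| const: "smooth_alg (\<lambda>_. c)"
| coord: "smooth_alg (\<lambda>x. of_real (x \<bullet> c))"
| radial: "smooth1 f \<Longrightarrow> smooth_alg (\<lambda>x. of_real (f (x \<bullet> x)))"
| add: "smooth_alg f \<Longrightarrow> smooth_alg g \<Longrightarrow> smooth_alg (\<lambda>x. f x + g x)"
| mult: "smooth_alg f \<Longrightarrow> smooth_alg g \<Longrightarrow> smooth_alg (\<lambda>x. f x * g x)"

lemmas smooth_alg_rules = smooth_alg.const smooth_alg.coord smooth_alg.radial smooth_alg.add smooth_alg.mult

lemma smooth_alg_derivative:
  "smooth_alg f \<Longrightarrow> (\<forall>x. f differentiable at x) \<and> (\<forall>b\<in>Basis. smooth_alg (dir_deriv f b))"
proof (induction rule: smooth_alg.induct)
  case (smooth f)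
  then show ?case by (auto intro: smooth_alg.smooth smooth_differentiable smooth_dir_deriv)
next
  case (const c)
  then show ?case by (auto simp: dir_deriv_const intro: smooth_alg.const)
next
  case (coord c)
  then show ?case using has_derivative_coord[of c] by (auto simp: dir_deriv_coord differentiable_def intro: smooth_alg.const)
next
  case (radial f)
  then obtain f' where f': "\<And>x. (f has_real_derivative f' x) (at x)" "smooth1 f'" by (auto elim: smooth1_derivative)
  have "dir_deriv (\<lambda>x. complex_of_real (f (x \<bullet> x))) b = (\<lambda>x. of_real 2 * (of_real (f' (x \<bullet> x)) * of_real (x \<bullet> b)))" for b :: 'a
    by (rule ext, subst dir_deriv_eq[OF has_derivative_radial[OF f'(1)]]) simp
  then show ?case using has_derivative_radial[OF f'(1)] f'(2) by (auto simp: differentiable_def intro!: smooth_alg_rules)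
next
  case (add f g)
  then have "dir_deriv (\<lambda>x. f x + g x) b = (\<lambda>x. dir_deriv f b x + dir_deriv g b x)" for b
    by (auto simp: dir_deriv_add)
  then show ?case using add by (auto intro: smooth_alg.add)
next
  case (mult f g)
  then have "dir_deriv (\<lambda>x. f x * g x) b = (\<lambda>x. f x * dir_deriv g b x + dir_deriv f b x * g x)" for b
    by (auto simp: dir_deriv_mult)
  then show ?case using mult by (auto intro!: smooth_alg.add smooth_alg.mult)
qed

lemma smooth_alg_smooth: "smooth_alg f \<Longrightarrow> smooth f"
  by (erule smooth_coinduct) (use smooth_alg_derivative in \<open>auto simp: differentiable_on_def intro: differentiable_at_withinI\<close>)

lemma smooth_alg_differentiable: "smooth_alg f \<Longrightarrow> f differentiable at x"
  by (rule smooth_differentiable[OF smooth_alg_smooth])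

lemma smooth_mult: "smooth f \<Longrightarrow> smooth g \<Longrightarrow> smooth (\<lambda>x. f x * g x)"
  by (rule smooth_alg_smooth[OF smooth_alg.mult[OF smooth_alg.smooth smooth_alg.smooth]])

lemma smooth_alg_power: "smooth_alg f \<Longrightarrow> smooth_alg (\<lambda>x. f x ^ k)"
  by (induction k) (auto intro: smooth_alg_rules)

section \<open>The lemma of du Bois-Reymond\<close>

lemma smooth1_antiderivative_exists:
  assumes "smooth1 g"
  obtains f where "\<And>x. (f has_real_derivative g x) (at x)" "smooth1 f" "f 0 = 0"
proof -
  define f where "f x = (LBINT y=ereal 0..ereal x. g y)" for x
  have d: "(f has_real_derivative g x) (at x)" for x
  proof -
    let ?a = "- \<bar>x\<bar> - 1" and ?b = "\<bar>x\<bar> + 1"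
    have "(f has_vector_derivative g x) (at x within {?a..?b})"
      unfolding f_def[abs_def]
      by (rule interval_integral_FTC2[OF _ _ smooth1_continuous[OF assms]]) auto
    moreover have "x \<in> interior {?a..?b}" by auto
    ultimately show ?thesis
      unfolding has_real_derivative_iff_has_vector_derivative using at_within_interior by metis
  qed
  show ?thesis
    by (rule that[OF d smooth1_antiderivative[OF d assms]]) (simp add: f_def)
qed

text \<open>A function of mean zero supported in \<open>{a..c}\<close> has a primitive supported there, that is, it is
  the derivative of an admissible test function.\<close>

lemma antiderivative_vanishes:
  fixes f g :: "real \<Rightarrow> real"
  assumes d: "\<And>x. (f has_real_derivative g x) (at x)" and g: "\<And>x. x \<notin> {a..c} \<Longrightarrow> g x = 0"
    and "0 < a" "c < 1" "f 0 = 0" "f 1 = 0" and x: "x \<notin> {a..c}"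
  shows "f x = 0"
proof -
  have d': "(f has_real_derivative 0) (at y)" if "y \<notin> {a..c}" for y
    using d[of y] g[OF that] by simp
  show ?thesis
  proof (cases "x < a")
    case True
    have "\<exists>k. \<forall>y\<in>{..<a}. f y = k"
      by (rule has_field_derivative_zero_constant) (use d' in \<open>auto intro: has_field_derivative_at_within\<close>)
    then show ?thesis using True assms by (metis lessThan_iff)
  next
    case False
    have "\<exists>k. \<forall>y\<in>{c<..}. f y = k"
      by (rule has_field_derivative_zero_constant) (use d' in \<open>auto intro: has_field_derivative_at_within\<close>)
    then show ?thesis using False x assms by (metis atLeastAtMost_iff greaterThan_iff not_le)
  qed
qed

text \<open>Put \<open>h(r) = Q(r) + \<integral>\<^sub>r\<^sup>1 b\<close>. By parts, \<open>\<integral> h(r) 2r g(r\<^sup>2) dr = 0\<close> for every \<open>g\<close> that is the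
  derivative of a test function, that is, for every \<open>g\<close> of mean zero. Subtracting a multiple of one fixed
  bump from an arbitrary \<open>g\<close> yields a constant \<open>C\<close> with \<open>\<integral> (h(r) - C) 2r g(r\<^sup>2) dr = 0\<close> for all bumps \<open>g\<close>,
  and these approximate the indicator functions of intervals. The square in the argument is there because
  the test functions on the ball are functions of \<open>|x|\<^sup>2\<close>, which is smooth at the origin.\<close>

lemma du_bois_reymond:
  fixes Q b :: "real \<Rightarrow> complex"
  assumes Q: "set_integrable lborel {0<..<1} Q" and b: "set_integrable lborel {0<..1} b"
    and weak: "\<And>f g a c. (\<And>t. (f has_real_derivative g t) (at t)) \<Longrightarrow> smooth1 f \<Longrightarrow> smooth1 g \<Longrightarrow> 0 < a \<Longrightarrow> c < 1
      \<Longrightarrow> (\<And>t. t \<notin> {a..c} \<Longrightarrow> f t = 0) \<Longrightarrow>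
      (LINT r:{0<..<1}|lborel. Q r * of_real (2 * r * g (r\<^sup>2))) = - (LINT r:{0<..<1}|lborel. b r * of_real (f (r\<^sup>2)))"
  obtains C where "AE r in lborel. r \<in> {0<..<1} \<longrightarrow> Q r = C - (LINT s:{r..1}|lborel. b s)"
proof -
  define H where "H r = (LINT s:{r..1}|lborel. b s)" for r
  define B where "B = (LINT s:{0<..1}|lborel. norm (b s))"
  have bs: "set_integrable lborel {r..1} b" if "0 < r" for r
    by (rule set_integrable_subset[OF b]) (use that in auto)
  have HB: "norm (H r) \<le> B" if "r \<in> {0<..<1}" for r
  proof -
    have "norm (H r) \<le> (LINT s:{r..1}|lborel. norm (b s))"
      unfolding H_def by (rule set_integral_norm_bound[OF bs]) (use that in auto)
    also have "\<dots> \<le> B" unfolding B_def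
      by (rule set_integral_mono_subset[OF set_integrable_norm[OF b]]) (use that in auto)
    finally show ?thesis .
  qed
  have Hcont0: "continuous_on {0<..1} H"
    unfolding H_def[abs_def] by (rule continuous_on_tail_integral[OF bs])
  have Hcont: "continuous_on {e..1} H" if "0 < e" for e
    by (rule continuous_on_subset[OF Hcont0]) (use that in auto)
  have Hcont01: "continuous_on {0<..<1} H"
    by (rule continuous_on_subset[OF Hcont0]) auto
  have Hi: "set_integrable lborel {0<..<1} H"
    unfolding set_integrable_def
  proof (rule integrableI_bounded_set[where A="{0<..<1}" and B=B])
    show "(\<lambda>x. indicator {0<..<1} x *\<^sub>R H x) \<in> borel_measurable lborel"
      using borel_measurable_continuous_on_indicator[OF _ Hcont01] by simp
  qed (use HB in auto)
  define h where "h r = Q r + H r" for r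
  have hi: "set_integrable lborel {0<..<1} h"
    unfolding h_def[abs_def] by (rule set_integral_add(1)[OF Q Hi])
  have c2: "continuous_on {0..1} (\<lambda>r. 2 * r * g (r\<^sup>2))" "continuous_on {0..1} (\<lambda>r. g (r\<^sup>2))" if "smooth1 g" for g
    by (intro continuous_intros continuous_on_compose2[OF smooth1_continuous[OF that, of UNIV]]; simp)+
  have mc: "set_integrable lborel {0<..<1} (\<lambda>r. q r * of_real (g r))"
    if "set_integrable lborel {0<..<1} q" "continuous_on {0..1} g" for q :: "real \<Rightarrow> complex" and g :: "real \<Rightarrow> real"
    by (rule set_integrable_mult_continuous[OF that(1) continuous_on_of_real[OF that(2)]]) auto
  have hmul: "set_integrable lborel {0<..<1} (\<lambda>r. h r * of_real (2 * r * g (r\<^sup>2)))" if "smooth1 g" for g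
    by (rule mc[OF hi c2(1)[OF that]])
  have key: "(LINT r:{0<..<1}|lborel. h r * of_real (2 * r * g (r\<^sup>2))) = 0"
    if g: "smooth1 g" "0 < a" "c < 1" "\<And>t. t \<notin> {a..c} \<Longrightarrow> g t = 0" and mean: "integral {0..1} g = 0" for g a c
  proof -
    obtain f where f: "\<And>x. (f has_real_derivative g x) (at x)" "smooth1 f" "f 0 = 0"
      using smooth1_antiderivative_exists[OF g(1)] by metis
    have "(g has_integral (f 1 - f 0)) {0..1}"
      by (rule fundamental_theorem_of_calculus)
        (use f(1) in \<open>auto simp: has_real_derivative_iff_has_vector_derivative[symmetric] intro: has_field_derivative_at_within\<close>)
    then have f1: "f 1 = 0" using mean f(3) by (auto dest: integral_unique)
    have supp: "f t = 0" if "t \<notin> {a..c}" for t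
      by (rule antiderivative_vanishes[OF f(1) g(4) g(2,3) f(3) f1 that])
    \<comment> \<open>For \<open>r \<le> e\<close> the square \<open>r\<^sup>2 < r \<le> a\<close> lies to the left of the support.\<close>
    define e where "e = min a (1/2)"
    have e: "0 < e" "e \<le> a" "e \<le> 1" using g(2) by (auto simp: e_def)
    have low: "r\<^sup>2 \<notin> {a..c}" if "0 < r" "r \<le> e" for r
    proof -
      have "r\<^sup>2 < r * 1" using that e_def unfolding power2_eq_square by (intro mult_strict_left_mono) auto
      then show ?thesis using that e by auto
    qed
    let ?Y = "\<lambda>r. complex_of_real (f (r\<^sup>2))" and ?Y' = "\<lambda>r. complex_of_real (2 * r * g (r\<^sup>2))"
    have Y: "(?Y has_vector_derivative ?Y' r) (at r within {e..1})" for r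
    proof -
      have "((\<lambda>r. f (r\<^sup>2)) has_real_derivative g (r\<^sup>2) * (2 * r)) (at r within {e..1})"
        by (rule DERIV_chain2[OF f(1)]) (auto intro!: derivative_eq_intros)
      then have "((\<lambda>r. f (r\<^sup>2)) has_real_derivative 2 * r * g (r\<^sup>2)) (at r within {e..1})"
        by (simp add: mult_ac)
      then show ?thesis by (rule has_vector_derivative_of_real)
    qed
    have Y'c: "continuous_on {e..1} ?Y'"
      by (intro continuous_on_of_real continuous_on_subset[OF c2(1)[OF g(1)]]) (use e in auto)
    have Yc: "continuous_on {e..1} ?Y"
      by (intro continuous_on_of_real continuous_on_subset[OF c2(2)[OF f(2)]]) (use e in auto)
    have "(LINT r:{0<..<1}|lborel. H r * ?Y' r) = (LINT r:{e..1}|lborel. H r * ?Y' r)"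
    proof (rule set_integral_Ioo_eq_Icc[OF less_imp_le[OF e(1)] e(3)])
      show "set_integrable lborel {e..1} (\<lambda>r. H r * ?Y' r)"
        by (intro borel_integrable_atLeastAtMost' continuous_on_mult Hcont e Y'c)
    qed (use low g(4) e in force)
    also have "\<dots> = (LINT s:{e..1}|lborel. b s * (?Y s - ?Y e))"
      unfolding H_def by (rule integral_by_parts_indefinite[OF e(3) bs[OF e(1)] Y Y'c])
    also have "\<dots> = (LINT s:{e..1}|lborel. b s * ?Y s)"
      using supp[OF low[of e]] e by simp
    also have "\<dots> = (LINT s:{0<..<1}|lborel. b s * ?Y s)"
    proof (rule set_integral_Ioo_eq_Icc[OF less_imp_le[OF e(1)] e(3), symmetric])
      show "set_integrable lborel {e..1} (\<lambda>r. b r * ?Y r)"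
        by (rule set_integrable_mult_continuous[OF bs[OF e(1)] Yc order.refl])
    qed (use low supp e in force)
    finally have HY: "(LINT r:{0<..<1}|lborel. H r * ?Y' r) = (LINT s:{0<..<1}|lborel. b s * ?Y s)" .
    have "(LINT r:{0<..<1}|lborel. h r * ?Y' r) = (LINT r:{0<..<1}|lborel. Q r * ?Y' r + H r * ?Y' r)"
      by (simp only: h_def distrib_right)
    also have "\<dots> = (LINT r:{0<..<1}|lborel. Q r * ?Y' r) + (LINT r:{0<..<1}|lborel. H r * ?Y' r)"
      by (intro set_integral_add(2) mc[OF _ c2(1)[OF g(1)]] Hi Q)
    also have "(LINT r:{0<..<1}|lborel. Q r * ?Y' r) = - (LINT s:{0<..<1}|lborel. b s * ?Y s)"
      by (rule weak[of f g a c]) (use f g supp in blast)+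
    also have "- (LINT s:{0<..<1}|lborel. b s * ?Y s) + (LINT r:{0<..<1}|lborel. H r * ?Y' r) = 0"
      unfolding HY by (rule left_minus)
    finally show ?thesis .
  qed
  \<comment> \<open>The constant is read off from one fixed bump \<open>?g0\<close>; any other \<open>g\<close> becomes a function of mean
    zero after subtraction of \<open>k\<close> times \<open>?g0\<close>.\<close>
  let ?g0 = "bump (1/4) (3/4) 1"
  let ?J = "\<lambda>g. (LINT r:{0<..<1}|lborel. h r * of_real (2 * r * g (r\<^sup>2)))"
  have g0: "smooth1 ?g0" by (rule flat_alg_smooth1[OF bump_flat_alg])
  have I0: "integral {0..1} ?g0 \<noteq> 0"
    using integral_eq_0_iff[OF smooth1_continuous[OF g0], of 0 1] bump_bounds(1) bump_pos[of "1/2" "1/4" "3/4" 1]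
    by fastforce
  define C where "C = ?J ?g0 / of_real (integral {0..1} ?g0)"
  define G where "G r = (h r - C) * of_real (2 * r)" for r
  have Gi: "set_integrable lborel {0<..<1} G"
  proof -
    have "set_integrable lborel {0<..<1} (\<lambda>r::real. C)"
      unfolding set_integrable_def by (rule integrableI_bounded_set_indicator[where B="norm C"]) auto
    then show ?thesis unfolding G_def
      by (intro mc set_integral_diff(1) hi) (auto intro!: continuous_intros)
  qed
  have Gzero: "(LINT r:{0<..<1}|lborel. G r * of_real (g (r\<^sup>2))) = 0"
    if g: "flat_alg g" "0 < a" "c < 1" "\<And>t. t \<notin> {a..c} \<Longrightarrow> g t = 0" for g a c
  proof -
    have gs: "smooth1 g" by (rule flat_alg_smooth1[OF g(1)])
    define k where "k = integral {0..1} g / integral {0..1} ?g0"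
    define w where "w t = g t + (- k) * ?g0 t" for t
    have "flat_alg w" unfolding w_def[abs_def] by (intro flat_alg.intros g bump_flat_alg)
    then have ws: "smooth1 w" by (rule flat_alg_smooth1)
    have "?J w = 0"
    proof (rule key[OF ws])
      show "0 < min a (1/4)" "max c (3/4) < 1" using g by auto
      show "w t = 0" if "t \<notin> {min a (1/4)..max c (3/4)}" for t
      proof -
        have "t \<notin> {a..c}" "t \<notin> {1/4<..<3/4}" using that by auto
        then show ?thesis using g(4)[of t] bump_eq_0[of t "1/4" "3/4" 1] by (simp add: w_def del: One_nat_def)
      qed
      have "integral {0..1} w = integral {0..1} g + (- k) * integral {0..1} ?g0"
      proof -
        have "integral {0..1} w = integral {0..1} g + integral {0..1} (\<lambda>t. (- k) * ?g0 t)"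
          unfolding w_def by (intro Henstock_Kurzweil_Integration.integral_add integrable_continuous_real
              continuous_on_mult continuous_on_const smooth1_continuous gs g0)
        then show ?thesis by simp
      qed
      then show "integral {0..1} w = 0" using I0 by (simp add: k_def)
    qed
    moreover have "?J w = (LINT r:{0<..<1}|lborel. h r * of_real (2 * r * g (r\<^sup>2)) - of_real k * (h r * of_real (2 * r * ?g0 (r\<^sup>2))))"
      by (intro set_lebesgue_integral_cong allI impI) (auto simp: w_def algebra_simps)
    moreover have "\<dots> = ?J g - of_real k * ?J ?g0"
      by (subst set_integral_diff(2)) (intro hmul gs, intro set_integrable_mult_right impI hmul g0, simp only: set_integral_mult_right)
    ultimately have Jg: "?J g = C * of_real (integral {0..1} g)"
      using I0 by (simp add: C_def k_def field_simps)
    obtain f where f: "\<And>x. (f has_real_derivative g x) (at x)"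
      using smooth1_antiderivative_exists[OF gs] by metis
    have "(LINT r:{0..1}|lborel. 2 * r * g (r\<^sup>2)) = f (1\<^sup>2) - f (0\<^sup>2)"
      unfolding set_lebesgue_integral_def
    proof (rule integral_FTC_atLeastAtMost)
      fix r :: real
      have "((\<lambda>r. f (r\<^sup>2)) has_real_derivative g (r\<^sup>2) * (2 * r)) (at r within {0..1})"
        by (rule DERIV_chain2[OF f(1)]) (auto intro!: derivative_eq_intros)
      then show "((\<lambda>r. f (r\<^sup>2)) has_vector_derivative 2 * r * g (r\<^sup>2)) (at r within {0..1})"
        by (simp add: has_real_derivative_iff_has_vector_derivative mult_ac)
    qed (use c2(1)[OF gs] in auto)
    moreover have "(g has_integral (f 1 - f 0)) {0..1}"
      by (rule fundamental_theorem_of_calculus)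
        (use f(1) in \<open>auto simp: has_real_derivative_iff_has_vector_derivative[symmetric] intro: has_field_derivative_at_within\<close>)
    ultimately have Ig: "(LINT r:{0..1}|lborel. 2 * r * g (r\<^sup>2)) = integral {0..1} g"
      by (simp add: integral_unique)
    have ci: "set_integrable lborel {0..1} (\<lambda>r. complex_of_real (2 * r * g (r\<^sup>2)))"
      by (intro borel_integrable_atLeastAtMost' continuous_on_of_real c2 gs)
    have ci': "set_integrable lborel {0<..<1} (\<lambda>r. C * complex_of_real (2 * r * g (r\<^sup>2)))"
      by (intro set_integrable_mult_right impI set_integrable_subset[OF ci]) auto
    have "(LINT r:{0<..<1}|lborel. complex_of_real (2 * r * g (r\<^sup>2))) = (LINT r:{0..1}|lborel. complex_of_real (2 * r * g (r\<^sup>2)))"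
      by (rule set_integral_Ioo_eq_Icc[OF order.refl zero_le_one ci]) auto
    also have "\<dots> = of_real (LINT r:{0..1}|lborel. 2 * r * g (r\<^sup>2))"
      by (rule set_integral_complex_of_real)
    finally have Ig': "(LINT r:{0<..<1}|lborel. complex_of_real (2 * r * g (r\<^sup>2))) = of_real (integral {0..1} g)"
      by (simp only: Ig)
    have "(LINT r:{0<..<1}|lborel. G r * of_real (g (r\<^sup>2))) =
        (LINT r:{0<..<1}|lborel. h r * of_real (2 * r * g (r\<^sup>2)) - C * of_real (2 * r * g (r\<^sup>2)))"
      by (intro set_lebesgue_integral_cong allI impI) (auto simp: G_def algebra_simps)
    also have "\<dots> = ?J g - C * of_real (integral {0..1} g)"
      by (subst set_integral_diff(2)[OF hmul[OF gs] ci']) (simp only: set_integral_mult_right Ig')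
    finally show ?thesis using Jg by simp
  qed
  have Gint: "(LINT r:{x<..<y}|lborel. G r) = 0" if xy: "0 < x" "y < 1" for x y
  proof (cases "x < y")
    case True
    have "(\<lambda>n. LINT r|lborel. indicator {0<..<1} r *\<^sub>R (G r * of_real (bump (x\<^sup>2) (y\<^sup>2) n (r\<^sup>2)))) \<longlonglongrightarrow>
       (LINT r|lborel. indicator {x<..<y} r *\<^sub>R G r)"
    proof (rule integral_dominated_convergence[where w="\<lambda>r. norm (indicator {0<..<1} r *\<^sub>R G r)"])
      have bm: "smooth1 (bump (x\<^sup>2) (y\<^sup>2) n)" for n by (rule flat_alg_smooth1[OF bump_flat_alg])
      show "(\<lambda>r. indicator {x<..<y} r *\<^sub>R G r) \<in> borel_measurable lborel"
      proof -
        have "{x<..<y} \<subseteq> {0<..<1}" using xy by auto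
        from set_integrable_subset[OF Gi _ this] show ?thesis
          unfolding set_integrable_def by (intro borel_measurable_integrable) simp
      qed
      show "(\<lambda>r. indicator {0<..<1} r *\<^sub>R (G r * of_real (bump (x\<^sup>2) (y\<^sup>2) n (r\<^sup>2)))) \<in> borel_measurable lborel" for n
        using mc[OF Gi c2(2)[OF bm]] by (auto simp: set_integrable_def dest: borel_measurable_integrable)
      show "integrable lborel (\<lambda>r. norm (indicator {0<..<1} r *\<^sub>R G r))"
        using Gi by (simp add: set_integrable_def del: norm_scaleR)
      show "AE r in lborel. norm (indicator {0<..<1} r *\<^sub>R (G r * of_real (bump (x\<^sup>2) (y\<^sup>2) n (r\<^sup>2)))) \<le> norm (indicator {0<..<1} r *\<^sub>R G r)" for n
        by (intro AE_I2) (auto simp: norm_mult bump_bounds intro!: mult_left_mono mult_left_le)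
      show "AE r in lborel. (\<lambda>n. indicator {0<..<1} r *\<^sub>R (G r * of_real (bump (x\<^sup>2) (y\<^sup>2) n (r\<^sup>2)))) \<longlonglongrightarrow> indicator {x<..<y} r *\<^sub>R G r"
      proof (intro AE_I2)
        fix r :: real
        have "(\<lambda>n. indicator {0<..<1} r *\<^sub>R (G r * of_real (bump (x\<^sup>2) (y\<^sup>2) n (r\<^sup>2)))) \<longlonglongrightarrow> indicator {0<..<1} r *\<^sub>R (G r * of_real (indicator {x\<^sup>2<..<y\<^sup>2} (r\<^sup>2)))"
          by (intro tendsto_intros bump_tendsto)
        also have "indicator {0<..<1} r *\<^sub>R (G r * of_real (indicator {x\<^sup>2<..<y\<^sup>2} (r\<^sup>2))) = indicator {x<..<y} r *\<^sub>R G r"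
          using xy True by (auto simp: indicator_def power_strict_mono not_less intro: power_mono dest: power_less_imp_less_base)
        finally show "(\<lambda>n. indicator {0<..<1} r *\<^sub>R (G r * of_real (bump (x\<^sup>2) (y\<^sup>2) n (r\<^sup>2)))) \<longlonglongrightarrow> indicator {x<..<y} r *\<^sub>R G r" .
      qed
    qed
    moreover have "(LINT r|lborel. indicator {0<..<1} r *\<^sub>R (G r * of_real (bump (x\<^sup>2) (y\<^sup>2) n (r\<^sup>2)))) = 0" for n
    proof -
      have y2: "y\<^sup>2 < 1" using xy True by (simp add: power_less_one_iff)
      have "(LINT r:{0<..<1}|lborel. G r * of_real (bump (x\<^sup>2) (y\<^sup>2) n (r\<^sup>2))) = 0"
        by (rule Gzero[OF bump_flat_alg _ y2, of "x\<^sup>2"]) (use xy in \<open>auto intro: bump_eq_0\<close>)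
      then show ?thesis by (simp only: set_lebesgue_integral_def)
    qed
    ultimately show ?thesis by (simp add: LIMSEQ_const_iff set_lebesgue_integral_def)
  qed (simp add: set_lebesgue_integral_def)
  have AEn: "AE r in lborel. r \<in> {1 / (real n + 2)<..<1 - 1 / (real n + 2)} \<longrightarrow> G r = 0" for n :: nat
  proof -
    define e where "e = 1 / (real n + 2)"
    have e: "0 < e" "1 - e < 1" by (auto simp: e_def)
    have "AE r in lborel. indicator {e<..<1 - e} r *\<^sub>R G r = 0"
    proof (rule AE_zero_if_box_integrals_zero)
      show "integrable lborel (\<lambda>r. indicator {e<..<1 - e} r *\<^sub>R G r)"
      proof -
        have "{e<..<1 - e} \<subseteq> {0<..<1}" using e by auto
        from set_integrable_subset[OF Gi _ this] show ?thesis
          unfolding set_integrable_def by simp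
      qed
      fix x y :: real
      have "(LINT r:box x y|lborel. indicator {e<..<1 - e} r *\<^sub>R G r) = (LINT r:{max x e<..<min y (1 - e)}|lborel. G r)"
        unfolding set_lebesgue_integral_def by (intro Bochner_Integration.integral_cong) (auto simp: indicator_def box_real)
      also have "\<dots> = 0" by (rule Gint) (use e in auto)
      finally show "(LINT r:box x y|lborel. indicator {e<..<1 - e} r *\<^sub>R G r) = 0" .
    qed
    then show ?thesis by eventually_elim (auto simp: e_def indicator_def add.commute)
  qed
  have "AE r in lborel. r \<in> {0<..<1} \<longrightarrow> Q r = C - (LINT s:{r..1}|lborel. b s)"
    using AEn[THEN AE_all_countable[THEN iffD2, OF allI]]
  proof eventually_elim
    fix r :: real assume *: "\<forall>n::nat. r \<in> {1 / (real n + 2)<..<1 - 1 / (real n + 2)} \<longrightarrow> G r = 0"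
    show "r \<in> {0<..<1} \<longrightarrow> Q r = C - (LINT s:{r..1}|lborel. b s)"
    proof
      assume r: "r \<in> {0<..<1}"
      obtain n where "1 / real (Suc n) < min r (1 - r)" using nat_approx_posE[of "min r (1 - r)"] r by auto
      moreover have "1 / (real n + 2) \<le> 1 / real (Suc n)" by (simp add: frac_le)
      ultimately have "G r = 0" using *[rule_format, of n] by auto
      then have "h r = C" using r by (simp add: G_def)
      then show "Q r = C - (LINT s:{r..1}|lborel. b s)"
        by (simp add: h_def H_def eq_diff_eq)
    qed
  qed
  then show ?thesis by (rule that)
qed

section \<open>Homogeneous polynomials\<close>

inductive homogeneous_poly :: "nat \<Rightarrow> ('a::euclidean_space \<Rightarrow> complex) \<Rightarrow> bool" where
  const: "homogeneous_poly 0 (\<lambda>_. c)"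
| add: "homogeneous_poly k p \<Longrightarrow> homogeneous_poly k q \<Longrightarrow> homogeneous_poly k (\<lambda>x. p x + q x)"
| coord: "homogeneous_poly k p \<Longrightarrow> homogeneous_poly (Suc k) (\<lambda>x. of_real (x \<bullet> c) * p x)"

lemma homogeneous_poly_smooth_alg: "homogeneous_poly k p \<Longrightarrow> smooth_alg p"
  by (induction rule: homogeneous_poly.induct) (auto intro: smooth_alg_rules)

lemma homogeneous_poly_scaleR: "homogeneous_poly k p \<Longrightarrow> p (t *\<^sub>R x) = of_real (t ^ k) * p x"
  by (induction rule: homogeneous_poly.induct) (auto simp: algebra_simps)

lemma homogeneous_poly_zero: "homogeneous_poly k (\<lambda>_. 0)"
proof (induction k)
  case (Suc k)
  from homogeneous_poly.coord[OF this, of 0] show ?case by simp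
qed (rule homogeneous_poly.const)

lemma homogeneous_poly_cmult: "homogeneous_poly k p \<Longrightarrow> homogeneous_poly k (\<lambda>x. c * p x)"
proof (induction rule: homogeneous_poly.induct)
  case (add k p q)
  then show ?case using homogeneous_poly.add by (fastforce simp: distrib_left)
next
  case (coord k p b)
  then show ?case using homogeneous_poly.coord[OF coord.IH, of b] by (simp add: mult.left_commute)
qed (rule homogeneous_poly.const)

lemma homogeneous_poly_sum:
  "finite B \<Longrightarrow> (\<And>b. b \<in> B \<Longrightarrow> homogeneous_poly k (p b)) \<Longrightarrow> homogeneous_poly k (\<lambda>x. \<Sum>b\<in>B. p b x)"
  by (induction B rule: finite_induct) (auto intro: homogeneous_poly_zero homogeneous_poly.add)

text \<open>A derivative in degree zero vanishes, hence it is also homogeneous of degree \<open>0 - 1 = 0\<close>.\<close>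

lemma homogeneous_poly_dir_deriv:
  "homogeneous_poly k p \<Longrightarrow> homogeneous_poly (k - 1) (dir_deriv p b) \<and> (k = 0 \<longrightarrow> dir_deriv p b = (\<lambda>_. 0))"
proof (induction rule: homogeneous_poly.induct)
  case (const c)
  then show ?case by (simp add: dir_deriv_const homogeneous_poly_zero)
next
  case (add k p q)
  have "dir_deriv (\<lambda>x. p x + q x) b = (\<lambda>x. dir_deriv p b x + dir_deriv q b x)"
    using add.hyps[THEN homogeneous_poly_smooth_alg] by (auto simp: dir_deriv_add smooth_alg_differentiable)
  then show ?case using add by (auto intro: homogeneous_poly.add)
next
  case (coord k p c)
  have eq: "dir_deriv (\<lambda>x. of_real (x \<bullet> c) * p x) b = (\<lambda>x. of_real (x \<bullet> c) * dir_deriv p b x + of_real (b \<bullet> c) * p x)"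
    using coord.hyps[THEN homogeneous_poly_smooth_alg]
    by (auto simp: dir_deriv_mult smooth_alg_differentiable smooth_alg.coord dir_deriv_coord)
  have "homogeneous_poly k (\<lambda>x. of_real (x \<bullet> c) * dir_deriv p b x)"
  proof (cases k)
    case 0
    then show ?thesis using coord by (simp add: homogeneous_poly_zero)
  next
    case (Suc j)
    then show ?thesis using coord homogeneous_poly.coord[of j "dir_deriv p b" c] by simp
  qed
  then show ?case using eq coord.hyps by (auto intro!: homogeneous_poly.add homogeneous_poly_cmult)
qed

lemma homogeneous_poly_euler:
  "homogeneous_poly k p \<Longrightarrow> (\<Sum>b\<in>Basis. of_real (x \<bullet> b) * dir_deriv p b x) = of_nat k * p x"
proof (induction rule: homogeneous_poly.induct)
  case (const c)
  then show ?case by (simp add: dir_deriv_const)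
next
  case (add k p q)
  then show ?case
    by (simp add: dir_deriv_add smooth_alg_differentiable homogeneous_poly_smooth_alg distrib_left sum.distrib)
next
  case (coord k p c)
  have "(\<Sum>b\<in>Basis. of_real (x \<bullet> b) * dir_deriv (\<lambda>x. of_real (x \<bullet> c) * p x) b x) =
     of_real (x \<bullet> c) * (\<Sum>b\<in>Basis. of_real (x \<bullet> b) * dir_deriv p b x) + of_real (\<Sum>b\<in>Basis. (x \<bullet> b) * (b \<bullet> c)) * p x"
    using coord.hyps[THEN homogeneous_poly_smooth_alg]
    by (simp add: dir_deriv_mult smooth_alg_differentiable smooth_alg.coord dir_deriv_coord
        sum_distrib_left sum_distrib_right sum.distrib algebra_simps)
  also have "(\<Sum>b\<in>Basis. (x \<bullet> b) * (b \<bullet> c)) = x \<bullet> c"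
    by (subst euclidean_inner[of x c]) (simp add: inner_commute)
  finally show ?case using coord.IH by (simp add: algebra_simps)
qed

definition laplacian :: "('a::euclidean_space \<Rightarrow> complex) \<Rightarrow> 'a \<Rightarrow> complex" where
  "laplacian f x = (\<Sum>b\<in>Basis. dir_deriv (dir_deriv f b) b x)"

text \<open>For \<open>k < 2\<close> the degree \<open>k - 2\<close> is \<open>0\<close> and says little; what matters then is that the Laplacian
  vanishes. This starts the induction over the degree.\<close>

lemma homogeneous_poly_laplacian:
  assumes "homogeneous_poly k p"
  shows "homogeneous_poly (k - 2) (laplacian p)" and "k < 2 \<Longrightarrow> laplacian p = (\<lambda>_. 0)"
proof -
  have h: "homogeneous_poly (k - 1) (dir_deriv p b)" for b
    using homogeneous_poly_dir_deriv[OF assms] by blast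
  then have "homogeneous_poly (k - 1 - 1) (dir_deriv (dir_deriv p b) b)" for b
    using homogeneous_poly_dir_deriv by blast
  then show "homogeneous_poly (k - 2) (laplacian p)"
    unfolding laplacian_def[abs_def] by (intro homogeneous_poly_sum) (auto simp: diff_diff_left numeral_2_eq_2)
  show "laplacian p = (\<lambda>_. 0)" if "k < 2"
    using homogeneous_poly_dir_deriv[OF h] that unfolding laplacian_def[abs_def] by auto
qed

text \<open>The mixed term contains \<open>x \<bullet> \<nabla>p\<close>, which is \<open>k p\<close> by Euler's identity.\<close>

lemma laplacian_radial_times_homogeneous:
  fixes p :: "'a::euclidean_space \<Rightarrow> complex" and f f' f'' :: "real \<Rightarrow> real"
  assumes p: "homogeneous_poly k p"
    and f: "\<And>t. (f has_real_derivative f' t) (at t)" and f': "\<And>t. (f' has_real_derivative f'' t) (at t)"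
    and s: "smooth1 f" "smooth1 f'"
  shows "laplacian (\<lambda>x. of_real (f (x \<bullet> x)) * p x) x =
     of_real (f (x \<bullet> x)) * laplacian p x +
     of_real (4 * (x \<bullet> x) * f'' (x \<bullet> x) + (2 * DIM('a) + 4 * k) * f' (x \<bullet> x)) * p x"
proof -
  note pa = homogeneous_poly_smooth_alg[OF p]
  note dif = smooth_alg_differentiable[OF pa] smooth_alg_differentiable[OF homogeneous_poly_smooth_alg[OF conjunct1[OF homogeneous_poly_dir_deriv[OF p]]]]
     smooth_alg_differentiable[OF smooth_alg.radial[OF s(1)]]  smooth_alg_differentiable[OF smooth_alg.radial[OF s(2)]]
     smooth_alg_differentiable[OF smooth_alg.coord]
  have df: "dir_deriv (\<lambda>x. complex_of_real (f (x \<bullet> x))) b = (\<lambda>x. of_real (f' (x \<bullet> x)) * (2 * of_real (x \<bullet> b)))" for b :: 'a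
    by (rule ext, subst dir_deriv_eq[OF has_derivative_radial[OF f]]) simp
  have df': "dir_deriv (\<lambda>x. complex_of_real (f' (x \<bullet> x))) b = (\<lambda>x. of_real (f'' (x \<bullet> x)) * (2 * of_real (x \<bullet> b)))" for b :: 'a
    by (rule ext, subst dir_deriv_eq[OF has_derivative_radial[OF f']]) simp
  have d1: "dir_deriv (\<lambda>x. of_real (f (x \<bullet> x)) * p x) b =
      (\<lambda>x. of_real (f (x \<bullet> x)) * dir_deriv p b x + (of_real (f' (x \<bullet> x)) * (2 * (of_real (x \<bullet> b) * p x))))" for b :: 'a
    by (rule ext, subst dir_deriv_mult) (auto simp: dif df)
  have dc: "dir_deriv (\<lambda>x. 2 * (of_real (x \<bullet> b) * p x)) b x = 2 * (of_real (x \<bullet> b) * dir_deriv p b x + of_real (b \<bullet> b) * p x)" for b x :: 'a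
    by (subst dir_deriv_mult, simp, simp add: dif) (subst dir_deriv_mult, auto simp: dif dir_deriv_coord dir_deriv_const)
  have d2: "dir_deriv (dir_deriv (\<lambda>x. of_real (f (x \<bullet> x)) * p x) b) b x =
     of_real (f (x \<bullet> x)) * dir_deriv (dir_deriv p b) b x
     + 4 * (of_real (f' (x \<bullet> x)) * (of_real (x \<bullet> b) * dir_deriv p b x))
     + of_real (2 * f' (x \<bullet> x)) * p x
     + of_real (4 * f'' (x \<bullet> x) * (x \<bullet> b)\<^sup>2) * p x" if b: "b \<in> Basis" for b
  proof -
    have e1: "dir_deriv (\<lambda>x. of_real (f (x \<bullet> x)) * dir_deriv p b x) b x =
       of_real (f (x \<bullet> x)) * dir_deriv (dir_deriv p b) b x + of_real (f' (x \<bullet> x)) * (2 * of_real (x \<bullet> b)) * dir_deriv p b x"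
      by (subst dir_deriv_mult[OF dif(3) dif(2)]) (simp only: df)
    have e2: "dir_deriv (\<lambda>x. of_real (f' (x \<bullet> x)) * (2 * (of_real (x \<bullet> b) * p x))) b x =
       of_real (f' (x \<bullet> x)) * (2 * (of_real (x \<bullet> b) * dir_deriv p b x + of_real (b \<bullet> b) * p x))
       + of_real (f'' (x \<bullet> x)) * (2 * of_real (x \<bullet> b)) * (2 * (of_real (x \<bullet> b) * p x))"
      by (subst dir_deriv_mult, rule dif(4), simp add: dif) (simp only: dc df')
    show ?thesis
      unfolding d1
      by (subst dir_deriv_add, simp add: dif, simp add: dif)
        (simp only: e1 e2, simp add: b power2_eq_square algebra_simps)
  qed
  have "laplacian (\<lambda>x. of_real (f (x \<bullet> x)) * p x) x = (\<Sum>b\<in>Basis. of_real (f (x \<bullet> x)) * dir_deriv (dir_deriv p b) b x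
     + 4 * (of_real (f' (x \<bullet> x)) * (of_real (x \<bullet> b) * dir_deriv p b x))
     + of_real (2 * f' (x \<bullet> x)) * p x
     + of_real (4 * f'' (x \<bullet> x) * (x \<bullet> b)\<^sup>2) * p x)"
    unfolding laplacian_def by (intro sum.cong refl d2)
  also have "\<dots> =
     of_real (f (x \<bullet> x)) * laplacian p x
     + 4 * (of_real (f' (x \<bullet> x)) * (\<Sum>b\<in>Basis. of_real (x \<bullet> b) * dir_deriv p b x))
     + of_real (2 * f' (x \<bullet> x)) * p x * DIM('a)
     + of_real (4 * f'' (x \<bullet> x) * (\<Sum>b\<in>Basis. (x \<bullet> b)\<^sup>2)) * p x"
    unfolding laplacian_def
    by (simp add: sum.distrib sum_distrib_left[symmetric] sum_distrib_right[symmetric] mult.commute)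
  also have "(\<Sum>b\<in>Basis. (x \<bullet> b)\<^sup>2) = x \<bullet> x"
    by (subst euclidean_inner[of x x]) (simp add: power2_eq_square)
  finally show ?thesis using homogeneous_poly_euler[OF p, of x] by (simp add: algebra_simps)
qed

lemma radial_times_poly_test_function:
  assumes p: "homogeneous_poly k p" and f: "smooth1 f" and supp: "\<And>t. t \<notin> {a..b} \<Longrightarrow> f t = 0" "b < 1"
  shows "(\<lambda>x. of_real (f (x \<bullet> x)) * p x) \<in> test_functions"
proof -
  have "smooth (\<lambda>x. of_real (f (x \<bullet> x)) * p x)"
    by (intro smooth_alg_smooth smooth_alg.mult smooth_alg.radial f homogeneous_poly_smooth_alg[OF p])
  moreover have "cball 0 (sqrt (max 0 b)) \<subseteq> ball (0::'a) 1" 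
  proof -
    have "sqrt (max 0 b) < 1" using supp(2) by simp
    from le_less_trans[OF _ this] show ?thesis unfolding subset_iff mem_cball_0 mem_ball_0 by blast
  qed
  moreover have "of_real (f (x \<bullet> x)) * p x = 0" if "x \<notin> cball 0 (sqrt (max 0 b))" for x
  proof -
    have "sqrt (max 0 b) < norm x" using that by auto
    then have "(sqrt (max 0 b))\<^sup>2 < (norm x)\<^sup>2" by (intro power_strict_mono) auto
    then have "max 0 b < (norm x)\<^sup>2" by simp
    then show ?thesis using supp(1)[of "x \<bullet> x"] by (auto simp: power2_norm_eq_inner)
  qed
  ultimately show ?thesis unfolding test_functions_def using compact_cball by blast
qed

text \<open>One harmonic polynomial in each degree is enough for the comparison solutions; this one depends
  on the plane of \<open>a\<close> and \<open>b\<close> only.\<close>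

definition planar_harmonic :: "'a::euclidean_space \<Rightarrow> 'a \<Rightarrow> nat \<Rightarrow> 'a \<Rightarrow> complex" where
  "planar_harmonic a b k x = (of_real (x \<bullet> a) + \<i> * of_real (x \<bullet> b)) ^ k"

lemma homogeneous_poly_planar_harmonic: "homogeneous_poly k (planar_harmonic a b k)"
proof (induction k)
  case 0
  show ?case unfolding planar_harmonic_def[abs_def] using homogeneous_poly.const[of 1] by simp
next
  case (Suc k)
  have "homogeneous_poly (Suc k) (\<lambda>x. of_real (x \<bullet> a) * planar_harmonic a b k x + \<i> * (of_real (x \<bullet> b) * planar_harmonic a b k x))"
    by (intro homogeneous_poly.add homogeneous_poly.coord homogeneous_poly_cmult Suc)
  then show ?case by (simp add: planar_harmonic_def[abs_def] algebra_simps)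
qed

text \<open>The Laplacian of \<open>L\<^sup>k\<close> for a complex linear form \<open>L\<close> is a multiple of the sum of the squares of the
  coefficients of \<open>L\<close>, and here this sum is \<open>1 + i\<^sup>2 = 0\<close>.\<close>

lemma laplacian_planar_harmonic:
  assumes ab: "a \<in> Basis" "b \<in> Basis" "a \<noteq> b"
  shows "laplacian (planar_harmonic a b k) = (\<lambda>_. 0)"
proof -
  let ?l = "\<lambda>x. of_real (x \<bullet> a) + \<i> * of_real (x \<bullet> b)"
  have hal: "smooth_alg (planar_harmonic a b k)" for k
    by (rule homogeneous_poly_smooth_alg[OF homogeneous_poly_planar_harmonic])
  have lal: "smooth_alg ?l" by (intro smooth_alg_rules)
  have dl: "dir_deriv ?l c x = ?l c" for c x
    by (subst dir_deriv_add, simp add: smooth_alg_differentiable smooth_alg.coord, simp add: smooth_alg_differentiable smooth_alg_rules)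
      (subst dir_deriv_mult, auto simp: dir_deriv_coord dir_deriv_const smooth_alg_differentiable smooth_alg.coord)
  have d: "dir_deriv (planar_harmonic a b (Suc k)) c = (\<lambda>x. (of_nat (Suc k) * ?l c) * planar_harmonic a b k x)" for k c
  proof (induction k)
    case 0
    show ?case using dl by (simp add: planar_harmonic_def[abs_def] fun_eq_iff)
  next
    case (Suc k)
    have eq: "planar_harmonic a b (Suc (Suc k)) = (\<lambda>x. ?l x * planar_harmonic a b (Suc k) x)"
      by (simp add: planar_harmonic_def fun_eq_iff)
    show ?case
    proof
      fix x
      have "dir_deriv (planar_harmonic a b (Suc (Suc k))) c x = ?l x * dir_deriv (planar_harmonic a b (Suc k)) c x + ?l c * planar_harmonic a b (Suc k) x"
        unfolding eq by (subst dir_deriv_mult) (auto simp only: smooth_alg_differentiable[OF hal] smooth_alg_differentiable[OF lal] dl)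
      also have "\<dots> = (of_nat (Suc (Suc k)) * ?l c) * planar_harmonic a b (Suc k) x"
        unfolding Suc by (simp add: planar_harmonic_def algebra_simps)
      finally show "dir_deriv (planar_harmonic a b (Suc (Suc k))) c x = (of_nat (Suc (Suc k)) * ?l c) * planar_harmonic a b (Suc k) x" .
    qed
  qed
  have d0: "dir_deriv (planar_harmonic a b 0) c = (\<lambda>_. 0)" for c
    by (simp add: planar_harmonic_def[abs_def] dir_deriv_const)
  have dm: "dir_deriv (\<lambda>x. z * planar_harmonic a b k x) c x = z * dir_deriv (planar_harmonic a b k) c x" for z k c x
    by (subst dir_deriv_mult) (auto simp: smooth_alg_differentiable[OF hal] dir_deriv_const)
  have sq: "(\<Sum>c\<in>Basis. ?l c * ?l c) = 0"
  proof -
    have "(\<Sum>c\<in>Basis. ?l c * ?l c) = (\<Sum>c\<in>Basis. of_real ((a \<bullet> c) * (a \<bullet> c) - (b \<bullet> c) * (b \<bullet> c)) + 2 * \<i> * of_real ((a \<bullet> c) * (b \<bullet> c)))"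
      by (intro sum.cong refl) (simp add: inner_commute algebra_simps)
    also have "\<dots> = of_real ((\<Sum>c\<in>Basis. (a \<bullet> c) * (a \<bullet> c)) - (\<Sum>c\<in>Basis. (b \<bullet> c) * (b \<bullet> c))) + 2 * \<i> * of_real (\<Sum>c\<in>Basis. (a \<bullet> c) * (b \<bullet> c))"
      by (simp add: sum.distrib sum_subtractf sum_distrib_left)
    also have "\<dots> = 0"
      unfolding euclidean_inner[symmetric] using ab by (simp add: inner_Basis)
    finally show ?thesis .
  qed
  consider "k = 0" | "k = Suc 0" | j where "k = Suc (Suc j)" by (metis One_nat_def not0_implies_Suc)
  then show ?thesis
  proof cases
    case 3
    show ?thesis
    proof
      fix x
      have "laplacian (planar_harmonic a b k) x = (\<Sum>c\<in>Basis. (?l c * ?l c) * (of_nat (Suc (Suc j)) * of_nat (Suc j) * planar_harmonic a b j x))"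
        unfolding laplacian_def 3 d by (intro sum.cong refl) (subst dm, subst d, simp only: mult_ac)
      also have "\<dots> = 0" unfolding sum_distrib_right[symmetric] sq by simp
      finally show "laplacian (planar_harmonic a b k) x = 0" .
    qed
  qed (auto simp: laplacian_def fun_eq_iff d d0 dm dir_deriv_const)
qed

lemma smooth_alg_cnj_planar_harmonic: "smooth_alg (\<lambda>x. cnj (planar_harmonic a b k x))"
proof -
  have "smooth_alg (\<lambda>x. (of_real (x \<bullet> a) + (- \<i>) * of_real (x \<bullet> b)) ^ k)"
    by (intro smooth_alg_power smooth_alg_rules)
  then show ?thesis by (simp add: planar_harmonic_def)
qed

section \<open>Spherical integrals\<close>

lemma finite_measure_unit_ball: "finite_measure (unit_ball_measure :: 'a::euclidean_space measure)"
proof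
  have "emeasure unit_ball_measure (ball 0 1 :: 'a set) = emeasure lborel (ball 0 1 :: 'a set)"
    by (subst emeasure_restrict_space) (auto simp: emeasure_completion)
  then show "emeasure unit_ball_measure (space unit_ball_measure :: 'a set) \<noteq> \<infinity>"
    using emeasure_lborel_ball_finite[of "0::'a" 1] by (simp add: less_top)
qed

lemma borel_measurable_lebesgue_onI: 
  fixes f :: "'a::euclidean_space \<Rightarrow> 'b::topological_space"
  shows "f \<in> borel_measurable borel \<Longrightarrow> f \<in> borel_measurable (lebesgue_on S)"
  by (intro measurable_restrict_space1 measurable_completion) simp

lemma ex_borel_representative:
  fixes g :: "'a::euclidean_space \<Rightarrow> complex"
  assumes g: "g \<in> borel_measurable (lebesgue_on S)" and S: "S \<in> sets lebesgue"
  obtains z where "z \<in> borel_measurable borel" "AE x in lebesgue_on S. g x = z x"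
proof -
  have gm[measurable]: "(\<lambda>x. indicator S x *\<^sub>R g x) \<in> borel_measurable lebesgue"
    using g S by (simp add: borel_measurable_restrict_space_iff)
  have re: "(\<lambda>x. Re (indicator S x *\<^sub>R g x)) \<in> borel_measurable lebesgue"
    and im: "(\<lambda>x. Im (indicator S x *\<^sub>R g x)) \<in> borel_measurable lebesgue"
    by (intro measurable_compose[OF gm]; simp)+
  obtain z1 where z1: "z1 \<in> borel_measurable lborel" "AE x in lborel. Re (indicator S x *\<^sub>R g x) = z1 x"
    using completion_ex_borel_measurable_real[OF re] by blast
  obtain z2 where z2: "z2 \<in> borel_measurable lborel" "AE x in lborel. Im (indicator S x *\<^sub>R g x) = z2 x"
    using completion_ex_borel_measurable_real[OF im] by blast
  have [measurable]: "z1 \<in> borel_measurable borel" "z2 \<in> borel_measurable borel" using z1 z2 by auto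
  have "AE x in lborel. indicator S x *\<^sub>R g x = Complex (z1 x) (z2 x)"
    using z1(2) z2(2) by eventually_elim (auto simp: complex_eq_iff)
  then have "AE x in lebesgue. indicator S x *\<^sub>R g x = Complex (z1 x) (z2 x)"
    by (rule AE_completion)
  then have "AE x in lebesgue_on S. g x = Complex (z1 x) (z2 x)"
    using S by (subst AE_restrict_space_iff) (auto elim!: eventually_mono)
  moreover have "(\<lambda>x. Complex (z1 x) (z2 x)) \<in> borel_measurable borel"
    unfolding Complex_eq by measurable
  ultimately show ?thesis using that by blast
qed

lemma (in finite_measure) integrable_norm_if_square:
  fixes f :: "'a \<Rightarrow> complex"
  assumes f: "f \<in> borel_measurable M" and f2: "integrable M (\<lambda>x. (norm (f x))\<^sup>2)"
  shows "integrable M f"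
proof (rule Bochner_Integration.integrable_bound[OF _ f])
  show "integrable M (\<lambda>x. 1 + (norm (f x))\<^sup>2)" using f2 by simp
  have "norm (f x) \<le> 1 + (norm (f x))\<^sup>2" for x
  proof -
    have "0 \<le> (norm (f x) - 1)\<^sup>2 + (norm (f x))\<^sup>2 + 1" by (intro add_nonneg_nonneg) auto
    then show ?thesis by (simp add: power2_diff)
  qed
  then show "AE x in M. norm (f x) \<le> norm (1 + (norm (f x))\<^sup>2)"
    by (intro AE_I2) (simp add: order.trans[OF _ abs_ge_self])
qed

lemma (in finite_measure) L1_tendsto_if_L2_tendsto:
  fixes f :: "nat \<Rightarrow> 'a \<Rightarrow> complex"
  assumes f: "\<And>k. f k \<in> borel_measurable M" and f2: "\<And>k. integrable M (\<lambda>x. (norm (f k x))\<^sup>2)"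
    and lim: "(\<lambda>k. LINT x|M. (norm (f k x))\<^sup>2) \<longlonglongrightarrow> 0"
  shows "(\<lambda>k. LINT x|M. norm (f k x)) \<longlonglongrightarrow> 0"
proof (rule real_tendsto_sandwich[where f="\<lambda>_. 0" and h="\<lambda>k. sqrt (measure M (space M) * (LINT x|M. (norm (f k x))\<^sup>2))"])
  have "(\<lambda>k. sqrt (measure M (space M) * (LINT x|M. (norm (f k x))\<^sup>2))) \<longlonglongrightarrow> sqrt (measure M (space M) * 0)"
    by (intro tendsto_intros lim)
  then show "(\<lambda>k. sqrt (measure M (space M) * (LINT x|M. (norm (f k x))\<^sup>2))) \<longlonglongrightarrow> 0" by simp
  have "(LINT x|M. norm (f k x)) \<le> sqrt (measure M (space M) * (LINT x|M. (norm (f k x))\<^sup>2))" for k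
    using integral_power2_le[of "\<lambda>x. norm (f k x)"] f2 integrable_norm[OF integrable_norm_if_square[OF f f2]]
    by (intro real_le_rsqrt) auto
  then show "eventually (\<lambda>k. (LINT x|M. norm (f k x)) \<le> sqrt (measure M (space M) * (LINT x|M. (norm (f k x))\<^sup>2))) sequentially"
    by simp
qed auto

lemma norm_diff_square_le: "(norm (a - b :: complex))\<^sup>2 \<le> 2 * (norm a)\<^sup>2 + 2 * (norm b)\<^sup>2"
proof -
  have "(norm (a - b))\<^sup>2 \<le> (norm a + norm b)\<^sup>2" by (intro power_mono norm_triangle_ineq4) auto
  also have "\<dots> \<le> 2 * (norm a)\<^sup>2 + 2 * (norm b)\<^sup>2"
    using zero_le_power2[of "norm a - norm b"] unfolding power2_sum power2_diff by linarith
  finally show ?thesis .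
qed

lemma integrable_diff_square:
  fixes f g :: "'a \<Rightarrow> complex"
  assumes "f \<in> borel_measurable M" "g \<in> borel_measurable M"
    and "integrable M (\<lambda>x. (norm (f x))\<^sup>2)" "integrable M (\<lambda>x. (norm (g x))\<^sup>2)"
  shows "integrable M (\<lambda>x. (norm (f x - g x))\<^sup>2)"
proof (rule Bochner_Integration.integrable_bound)
  show "integrable M (\<lambda>x. 2 * (norm (f x))\<^sup>2 + 2 * (norm (g x))\<^sup>2)" using assms by simp
  show "(\<lambda>x. (norm (f x - g x))\<^sup>2) \<in> borel_measurable M" using assms by measurable
  show "AE x in M. norm ((norm (f x - g x))\<^sup>2) \<le> norm (2 * (norm (f x))\<^sup>2 + 2 * (norm (g x))\<^sup>2)"
    by (intro AE_I2) (simp add: norm_diff_square_le)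
qed

definition sphere_integral :: "('a::euclidean_space \<Rightarrow> complex) \<Rightarrow> real \<Rightarrow> complex" where
  "sphere_integral f r = (LINT w|sphere_measure. f (r *\<^sub>R w))"

lemma borel_measurable_sphere_integral:
  assumes "f \<in> borel_measurable borel" shows "sphere_integral f \<in> borel_measurable borel"
proof -
  interpret S: finite_measure "sphere_measure :: 'a measure" by (rule finite_sphere_measure)
  show ?thesis using S.borel_measurable_lebesgue_integral[OF measurable_scaleR_sphere(2)[OF assms]]
    unfolding sphere_integral_def[abs_def] by simp
qed

text \<open>Cauchy-Schwarz on each sphere, followed by polar coordinates for \<open>|f|\<^sup>2\<close>.\<close>

lemma set_integrable_sphere_integral_square:
  fixes f :: "'a::euclidean_space \<Rightarrow> complex"
  assumes f: "f \<in> borel_measurable borel" and f2: "integrable unit_ball_measure (\<lambda>x. (norm (f x))\<^sup>2)"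
  shows "set_integrable lborel {0<..<1} (\<lambda>r. r ^ (DIM('a) - 1) * (norm (sphere_integral f r))\<^sup>2)"
proof -
  interpret S: finite_measure "sphere_measure :: 'a measure" by (rule finite_sphere_measure)
  let ?m = "measure sphere_measure (space sphere_measure :: 'a set)"
  have f2b: "(\<lambda>x. (norm (f x))\<^sup>2) \<in> borel_measurable borel" using f by measurable
  note pol = polar_coordinates[OF f2b f2]
  show ?thesis unfolding set_integrable_def
  proof (rule Bochner_Integration.integrable_bound)
    show "integrable lborel (\<lambda>r. ?m *\<^sub>R (indicator {0<..<1} r *\<^sub>R (r ^ (DIM('a) - 1) *\<^sub>R (LINT w|sphere_measure. (norm (f (r *\<^sub>R w)))\<^sup>2))))"
      using pol(2) unfolding set_integrable_def by (rule integrable_scaleR_right)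
    show "(\<lambda>r. indicator {0<..<1} r *\<^sub>R (r ^ (DIM('a) - 1) * (norm (sphere_integral f r))\<^sup>2)) \<in> borel_measurable lborel"
      using borel_measurable_sphere_integral[OF f] by measurable
    show "AE r in lborel. norm (indicator {0<..<1} r *\<^sub>R (r ^ (DIM('a) - 1) * (norm (sphere_integral f r))\<^sup>2))
       \<le> norm (?m *\<^sub>R (indicator {0<..<1} r *\<^sub>R (r ^ (DIM('a) - 1) *\<^sub>R (LINT w|sphere_measure. (norm (f (r *\<^sub>R w)))\<^sup>2))))"
      using pol(1)
    proof eventually_elim
      fix r :: real
      assume i: "r \<in> {0<..<1} \<longrightarrow> integrable sphere_measure (\<lambda>w. (norm (f (r *\<^sub>R w)))\<^sup>2)"
      show "norm (indicator {0<..<1} r *\<^sub>R (r ^ (DIM('a) - 1) * (norm (sphere_integral f r))\<^sup>2))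
       \<le> norm (?m *\<^sub>R (indicator {0<..<1} r *\<^sub>R (r ^ (DIM('a) - 1) *\<^sub>R (LINT w|sphere_measure. (norm (f (r *\<^sub>R w)))\<^sup>2))))"
      proof (cases "r \<in> {0<..<1}")
        case True
        have fi: "integrable sphere_measure (\<lambda>w. f (r *\<^sub>R w))"
          using i True by (intro S.integrable_norm_if_square measurable_scaleR_sphere(3)[OF f]) auto
        have "norm (sphere_integral f r) \<le> (LINT w|sphere_measure. norm (f (r *\<^sub>R w)))"
          unfolding sphere_integral_def by (rule integral_norm_bound)
        then have "(norm (sphere_integral f r))\<^sup>2 \<le> (LINT w|sphere_measure. norm (f (r *\<^sub>R w)))\<^sup>2"
          by (intro power_mono) auto
        also have "\<dots> \<le> ?m * (LINT w|sphere_measure. (norm (f (r *\<^sub>R w)))\<^sup>2)"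
          using i True fi by (intro S.integral_power2_le) auto
        finally have "r ^ (DIM('a) - 1) * (norm (sphere_integral f r))\<^sup>2 \<le> r ^ (DIM('a) - 1) * (?m * (LINT w|sphere_measure. (norm (f (r *\<^sub>R w)))\<^sup>2))"
          using True by (intro mult_left_mono) auto
        then show ?thesis using True by (simp add: abs_mult mult_ac)
      qed auto
    qed
  qed
qed

text \<open>On \<open>{r..1}\<close> the factor \<open>s\<^sup>d\<^sup>-\<^sup>1\<close> of polar coordinates is at least \<open>r\<^sup>d\<^sup>-\<^sup>1\<close>, so convergence in the
  mean on the ball gives convergence of the tail integrals.\<close>

lemma sphere_integral_tail_diff:
  fixes f g :: "'a::euclidean_space \<Rightarrow> complex"
  assumes d: "3 \<le> DIM('a)" 
    and f: "f \<in> borel_measurable borel" "integrable unit_ball_measure (\<lambda>x. (norm (f x))\<^sup>2)"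
    and g: "g \<in> borel_measurable borel" "integrable unit_ball_measure (\<lambda>x. (norm (g x))\<^sup>2)"
    and r: "r \<in> {0<..<1}"
  shows "norm ((LINT s:{r..1}|lborel. sphere_integral f s) - (LINT s:{r..1}|lborel. sphere_integral g s))
     \<le> (1 / r ^ (DIM('a) - 1)) * (LINT x|unit_ball_measure. norm (f x - g x))"
proof -
  interpret B: finite_measure "unit_ball_measure :: 'a measure" by (rule finite_measure_unit_ball)
  let ?d = "DIM('a)"
  have fi: "integrable unit_ball_measure f" and gi: "integrable unit_ball_measure g"
    using f g by (auto intro!: B.integrable_norm_if_square borel_measurable_lebesgue_onI)
  have hb: "(\<lambda>x. norm (f x - g x)) \<in> borel_measurable borel" using f(1) g(1) by measurable
  have hi: "integrable unit_ball_measure (\<lambda>x. norm (f x - g x))" using fi gi by auto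
  note pf = polar_coordinates[OF f(1) fi] and pg = polar_coordinates[OF g(1) gi] and ph = polar_coordinates[OF hb hi]
  have tail: "set_integrable lborel {r..1} (sphere_integral h)" if "h \<in> borel_measurable borel" "integrable unit_ball_measure (\<lambda>x. (norm (h x))\<^sup>2)" for h :: "'a \<Rightarrow> complex"
  proof (rule weighted_square_integrable_tail(1)[OF d])
    show "set_borel_measurable borel {0<..<1} (sphere_integral h)"
      using borel_measurable_sphere_integral[OF that(1)] unfolding set_borel_measurable_def by measurable
    show "set_integrable lborel {0<..<1} (\<lambda>r. r ^ (?d - 1) * (norm (sphere_integral h r))\<^sup>2)"
      by (rule set_integrable_sphere_integral_square[OF that])
  qed (use r in auto)
  have "norm ((LINT s:{r..1}|lborel. sphere_integral f s) - (LINT s:{r..1}|lborel. sphere_integral g s))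
     = norm (LINT s|lborel. indicator {r..1} s *\<^sub>R (sphere_integral f s - sphere_integral g s))"
    using set_integral_diff(2)[OF tail[OF f] tail[OF g]] by (simp add: set_lebesgue_integral_def)
  also have "\<dots> \<le> (LINT s|lborel. (1 / r ^ (?d - 1)) *\<^sub>R (indicator {0<..<1} s *\<^sub>R (s ^ (?d - 1) *\<^sub>R (LINT w|sphere_measure. norm (f (s *\<^sub>R w) - g (s *\<^sub>R w))))))"
  proof (rule order.trans[OF integral_norm_bound integral_mono_AE[OF integrable_norm]])
    show "integrable lborel (\<lambda>s. indicator {r..1} s *\<^sub>R (sphere_integral f s - sphere_integral g s))"
      using set_integral_diff(1)[OF tail[OF f] tail[OF g]] by (simp add: set_integrable_def)
    show "integrable lborel (\<lambda>s. (1 / r ^ (?d - 1)) *\<^sub>R (indicator {0<..<1} s *\<^sub>R (s ^ (?d - 1) *\<^sub>R (LINT w|sphere_measure. norm (f (s *\<^sub>R w) - g (s *\<^sub>R w))))))"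
      using ph(2) unfolding set_integrable_def by (rule integrable_scaleR_right)
    show "AE s in lborel. norm (indicator {r..1} s *\<^sub>R (sphere_integral f s - sphere_integral g s))
       \<le> (1 / r ^ (?d - 1)) *\<^sub>R (indicator {0<..<1} s *\<^sub>R (s ^ (?d - 1) *\<^sub>R (LINT w|sphere_measure. norm (f (s *\<^sub>R w) - g (s *\<^sub>R w)))))"
      using pf(1) pg(1) AE_lborel_singleton[of "1::real"]
    proof eventually_elim
      fix s :: real
      let ?I = "LINT w|sphere_measure. norm (f (s *\<^sub>R w) - g (s *\<^sub>R w))"
      assume i: "s \<in> {0<..<1} \<longrightarrow> integrable sphere_measure (\<lambda>w. f (s *\<^sub>R w))" "s \<in> {0<..<1} \<longrightarrow> integrable sphere_measure (\<lambda>w. g (s *\<^sub>R w))" and s1: "s \<noteq> 1"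
      show "norm (indicator {r..1} s *\<^sub>R (sphere_integral f s - sphere_integral g s))
       \<le> (1 / r ^ (?d - 1)) *\<^sub>R (indicator {0<..<1} s *\<^sub>R (s ^ (?d - 1) *\<^sub>R ?I))"
      proof (cases "s \<in> {r..1}")
        case True
        then have s: "s \<in> {0<..<1}" using r s1 by auto
        have "norm (sphere_integral f s - sphere_integral g s) = norm (LINT w|sphere_measure. f (s *\<^sub>R w) - g (s *\<^sub>R w))"
          unfolding sphere_integral_def using i s by simp
        also have "\<dots> \<le> 1 * ?I" by (simp add: integral_norm_bound)
        also have "\<dots> \<le> (s ^ (?d - 1) / r ^ (?d - 1)) * ?I"
          using True r by (intro mult_right_mono) (auto intro!: power_mono)
        finally show ?thesis using True s by simp
      next
        case False
        then show ?thesis using r by (auto simp: indicator_def)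
      qed
    qed
  qed
  also have "\<dots> = (1 / r ^ (?d - 1)) * (LINT x|unit_ball_measure. norm (f x - g x))"
    unfolding ph(3) set_lebesgue_integral_def by simp
  finally show ?thesis .
qed

text \<open>Evaluating \<open>p\<close> at \<open>x / |x|\<close> makes the integral over every sphere pair \<open>z\<close> with the same function on the
  unit sphere.\<close>

definition angular_weight :: "('a::euclidean_space \<Rightarrow> complex) \<Rightarrow> ('a \<Rightarrow> complex) \<Rightarrow> 'a \<Rightarrow> complex" where
  "angular_weight p z x = z x * p (sgn x)"

text \<open>For the gradient \<open>Z\<close> of a function this is its derivative in the radial direction.\<close>

definition radial_part :: "('a::euclidean_space \<Rightarrow> 'a \<Rightarrow> complex) \<Rightarrow> 'a \<Rightarrow> complex" where
  "radial_part Z x = (\<Sum>b\<in>Basis. of_real (sgn x \<bullet> b) * Z b x)"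

lemma borel_measurable_angular_weight:
  assumes "p \<in> borel_measurable borel" "z \<in> borel_measurable borel"
  shows "angular_weight p z \<in> borel_measurable borel"
  unfolding angular_weight_def[abs_def] using assms by measurable

lemma borel_measurable_radial_part:
  assumes "\<And>b. b \<in> Basis \<Longrightarrow> Z b \<in> borel_measurable borel"
  shows "radial_part Z \<in> borel_measurable borel"
  unfolding radial_part_def[abs_def] using assms by measurable

lemma sphere_bound:
  fixes p :: "'a::euclidean_space \<Rightarrow> complex"
  assumes "continuous_on UNIV p"
  obtains P where "0 < P" "\<And>w. norm w \<le> 1 \<Longrightarrow> norm (p w) \<le> P"
proof -
  have "compact (p ` cball 0 1)" by (intro compact_continuous_image continuous_on_subset[OF assms]) auto
  then obtain B where "\<forall>y\<in>p ` cball 0 1. norm y \<le> B" using compact_imp_bounded bounded_iff by blast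
  then show ?thesis by (intro that[of "max 1 B"]) (auto simp: le_max_iff_disj)
qed

lemma norm_sgn_le: "norm (sgn x :: 'a::real_normed_vector) \<le> 1"
  by (simp add: norm_sgn)

lemma smooth_along_ray:
  fixes u :: "'a::euclidean_space \<Rightarrow> complex"
  assumes "smooth u"
  shows "((\<lambda>s. u (s *\<^sub>R w)) has_vector_derivative (\<Sum>b\<in>Basis. of_real (w \<bullet> b) * dir_deriv u b (s *\<^sub>R w))) (at s within S)"
proof -
  let ?D = "frechet_derivative u (at (s *\<^sub>R w))"
  have D: "(u has_derivative ?D) (at (s *\<^sub>R w))"
    by (rule differentiable_has_derivative[OF smooth_differentiable[OF assms]])
  then have lin: "linear ?D" by (rule has_derivative_linear)
  have "((\<lambda>s. s *\<^sub>R w) has_derivative (\<lambda>t. t *\<^sub>R w)) (at s within S)"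
    by (auto intro!: derivative_eq_intros)
  from has_derivative_compose[OF this D] have "((\<lambda>s. u (s *\<^sub>R w)) has_derivative (\<lambda>t. ?D (t *\<^sub>R w))) (at s within S)" .
  moreover have "?D w = (\<Sum>b\<in>Basis. of_real (w \<bullet> b) * dir_deriv u b (s *\<^sub>R w))"
  proof -
    have "?D w = ?D (\<Sum>b\<in>Basis. (w \<bullet> b) *\<^sub>R b)" by (simp add: euclidean_representation)
    also have "\<dots> = (\<Sum>b\<in>Basis. (w \<bullet> b) *\<^sub>R ?D b)" by (simp add: linear_sum[OF lin] linear_cmul[OF lin])
    finally show ?thesis by (simp add: dir_deriv_def scaleR_conv_of_real)
  qed
  ultimately show ?thesis by (simp add: has_vector_derivative_def linear_cmul[OF lin])
qed

lemma borel_measurable_smooth: "smooth u \<Longrightarrow> u \<in> borel_measurable borel"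
  by (rule borel_measurable_continuous_onI[OF smooth_continuous])

text \<open>The fundamental theorem of calculus along each ray, integrated over the sphere.\<close>

lemma sphere_integral_smooth:
  fixes u p :: "'a::euclidean_space \<Rightarrow> complex"
  assumes u: "smooth u" and p: "continuous_on UNIV p" and r: "0 < r" "r \<le> 1"
  shows "sphere_integral (angular_weight p u) r = (LINT w|sphere_measure. u w * p w)
     - (LINT s:{r..1}|lborel. sphere_integral (angular_weight p (radial_part (dir_deriv u))) s)"
proof -
  interpret S: finite_measure "sphere_measure :: 'a measure" by (rule finite_sphere_measure)
  interpret LS: pair_sigma_finite lborel "sphere_measure :: 'a measure" ..
  let ?g = "angular_weight p (radial_part (dir_deriv u))"
  have pb[measurable]: "p \<in> borel_measurable borel" by (rule borel_measurable_continuous_onI[OF p])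
  have ub[measurable]: "u \<in> borel_measurable borel" by (rule borel_measurable_smooth[OF u])
  have gb[measurable]: "?g \<in> borel_measurable borel"
    by (intro borel_measurable_angular_weight borel_measurable_radial_part pb borel_measurable_smooth smooth_dir_deriv u)
  have sph: "w \<in> space sphere_measure \<longleftrightarrow> norm w = 1" for w :: 'a by (simp add: space_sphere_measure)
  have gw: "?g (s *\<^sub>R w) = (\<Sum>b\<in>Basis. of_real (w \<bullet> b) * dir_deriv u b (s *\<^sub>R w)) * p w" if "norm w = 1" "s > 0" for s w
    using that by (simp add: angular_weight_def radial_part_def sgn_scaleR sgn_div_norm)
  define k where "k = (\<lambda>s w. indicator {r..1} s *\<^sub>R ?g (s *\<^sub>R w))"
  have "continuous_on UNIV (\<lambda>x. \<Sum>b\<in>Basis. of_real (norm (dir_deriv u b x)) :: complex)"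
    by (intro continuous_intros continuous_on_of_real smooth_continuous smooth_dir_deriv u)
  from sphere_bound[OF this] obtain B where B: "0 < B" "\<And>w. norm w \<le> 1 \<Longrightarrow> norm (\<Sum>b\<in>Basis. complex_of_real (norm (dir_deriv u b w))) \<le> B"
    by metis
  obtain P where P: "0 < P" "\<And>w. norm w \<le> 1 \<Longrightarrow> norm (p w) \<le> P" using sphere_bound[OF p] by metis
  have gbound: "norm (?g x) \<le> B * P" if "norm x \<le> 1" for x
  proof -
    have "norm (radial_part (dir_deriv u) x) \<le> (\<Sum>b\<in>Basis. norm (of_real (sgn x \<bullet> b) * dir_deriv u b x))"
      unfolding radial_part_def by (rule norm_sum)
    also have "\<dots> \<le> (\<Sum>b\<in>Basis. norm (dir_deriv u b x))"
    proof (intro sum_mono)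
      fix b :: 'a assume b: "b \<in> Basis"
      have "\<bar>sgn x \<bullet> b\<bar> \<le> norm (sgn x)" by (rule Basis_le_norm[OF b])
      also have "\<dots> \<le> 1" by (rule norm_sgn_le)
      finally show "norm (of_real (sgn x \<bullet> b) * dir_deriv u b x) \<le> norm (dir_deriv u b x)"
        by (simp add: norm_mult mult_left_le_one_le)
    qed
    also have "\<dots> \<le> B" using B(2)[OF that] by (simp flip: of_real_sum)
    finally have "norm (radial_part (dir_deriv u) x) \<le> B" .
    then show ?thesis unfolding angular_weight_def norm_mult
      using P(2)[OF norm_sgn_le, of x] B P by (intro mult_mono) auto
  qed
  have ki: "integrable (lborel \<Otimes>\<^sub>M sphere_measure) (\<lambda>(s, w). k s w)"
  proof -
    have "integrable (lborel \<Otimes>\<^sub>M sphere_measure) (\<lambda>x. indicator ({r..1} \<times> space sphere_measure) x *\<^sub>R (\<lambda>(s, w). ?g (s *\<^sub>R w)) x)"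
    proof (rule integrableI_bounded_set_indicator)
      show "{r..1} \<times> space sphere_measure \<in> sets (lborel \<Otimes>\<^sub>M (sphere_measure :: 'a measure))" by auto
      show "(\<lambda>(s, w). ?g (s *\<^sub>R w)) \<in> borel_measurable (lborel \<Otimes>\<^sub>M sphere_measure)"
        by (rule measurable_scaleR_sphere(2)[OF gb])
      show "emeasure (lborel \<Otimes>\<^sub>M (sphere_measure :: 'a measure)) ({r..1} \<times> space sphere_measure) < \<infinity>"
        using r by (subst S.emeasure_pair_measure_Times) (auto simp: ennreal_mult_eq_top_iff less_top[symmetric])
      show "AE x in lborel \<Otimes>\<^sub>M sphere_measure. x \<in> {r..1} \<times> space sphere_measure \<longrightarrow> norm ((\<lambda>(s, w). ?g (s *\<^sub>R w)) x) \<le> B * P"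
        using r by (intro AE_I2) (auto simp: sph intro!: gbound)
    qed
    then show ?thesis
      by (rule Bochner_Integration.integrable_cong[THEN iffD1, rotated -1, OF _ refl])
         (auto simp: k_def indicator_def space_pair_measure)
  qed
  have ray: "(LINT s|lborel. k s w) = u w * p w - angular_weight p u (r *\<^sub>R w)" if w: "norm w = 1" for w
  proof -
    have "(LINT s|lborel. indicator {r..1} s *\<^sub>R (\<Sum>b\<in>Basis. of_real (w \<bullet> b) * dir_deriv u b (s *\<^sub>R w))) = u (1 *\<^sub>R w) - u (r *\<^sub>R w)"
      by (intro integral_FTC_atLeastAtMost r smooth_along_ray[OF u])
        (intro continuous_intros continuous_on_compose2[OF smooth_continuous[OF smooth_dir_deriv[OF u], of _ UNIV]]; auto)
    then have "(LINT s|lborel. (indicator {r..1} s *\<^sub>R (\<Sum>b\<in>Basis. of_real (w \<bullet> b) * dir_deriv u b (s *\<^sub>R w))) * p w) = (u w - u (r *\<^sub>R w)) * p w"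
      by (simp only: integral_mult_left_zero scaleR_one)
    moreover have "(\<lambda>s. (indicator {r..1} s *\<^sub>R (\<Sum>b\<in>Basis. of_real (w \<bullet> b) * dir_deriv u b (s *\<^sub>R w))) * p w) = (\<lambda>s. k s w)"
      using gw[OF w] r by (auto simp: k_def indicator_def fun_eq_iff)
    moreover have "angular_weight p u (r *\<^sub>R w) = u (r *\<^sub>R w) * p w"
      using w r by (simp add: angular_weight_def sgn_scaleR sgn_div_norm)
    ultimately show ?thesis by (simp add: left_diff_distrib)
  qed
  obtain U where U: "0 < U" "\<And>w. norm w \<le> 1 \<Longrightarrow> norm (u w) \<le> U" using sphere_bound[OF smooth_continuous[OF u]] by metis
  have upi: "integrable sphere_measure (\<lambda>w. u (t *\<^sub>R w) * p w)" if t: "0 \<le> t" "t \<le> 1" for t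
  proof (rule S.integrable_const_bound[where B="U * P"])
    show "AE w in sphere_measure. norm (u (t *\<^sub>R w) * p w) \<le> U * P"
      using t by (intro AE_I2) (auto simp: sph norm_mult intro!: mult_mono U P less_imp_le[OF U(1)])
    have "(\<lambda>w. u (t *\<^sub>R w) * p (1 *\<^sub>R w)) \<in> borel_measurable sphere_measure"
      by (rule borel_measurable_times[OF measurable_scaleR_sphere(3)[OF ub, where r=t] measurable_scaleR_sphere(3)[OF pb, where r=1]])
    then show "(\<lambda>w. u (t *\<^sub>R w) * p w) \<in> borel_measurable sphere_measure" by (simp only: scaleR_one)
  qed
  have aw: "angular_weight p u (r *\<^sub>R w) = u (r *\<^sub>R w) * p w" if "norm w = 1" for w
    using that r by (simp add: angular_weight_def sgn_scaleR sgn_div_norm)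
  have "(LINT s:{r..1}|lborel. sphere_integral ?g s) = (LINT s|lborel. LINT w|sphere_measure. k s w)"
    unfolding set_lebesgue_integral_def sphere_integral_def k_def by simp
  also have "\<dots> = (LINT w|sphere_measure. LINT s|lborel. k s w)"
    by (rule LS.Fubini_integral[symmetric]) (use ki in auto)
  also have "\<dots> = (LINT w|sphere_measure. u w * p w - u (r *\<^sub>R w) * p w)"
    by (intro Bochner_Integration.integral_cong refl) (auto simp: sph ray aw)
  also have "\<dots> = (LINT w|sphere_measure. u w * p w) - (LINT w|sphere_measure. u (r *\<^sub>R w) * p w)"
    using upi[of 1] upi[of r] r by (intro Bochner_Integration.integral_diff) auto
  also have "(LINT w|sphere_measure. u (r *\<^sub>R w) * p w) = sphere_integral (angular_weight p u) r"
    unfolding sphere_integral_def by (intro Bochner_Integration.integral_cong refl) (auto simp: sph aw)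
  finally show ?thesis by simp
qed

section \<open>Traces of Sobolev functions\<close>

lemma integrable_smooth_square:
  assumes "smooth u"
  shows "integrable (unit_ball_measure :: 'a::euclidean_space measure) (\<lambda>x. (norm (u x))\<^sup>2)"
proof -
  interpret B: finite_measure "unit_ball_measure :: 'a measure" by (rule finite_measure_unit_ball)
  obtain U where U: "0 < U" "\<And>w. norm w \<le> 1 \<Longrightarrow> norm (u w) \<le> U" using sphere_bound[OF smooth_continuous[OF assms]] by metis
  show ?thesis
  proof (rule B.integrable_const_bound[where B="U\<^sup>2"])
    show "AE x in unit_ball_measure. norm ((norm (u x))\<^sup>2) \<le> U\<^sup>2"
      by (intro AE_I2) (auto intro!: power_mono U)
    show "(\<lambda>x. (norm (u x))\<^sup>2) \<in> borel_measurable unit_ball_measure"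
      using borel_measurable_smooth[OF assms] by (intro borel_measurable_lebesgue_onI) measurable
  qed
qed

lemma smooth_in_L2_sphere:
  assumes u: "smooth u" shows "u \<in> L2 (sphere_measure :: 'a::euclidean_space measure)"
proof -
  interpret S: finite_measure "sphere_measure :: 'a measure" by (rule finite_sphere_measure)
  obtain U where U: "0 < U" "\<And>x. norm x \<le> 1 \<Longrightarrow> norm (u x) \<le> U" using sphere_bound[OF smooth_continuous[OF u]] by metis
  have m: "u \<in> borel_measurable sphere_measure"
    using measurable_scaleR_sphere(3)[OF borel_measurable_smooth[OF u], where r=1] by (simp only: scaleR_one)
  have "integrable sphere_measure (\<lambda>x. (norm (u x))\<^sup>2)"
  proof (rule S.integrable_const_bound[where B="U\<^sup>2"])
    show "AE x in sphere_measure. norm ((norm (u x))\<^sup>2) \<le> U\<^sup>2"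
      by (intro AE_I2) (auto simp: space_sphere_measure intro!: power_mono U)
    show "(\<lambda>x. (norm (u x))\<^sup>2) \<in> borel_measurable sphere_measure" using m by measurable
  qed
  with m show ?thesis by (simp add: L2_def)
qed

lemma radial_part_square:
  assumes Zb: "\<And>b. b \<in> Basis \<Longrightarrow> Z b \<in> borel_measurable borel"
    and Z2: "\<And>b. b \<in> Basis \<Longrightarrow> integrable (unit_ball_measure :: 'a::euclidean_space measure) (\<lambda>x. (norm (Z b x))\<^sup>2)"
  shows "integrable (unit_ball_measure :: 'a measure) (\<lambda>x. (norm (radial_part Z x))\<^sup>2)"
proof (rule Bochner_Integration.integrable_bound)
  show "integrable unit_ball_measure (\<lambda>x. (\<Sum>b\<in>Basis. (norm (Z b x))\<^sup>2) * card (Basis :: 'a set))"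
    using Z2 by (intro integrable_mult_left Bochner_Integration.integrable_sum) auto
  show "(\<lambda>x. (norm (radial_part Z x))\<^sup>2) \<in> borel_measurable unit_ball_measure"
    using borel_measurable_radial_part[OF Zb] by (intro borel_measurable_lebesgue_onI) measurable
  have "(norm (radial_part Z x))\<^sup>2 \<le> (\<Sum>b\<in>Basis. (norm (Z b x))\<^sup>2) * card (Basis :: 'a set)" for x
  proof -
    have "norm (radial_part Z x) \<le> (\<Sum>b\<in>Basis. norm (of_real (sgn x \<bullet> b) * Z b x))"
      unfolding radial_part_def by (rule norm_sum)
    also have "\<dots> \<le> (\<Sum>b\<in>Basis. norm (Z b x))"
    proof (intro sum_mono)
      fix b :: 'a assume b: "b \<in> Basis"
      have "\<bar>sgn x \<bullet> b\<bar> \<le> 1" using Basis_le_norm[OF b, of "sgn x"] norm_sgn_le[of x] by linarith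
      then show "norm (of_real (sgn x \<bullet> b) * Z b x) \<le> norm (Z b x)"
        by (simp add: norm_mult mult_left_le_one_le)
    qed
    finally have "(norm (radial_part Z x))\<^sup>2 \<le> (\<Sum>b\<in>Basis. norm (Z b x))\<^sup>2" by (intro power_mono) auto
    also have "\<dots> \<le> (\<Sum>b\<in>Basis. (norm (Z b x))\<^sup>2) * card (Basis :: 'a set)"
      by (rule sum_squared_le_sum_of_squares)
    finally show ?thesis .
  qed
  then show "AE x in unit_ball_measure. norm ((norm (radial_part Z x))\<^sup>2) \<le> norm ((\<Sum>b\<in>Basis. (norm (Z b x))\<^sup>2) * card (Basis :: 'a set))"
    by (intro AE_I2) (simp add: order.trans[OF _ abs_ge_self])
qed

lemma angular_weight_square:
  assumes p: "continuous_on UNIV p" and z: "z \<in> borel_measurable borel" "integrable (unit_ball_measure :: 'a::euclidean_space measure) (\<lambda>x. (norm (z x))\<^sup>2)"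
  shows "integrable (unit_ball_measure :: 'a measure) (\<lambda>x. (norm (angular_weight p z x))\<^sup>2)"
proof -
  obtain P where P: "0 < P" "\<And>w. norm w \<le> 1 \<Longrightarrow> norm (p w) \<le> P" using sphere_bound[OF p] by metis
  have pb: "p \<in> borel_measurable borel" by (rule borel_measurable_continuous_onI[OF p])
  show ?thesis
  proof (rule Bochner_Integration.integrable_bound)
    show "integrable unit_ball_measure (\<lambda>x. P\<^sup>2 * (norm (z x))\<^sup>2)" using z(2) by simp
    show "(\<lambda>x. (norm (angular_weight p z x))\<^sup>2) \<in> borel_measurable unit_ball_measure"
      using borel_measurable_angular_weight[OF pb z(1)] by (intro borel_measurable_lebesgue_onI) measurable
    have "(norm (angular_weight p z x))\<^sup>2 \<le> P\<^sup>2 * (norm (z x))\<^sup>2" for x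
    proof -
      have "norm (angular_weight p z x) \<le> P * norm (z x)"
        using mult_right_mono[OF P(2)[OF norm_sgn_le] norm_ge_zero[of "z x"], of x] by (simp add: angular_weight_def norm_mult mult.commute)
      then show ?thesis by (metis norm_ge_zero power_mono power_mult_distrib)
    qed
    then show "AE x in unit_ball_measure. norm ((norm (angular_weight p z x))\<^sup>2) \<le> norm (P\<^sup>2 * (norm (z x))\<^sup>2)"
      by (intro AE_I2) simp
  qed
qed

lemma angular_weight_L1_tendsto:
  fixes v :: "nat \<Rightarrow> 'a::euclidean_space \<Rightarrow> complex"
  assumes p: "continuous_on UNIV p"
    and v: "\<And>k. integrable unit_ball_measure (v k)" and z: "integrable unit_ball_measure z"
    and vb: "\<And>k. v k \<in> borel_measurable borel" and zb: "z \<in> borel_measurable borel"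
    and lim: "(\<lambda>k. LINT x|unit_ball_measure. norm (v k x - z x)) \<longlonglongrightarrow> 0"
  shows "(\<lambda>k. LINT x|unit_ball_measure. norm (angular_weight p (v k) x - angular_weight p z x)) \<longlonglongrightarrow> 0"
proof -
  obtain P where P: "0 < P" "\<And>w. norm w \<le> 1 \<Longrightarrow> norm (p w) \<le> P" using sphere_bound[OF p] by metis
  have pb[measurable]: "p \<in> borel_measurable borel" by (rule borel_measurable_continuous_onI[OF p])
  have le: "norm (angular_weight p (v k) x - angular_weight p z x) \<le> P * norm (v k x - z x)" for k x
  proof -
    have "angular_weight p (v k) x - angular_weight p z x = (v k x - z x) * p (sgn x)"
      by (simp add: angular_weight_def left_diff_distrib)
    then show ?thesis using P(2)[OF norm_sgn_le, of x] by (simp add: norm_mult mult.commute mult_right_mono)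
  qed
  have up: "(LINT x|unit_ball_measure. norm (angular_weight p (v k) x - angular_weight p z x)) \<le> (LINT x|unit_ball_measure. P * norm (v k x - z x))" for k
  proof (rule integral_mono)
    show i: "integrable unit_ball_measure (\<lambda>x. P * norm (v k x - z x))" using v z by auto
    show "integrable unit_ball_measure (\<lambda>x. norm (angular_weight p (v k) x - angular_weight p z x))"
    proof (rule Bochner_Integration.integrable_bound[OF i])
      show "(\<lambda>x. norm (angular_weight p (v k) x - angular_weight p z x)) \<in> borel_measurable unit_ball_measure"
        using borel_measurable_angular_weight[OF pb vb[of k]] borel_measurable_angular_weight[OF pb zb]
        by (intro borel_measurable_lebesgue_onI) measurable
    qed (use le P in \<open>auto intro!: AE_I2\<close>)
  qed (use le in auto)
  show ?thesis
  proof (rule real_tendsto_sandwich[where f="\<lambda>_. 0" and h="\<lambda>k. LINT x|unit_ball_measure. P * norm (v k x - z x)"])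
    show "(\<lambda>k. LINT x|unit_ball_measure. P * norm (v k x - z x)) \<longlonglongrightarrow> 0"
      using tendsto_mult_right_zero[OF lim, of P] by simp
    show "eventually (\<lambda>k. (LINT x|unit_ball_measure. norm (angular_weight p (v k) x - angular_weight p z x)) \<le> (LINT x|unit_ball_measure. P * norm (v k x - z x))) sequentially"
      by (intro always_eventually allI up)
    show "eventually (\<lambda>k. 0 \<le> (LINT x|unit_ball_measure. norm (angular_weight p (v k) x - angular_weight p z x))) sequentially"
      by simp
  qed simp
qed

text \<open>For the smooth functions \<open>w\<^sub>k\<close> in the definition of the trace the identity is
  \<open>sphere_integral_smooth\<close>, and each term passes to the limit: the boundary term by convergence on the
  sphere, the tail integral by convergence of the gradients, and the left-hand side almost everywhere
  along a subsequence, because polar coordinates turn mean convergence on the ball into mean convergence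
  on the unit interval.\<close>

theorem trace_radial_moments:
  fixes u f p :: "'a::euclidean_space \<Rightarrow> complex"
  assumes d: "3 \<le> DIM('a)" and tr: "has_trace u f"
    and z: "z \<in> borel_measurable borel" "AE x in unit_ball_measure. u x = z x"
    and p: "continuous_on UNIV p"
  obtains A where "A \<in> borel_measurable borel"
    "set_integrable lborel {0<..<1} (\<lambda>r. r ^ (DIM('a) - 1) * (norm (A r))\<^sup>2)"
    "AE r in lborel. r \<in> {0<..<1} \<longrightarrow>
       sphere_integral (angular_weight p z) r = (LINT w|sphere_measure. f w * p w) - (LINT s:{r..1}|lborel. A s)"
proof -
  let ?B = "unit_ball_measure :: 'a measure" and ?S = "sphere_measure :: 'a measure"
  interpret B: finite_measure ?B by (rule finite_measure_unit_ball)
  interpret S: finite_measure ?S by (rule finite_sphere_measure)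
  obtain G w where G: "has_weak_gradient u G" and w: "\<And>k::nat. smooth (w k)"
    and lu: "(\<lambda>k. LINT x|?B. (norm (w k x - u x))\<^sup>2) \<longlonglongrightarrow> 0"
    and lG: "\<And>b. b \<in> Basis \<Longrightarrow> (\<lambda>k. LINT x|?B. (norm (dir_deriv (w k) b x - G b x))\<^sup>2) \<longlonglongrightarrow> 0"
    and lf: "(\<lambda>k. LINT x|?S. (norm (w k x - f x))\<^sup>2) \<longlonglongrightarrow> 0" and fL: "f \<in> L2 ?S"
    using tr unfolding has_trace_def by blast
  have uL: "u \<in> L2 ?B" and GL: "\<And>b. b \<in> Basis \<Longrightarrow> G b \<in> L2 ?B"
    using G SOME_Basis unfolding has_weak_gradient_def has_weak_partial_def by blast+
  have "\<exists>Zb. b \<in> Basis \<longrightarrow> Zb \<in> borel_measurable borel \<and> (AE x in ?B. G b x = Zb x)" for b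
  proof (cases "b \<in> Basis")
    case True
    then have "G b \<in> borel_measurable ?B" using GL by (simp add: L2_def)
    from ex_borel_representative[OF this] show ?thesis by auto
  qed auto
  then obtain Z where Z: "\<And>b. b \<in> Basis \<Longrightarrow> Z b \<in> borel_measurable borel" "\<And>b. b \<in> Basis \<Longrightarrow> AE x in ?B. G b x = Z b x"
    by metis
  note onI = borel_measurable_lebesgue_onI
  note wb = borel_measurable_smooth[OF w]
  note dwb = borel_measurable_smooth[OF smooth_dir_deriv[OF w]]
  have L2rep: "integrable ?B (\<lambda>x. (norm (h x))\<^sup>2)" if "g \<in> L2 ?B" "h \<in> borel_measurable borel" "AE x in ?B. g x = h x" for g h :: "'a \<Rightarrow> complex"
  proof (rule integrable_cong_AE_imp)
    show "integrable ?B (\<lambda>x. (norm (g x))\<^sup>2)" using that by (simp add: L2_def)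
    show "(\<lambda>x. (norm (h x))\<^sup>2) \<in> borel_measurable ?B" using that(2) by (intro onI) measurable
    show "AE x in ?B. (norm (g x))\<^sup>2 = (norm (h x))\<^sup>2" using that(3) by eventually_elim simp
  qed
  have rep: "(\<lambda>k. LINT x|?B. norm (v k x - h x)) \<longlonglongrightarrow> 0"
    if g: "g \<in> L2 ?B" "h \<in> borel_measurable borel" "AE x in ?B. g x = h x" and v: "\<And>k. smooth (v k)"
      and l: "(\<lambda>k. LINT x|?B. (norm (v k x - g x))\<^sup>2) \<longlonglongrightarrow> 0" for g h :: "'a \<Rightarrow> complex" and v :: "nat \<Rightarrow> 'a \<Rightarrow> complex"
  proof (rule B.L1_tendsto_if_L2_tendsto)
    have vm: "v k \<in> borel_measurable ?B" for k by (rule onI[OF borel_measurable_smooth[OF v]])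
    have hm: "h \<in> borel_measurable ?B" "g \<in> borel_measurable ?B"
      using g by (auto intro: onI simp: L2_def)
    show "(\<lambda>x. v k x - h x) \<in> borel_measurable ?B" for k using vm[of k] hm by measurable
    show "integrable ?B (\<lambda>x. (norm (v k x - h x))\<^sup>2)" for k
      by (intro integrable_diff_square vm hm integrable_smooth_square v L2rep[OF g])
    have "(LINT x|?B. (norm (v k x - h x))\<^sup>2) = (LINT x|?B. (norm (v k x - g x))\<^sup>2)" for k
    proof (rule integral_cong_AE)
      show "(\<lambda>x. (norm (v k x - h x))\<^sup>2) \<in> borel_measurable ?B" "(\<lambda>x. (norm (v k x - g x))\<^sup>2) \<in> borel_measurable ?B"
        using vm[of k] hm by measurable
      show "AE x in ?B. (norm (v k x - h x))\<^sup>2 = (norm (v k x - g x))\<^sup>2" using g(3) by eventually_elim simp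
    qed
    with l show "(\<lambda>k. LINT x|?B. (norm (v k x - h x))\<^sup>2) \<longlonglongrightarrow> 0" by simp
  qed
  have z2: "integrable ?B (\<lambda>x. (norm (z x))\<^sup>2)" by (rule L2rep[OF uL z])
  have Z2: "integrable ?B (\<lambda>x. (norm (Z b x))\<^sup>2)" if "b \<in> Basis" for b by (rule L2rep[OF GL[OF that] Z[OF that]])
  have zi: "integrable ?B z" by (intro B.integrable_norm_if_square onI z z2)
  have Zi: "integrable ?B (Z b)" if "b \<in> Basis" for b by (intro B.integrable_norm_if_square onI Z Z2 that)
  have wi: "integrable ?B (v)" if "smooth v" for v by (intro B.integrable_norm_if_square onI borel_measurable_smooth integrable_smooth_square that)
  let ?R = "radial_part Z" and ?Rw = "\<lambda>k. radial_part (dir_deriv (w k))"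
  have Rb: "?R \<in> borel_measurable borel" by (rule borel_measurable_radial_part[OF Z(1)])
  have Rwb: "?Rw k \<in> borel_measurable borel" for k by (intro borel_measurable_radial_part dwb)
  have R2: "integrable ?B (\<lambda>x. (norm (?R x))\<^sup>2)" by (rule radial_part_square[OF Z(1) Z2])
  have Rw2: "integrable ?B (\<lambda>x. (norm (?Rw k x))\<^sup>2)" for k
    by (rule radial_part_square) (auto intro: dwb integrable_smooth_square smooth_dir_deriv w)
  have Ri: "integrable ?B ?R" "integrable ?B (?Rw k)" for k
    by (intro B.integrable_norm_if_square onI Rb Rwb R2 Rw2)+
  have lz: "(\<lambda>k. LINT x|?B. norm (w k x - z x)) \<longlonglongrightarrow> 0" by (rule rep[OF uL z w lu])
  have lR: "(\<lambda>k. LINT x|?B. norm (?Rw k x - ?R x)) \<longlonglongrightarrow> 0"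
  proof (rule real_tendsto_sandwich[where f="\<lambda>_. 0" and h="\<lambda>k. \<Sum>b\<in>Basis. LINT x|?B. norm (dir_deriv (w k) b x - Z b x)"])
    show "(\<lambda>k. \<Sum>b\<in>Basis. LINT x|?B. norm (dir_deriv (w k) b x - Z b x)) \<longlonglongrightarrow> 0"
      by (intro tendsto_null_sum rep[OF GL Z smooth_dir_deriv[OF w] lG]) auto
    have le: "norm (?Rw k x - ?R x) \<le> (\<Sum>b\<in>Basis. norm (dir_deriv (w k) b x - Z b x))" for k x
    proof -
      have "?Rw k x - ?R x = (\<Sum>b\<in>Basis. of_real (sgn x \<bullet> b) * (dir_deriv (w k) b x - Z b x))"
        by (simp add: radial_part_def sum_subtractf right_diff_distrib)
      also have "norm \<dots> \<le> (\<Sum>b\<in>Basis. norm (of_real (sgn x \<bullet> b) * (dir_deriv (w k) b x - Z b x)))" by (rule norm_sum)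
      also have "\<dots> \<le> (\<Sum>b\<in>Basis. norm (dir_deriv (w k) b x - Z b x))"
      proof (intro sum_mono)
        fix b :: 'a assume b: "b \<in> Basis"
        have "\<bar>sgn x \<bullet> b\<bar> \<le> 1" using Basis_le_norm[OF b, of "sgn x"] norm_sgn_le[of x] by linarith
        then show "norm (of_real (sgn x \<bullet> b) * (dir_deriv (w k) b x - Z b x)) \<le> norm (dir_deriv (w k) b x - Z b x)"
          by (simp add: norm_mult mult_left_le_one_le)
      qed
      finally show ?thesis .
    qed
    have "(LINT x|?B. norm (?Rw k x - ?R x)) \<le> (LINT x|?B. (\<Sum>b\<in>Basis. norm (dir_deriv (w k) b x - Z b x)))" for k
      by (intro integral_mono integrable_norm Bochner_Integration.integrable_diff Bochner_Integration.integrable_sum Ri Zi wi smooth_dir_deriv w le)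
    also have "(LINT x|?B. (\<Sum>b\<in>Basis. norm (dir_deriv (w k) b x - Z b x))) = (\<Sum>b\<in>Basis. LINT x|?B. norm (dir_deriv (w k) b x - Z b x))" for k
      by (intro Bochner_Integration.integral_sum integrable_norm Bochner_Integration.integrable_diff Zi wi smooth_dir_deriv w)
    finally show "eventually (\<lambda>k. (LINT x|?B. norm (?Rw k x - ?R x)) \<le> (\<Sum>b\<in>Basis. LINT x|?B. norm (dir_deriv (w k) b x - Z b x))) sequentially"
      by simp
  qed auto
  have pb: "p \<in> borel_measurable borel" by (rule borel_measurable_continuous_onI[OF p])
  define F where "F = angular_weight p z"
  define Fw where "Fw k = angular_weight p (w k)" for k
  define H where "H = angular_weight p ?R"
  define Hw where "Hw k = angular_weight p (?Rw k)" for k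
  have Fb: "F \<in> borel_measurable borel" "Fw k \<in> borel_measurable borel" "H \<in> borel_measurable borel" "Hw k \<in> borel_measurable borel" for k
    unfolding F_def Fw_def H_def Hw_def by (intro borel_measurable_angular_weight pb z wb Rb Rwb)+
  have F2: "integrable ?B (\<lambda>x. (norm (F x))\<^sup>2)" "integrable ?B (\<lambda>x. (norm (Fw k x))\<^sup>2)"
     "integrable ?B (\<lambda>x. (norm (H x))\<^sup>2)" "integrable ?B (\<lambda>x. (norm (Hw k x))\<^sup>2)" for k
    unfolding F_def Fw_def H_def Hw_def by (intro angular_weight_square p z wb Rb Rwb z2 R2 Rw2 integrable_smooth_square w)+
  have Fi: "integrable ?B F" "integrable ?B (Fw k)" for k
    by (intro B.integrable_norm_if_square onI Fb F2)+
  have lF: "(\<lambda>k. LINT x|?B. norm (Fw k x - F x)) \<longlonglongrightarrow> 0"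
    unfolding F_def Fw_def by (intro angular_weight_L1_tendsto p wi w zi wb z lz)
  have lH: "(\<lambda>k. LINT x|?B. norm (Hw k x - H x)) \<longlonglongrightarrow> 0"
    unfolding H_def Hw_def by (intro angular_weight_L1_tendsto p Ri Rb Rwb lR)
  let ?A = "sphere_integral H" and ?Aw = "\<lambda>k. sphere_integral (Hw k)"
  let ?c = "LINT w|?S. f w * p w" and ?cw = "\<lambda>k. LINT x|?S. w k x * p x"
  have fm: "f \<in> borel_measurable ?S" and f2: "integrable ?S (\<lambda>x. (norm (f x))\<^sup>2)" using fL by (auto simp: L2_def)
  have sph: "x \<in> space ?S \<longleftrightarrow> norm x = 1" for x :: 'a by (simp add: space_sphere_measure)
  have bS: "h \<in> borel_measurable ?S" if "h \<in> borel_measurable borel" for h :: "'a \<Rightarrow> complex"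
    using measurable_scaleR_sphere(3)[OF that, where r=1] by simp
  obtain P where P: "0 < P" "\<And>w. norm w \<le> 1 \<Longrightarrow> norm (p w) \<le> P" using sphere_bound[OF p] by metis
  have cwc: "?cw \<longlonglongrightarrow> ?c"
  proof -
    have ws2: "integrable ?S (\<lambda>x. (norm (w k x))\<^sup>2)" for k
      using smooth_in_L2_sphere[OF w[of k]] by (simp add: L2_def)
    have wm: "w k \<in> borel_measurable ?S" for k by (rule bS[OF wb])
    have wfm: "(\<lambda>x. w k x - f x) \<in> borel_measurable ?S" for k using wm[of k] fm by measurable
    have wf2: "integrable ?S (\<lambda>x. (norm (w k x - f x))\<^sup>2)" for k by (rule integrable_diff_square[OF wm fm ws2 f2])
    have wf1: "integrable ?S (\<lambda>x. w k x - f x)" for k by (rule S.integrable_norm_if_square[OF wfm wf2])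
    have l1: "(\<lambda>k. LINT x|?S. norm (w k x - f x)) \<longlonglongrightarrow> 0"
      by (rule S.L1_tendsto_if_L2_tendsto[OF wfm wf2 lf])
    have mulp: "integrable ?S (\<lambda>x. h x * p x)" if "integrable ?S h" for h
    proof (rule Bochner_Integration.integrable_bound)
      show "integrable ?S (\<lambda>x. P *\<^sub>R h x)" using that by (rule integrable_scaleR_right)
      show "(\<lambda>x. h x * p x) \<in> borel_measurable ?S" using borel_measurable_integrable[OF that] bS[OF pb] by measurable
      show "AE x in ?S. norm (h x * p x) \<le> norm (P *\<^sub>R h x)"
        using P by (intro AE_I2) (auto simp: sph norm_mult mult.commute[of P] intro!: mult_left_mono)
    qed
    have wi1: "integrable ?S (w k)" for k by (rule S.integrable_norm_if_square[OF wm ws2])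
    have fi1: "integrable ?S f" by (rule S.integrable_norm_if_square[OF fm f2])
    have "(\<lambda>k. ?cw k - ?c) \<longlonglongrightarrow> 0"
    proof (rule Lim_null_comparison)
      show "(\<lambda>k. P * (LINT x|?S. norm (w k x - f x))) \<longlonglongrightarrow> 0" using tendsto_mult_right_zero[OF l1] .
      show "eventually (\<lambda>k. norm (?cw k - ?c) \<le> P * (LINT x|?S. norm (w k x - f x))) sequentially"
      proof (intro always_eventually allI)
        fix k
        have "?cw k - ?c = (LINT x|?S. (w k x - f x) * p x)"
          using mulp[OF wi1[of k]] mulp[OF fi1] by (simp add: left_diff_distrib)
        also have "norm \<dots> \<le> (LINT x|?S. norm ((w k x - f x) * p x))" by (rule integral_norm_bound)
        also have "\<dots> \<le> (LINT x|?S. P * norm (w k x - f x))"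
          using mulp[OF wf1[of k]] wf1[of k] P
          by (intro integral_mono integrable_norm) (auto simp: sph norm_mult mult.commute[of P] intro!: mult_left_mono)
        finally show "norm (?cw k - ?c) \<le> P * (LINT x|?S. norm (w k x - f x))" by simp
      qed
    qed
    then show ?thesis by (simp add: LIM_zero_iff)
  qed
  have smooth_eq: "sphere_integral (Fw k) r = ?cw k - (LINT s:{r..1}|lborel. ?Aw k s)" if "r \<in> {0<..<1}" for r k
    unfolding Fw_def Hw_def using that by (intro sphere_integral_smooth w p) auto
  have Alim: "(\<lambda>k. LINT s:{r..1}|lborel. ?Aw k s) \<longlonglongrightarrow> (LINT s:{r..1}|lborel. ?A s)" if r: "r \<in> {0<..<1}" for r
  proof -
    have "(\<lambda>k. (LINT s:{r..1}|lborel. ?Aw k s) - (LINT s:{r..1}|lborel. ?A s)) \<longlonglongrightarrow> 0"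
    proof (rule Lim_null_comparison)
      show "(\<lambda>k. (1 / r ^ (DIM('a) - 1)) * (LINT x|?B. norm (Hw k x - H x))) \<longlonglongrightarrow> 0" using tendsto_mult_right_zero[OF lH] .
      show "eventually (\<lambda>k. norm ((LINT s:{r..1}|lborel. ?Aw k s) - (LINT s:{r..1}|lborel. ?A s)) \<le> (1 / r ^ (DIM('a) - 1)) * (LINT x|?B. norm (Hw k x - H x))) sequentially"
        by (intro always_eventually allI sphere_integral_tail_diff[OF d Fb(4) F2(4) Fb(3) F2(3) r])
    qed
    then show ?thesis by (simp add: LIM_zero_iff)
  qed
  define D where "D k r = indicator {0<..<1} r *\<^sub>R (r ^ (DIM('a) - 1) *\<^sub>R (LINT y|?S. norm (Fw k (r *\<^sub>R y) - F (r *\<^sub>R y))))" for k r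
  have Db: "(\<lambda>x. norm (Fw k x - F x)) \<in> borel_measurable borel" for k using Fb(1,2) by measurable
  have Di: "integrable ?B (\<lambda>x. norm (Fw k x - F x))" for k using Fi by auto
  have Dint: "integrable lborel (D k)" for k
    using polar_coordinates(2)[OF Db Di] unfolding D_def set_integrable_def by simp
  have "(LINT r|lborel. norm (D k r)) = (LINT x|?B. norm (Fw k x - F x))" for k
  proof -
    have "norm (D k r) = D k r" for r by (auto simp: D_def indicator_def)
    then show ?thesis using polar_coordinates(3)[OF Db[of k] Di] by (simp add: D_def set_lebesgue_integral_def)
  qed
  then have "(\<lambda>k. LINT r|lborel. norm (D k r)) \<longlonglongrightarrow> 0" using lF by simp
  from tendsto_L1_AE_subseq[OF Dint this] obtain \<sigma> :: "nat \<Rightarrow> nat" where \<sigma>: "strict_mono \<sigma>" "AE r in lborel. (\<lambda>n. D (\<sigma> n) r) \<longlonglongrightarrow> 0" by blast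
  have AEF: "AE r in lborel. \<forall>k. r \<in> {0<..<1} \<longrightarrow> integrable ?S (\<lambda>y. Fw k (r *\<^sub>R y))"
    unfolding AE_all_countable using polar_coordinates(1)[OF Fb(2) Fi(2)] by blast
  have "AE r in lborel. r \<in> {0<..<1} \<longrightarrow> sphere_integral F r = ?c - (LINT s:{r..1}|lborel. ?A s)"
    using \<sigma>(2) AEF polar_coordinates(1)[OF Fb(1) Fi(1)]
  proof eventually_elim
    fix r assume Dl: "(\<lambda>n. D (\<sigma> n) r) \<longlonglongrightarrow> 0" and i1: "\<forall>k. r \<in> {0<..<1} \<longrightarrow> integrable ?S (\<lambda>y. Fw k (r *\<^sub>R y))"
      and i2: "r \<in> {0<..<1} \<longrightarrow> integrable ?S (\<lambda>y. F (r *\<^sub>R y))"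
    show "r \<in> {0<..<1} \<longrightarrow> sphere_integral F r = ?c - (LINT s:{r..1}|lborel. ?A s)"
    proof
      assume r: "r \<in> {0<..<1}"
      have "(\<lambda>n. sphere_integral (Fw (\<sigma> n)) r - sphere_integral F r) \<longlonglongrightarrow> 0"
      proof (rule Lim_null_comparison)
        show "(\<lambda>n. (1 / r ^ (DIM('a) - 1)) * D (\<sigma> n) r) \<longlonglongrightarrow> 0" using tendsto_mult_right_zero[OF Dl] .
        show "eventually (\<lambda>n. norm (sphere_integral (Fw (\<sigma> n)) r - sphere_integral F r) \<le> (1 / r ^ (DIM('a) - 1)) * D (\<sigma> n) r) sequentially"
        proof (intro always_eventually allI)
          fix n
          have "sphere_integral (Fw (\<sigma> n)) r - sphere_integral F r = (LINT y|?S. Fw (\<sigma> n) (r *\<^sub>R y) - F (r *\<^sub>R y))"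
            unfolding sphere_integral_def using i1 i2 r by simp
          also have "norm \<dots> \<le> (LINT y|?S. norm (Fw (\<sigma> n) (r *\<^sub>R y) - F (r *\<^sub>R y)))" by (rule integral_norm_bound)
          also have "\<dots> = (1 / r ^ (DIM('a) - 1)) * D (\<sigma> n) r" using r by (simp add: D_def)
          finally show "norm (sphere_integral (Fw (\<sigma> n)) r - sphere_integral F r) \<le> (1 / r ^ (DIM('a) - 1)) * D (\<sigma> n) r" .
        qed
      qed
      then have "(\<lambda>n. sphere_integral (Fw (\<sigma> n)) r) \<longlonglongrightarrow> sphere_integral F r" by (simp add: LIM_zero_iff)
      moreover have "(\<lambda>n. sphere_integral (Fw (\<sigma> n)) r) \<longlonglongrightarrow> ?c - (LINT s:{r..1}|lborel. ?A s)"
        unfolding smooth_eq[OF r]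
        by (intro tendsto_diff LIMSEQ_subseq_LIMSEQ[OF cwc \<sigma>(1), unfolded o_def] LIMSEQ_subseq_LIMSEQ[OF Alim[OF r] \<sigma>(1), unfolded o_def])
      ultimately show "sphere_integral F r = ?c - (LINT s:{r..1}|lborel. ?A s)" by (rule LIMSEQ_unique)
    qed
  qed
  then show ?thesis
    by (intro that[of ?A] borel_measurable_sphere_integral Fb set_integrable_sphere_integral_square F2) (simp add: F_def)
qed

section \<open>The radial equation for the moments of a solution\<close>

text \<open>What is retained of a weak solution with a given trace, for a Borel representative \<open>z\<close>: the
  equation with all derivatives moved to the test function, and the moments as primitives of finite
  energy with boundary values \<open>c p\<close>. For the trace \<open>f\<close> the boundary value \<open>c p\<close> is the integral of \<open>f p\<close> over the
  sphere. Both conditions are linear in \<open>z\<close> and \<open>c\<close> and mention neither a gradient nor an approximating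
  sequence.\<close>

definition moment_solution :: "(real \<Rightarrow> complex) \<Rightarrow> ('a::euclidean_space \<Rightarrow> complex) \<Rightarrow> (('a \<Rightarrow> complex) \<Rightarrow> complex) \<Rightarrow> bool" where
  "moment_solution V z c \<longleftrightarrow>
     z \<in> borel_measurable borel \<and> integrable unit_ball_measure (\<lambda>x. (norm (z x))\<^sup>2) \<and>
     (\<forall>\<phi>\<in>test_functions. integrable unit_ball_measure (\<lambda>x. V (norm x) * z x * \<phi> x) \<and>
        (LINT x|unit_ball_measure. z x * laplacian \<phi> x) = (LINT x|unit_ball_measure. V (norm x) * z x * \<phi> x)) \<and>
     (\<forall>p. continuous_on UNIV p \<longrightarrow>
        (\<exists>A. A \<in> borel_measurable borel \<and> set_integrable lborel {0<..<1} (\<lambda>r. r ^ (DIM('a) - 1) * (norm (A r))\<^sup>2) \<and>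
          (AE r in lborel. r \<in> {0<..<1} \<longrightarrow>
             sphere_integral (angular_weight p z) r = c p - (LINT s:{r..1}|lborel. A s))))"

lemma integrable_mult_continuous_unit_ball:
  fixes z q :: "'a::euclidean_space \<Rightarrow> complex"
  assumes z: "integrable unit_ball_measure z" and q: "continuous_on UNIV q"
  shows "integrable unit_ball_measure (\<lambda>x. z x * q x)"
proof -
  obtain P where P: "0 < P" "\<And>w. norm w \<le> 1 \<Longrightarrow> norm (q w) \<le> P" using sphere_bound[OF q] by metis
  show ?thesis
  proof (rule Bochner_Integration.integrable_bound)
    show "integrable unit_ball_measure (\<lambda>x. P *\<^sub>R z x)" using z by (rule integrable_scaleR_right)
    have "q \<in> borel_measurable unit_ball_measure"
      by (rule borel_measurable_lebesgue_onI[OF borel_measurable_continuous_onI[OF q]])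
    then show "(\<lambda>x. z x * q x) \<in> borel_measurable unit_ball_measure"
      using borel_measurable_integrable[OF z] by measurable
    show "AE x in unit_ball_measure. norm (z x * q x) \<le> norm (P *\<^sub>R z x)"
      using P by (intro AE_I2) (auto simp: norm_mult mult.commute[of P] intro!: mult_left_mono)
  qed
qed

lemma angular_weight_ray:
  assumes "norm w = 1" "0 < r" shows "angular_weight p z (r *\<^sub>R w) = z (r *\<^sub>R w) * p w"
  using assms by (simp add: angular_weight_def sgn_scaleR sgn_div_norm)

text \<open>Testing with \<open>\<phi> = \<xi>(|x|\<^sup>2) p(x)\<close> gives an equation on the unit interval, in which the term with
  the Laplacian of \<open>p\<close> vanishes by assumption. With \<open>j = d - 1 + k\<close> and the slope \<open>A\<close> of \<open>F\<close>, one integration by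
  parts turns it into \<open>\<integral> Q0 (\<xi>(r\<^sup>2))' = - \<integral> r\<^sup>j V F \<xi>(r\<^sup>2)\<close> for \<open>Q0 = r\<^sup>j A - k r\<^sup>j\<^sup>-\<^sup>1 F\<close>, and the lemma of
  du Bois-Reymond identifies \<open>Q0\<close> with a flux of \<open>F\<close>. The growth bound makes \<open>r\<^sup>j\<^sup>-\<^sup>1 F\<close> bounded, so that \<open>r\<^sup>j V F\<close> is
  dominated by \<open>r V\<close>.\<close>

theorem moment_radial_solution:
  fixes z p :: "'a::euclidean_space \<Rightarrow> complex"
  assumes d: "3 \<le> DIM('a)"
    and V: "V \<in> borel_measurable borel" "set_integrable lborel {0<..<1} (\<lambda>r. of_real r * V r)"
    and z: "moment_solution V z c" and p: "homogeneous_poly k p"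
    and lap0: "AE r in lborel. r \<in> {0<..<1} \<longrightarrow> sphere_integral (angular_weight (laplacian p) z) r = 0"
  obtains F Q where "radial_solution DIM('a) k V F Q" "F 1 = c p"
    "AE r in lborel. r \<in> {0<..<1} \<longrightarrow> sphere_integral (angular_weight p z) r = F r"
proof -
  interpret B: finite_measure "unit_ball_measure :: 'a measure" by (rule finite_measure_unit_ball)
  let ?d = "DIM('a)" and ?B = "unit_ball_measure :: 'a measure" and ?S = "sphere_measure :: 'a measure"
  define j where "j = ?d - 1 + k"
  have j1: "j = Suc (j - 1)" using d by (simp add: j_def)
  have sp: "smooth p" by (rule smooth_alg_smooth[OF homogeneous_poly_smooth_alg[OF p]])
  have lp: "homogeneous_poly (k - 2) (laplacian p)" by (rule homogeneous_poly_laplacian(1)[OF p])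
  have slp: "smooth (laplacian p)" by (rule smooth_alg_smooth[OF homogeneous_poly_smooth_alg[OF lp]])
  have zb[measurable]: "z \<in> borel_measurable borel" and z2: "integrable ?B (\<lambda>x. (norm (z x))\<^sup>2)"
    and zt: "\<And>\<phi>. \<phi> \<in> test_functions \<Longrightarrow> integrable ?B (\<lambda>x. V (norm x) * z x * \<phi> x)"
       "\<And>\<phi>. \<phi> \<in> test_functions \<Longrightarrow> (LINT x|?B. z x * laplacian \<phi> x) = (LINT x|?B. V (norm x) * z x * \<phi> x)"
    using z unfolding moment_solution_def by blast+
  have zi: "integrable ?B z" by (intro B.integrable_norm_if_square borel_measurable_lebesgue_onI zb z2)
  obtain A where A[measurable]: "A \<in> borel_measurable borel"
    and A2: "set_integrable lborel {0<..<1} (\<lambda>r. r ^ (?d - 1) * (norm (A r))\<^sup>2)"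
    and FA: "AE r in lborel. r \<in> {0<..<1} \<longrightarrow> sphere_integral (angular_weight p z) r = c p - (LINT s:{r..1}|lborel. A s)"
    using z smooth_continuous[OF sp] unfolding moment_solution_def by blast
  have As: "set_borel_measurable borel {0<..<1} A" unfolding set_borel_measurable_def by measurable
  have Ai: "set_integrable lborel {e..1} A" if "0 < e" for e
  proof (cases "e \<le> 1")
    case True
    then show ?thesis by (rule weighted_square_integrable_tail(1)[OF d As A2 that])
  qed (simp add: set_integrable_def)
  define F where "F r = c p - (LINT s:{r..1}|lborel. A s)" for r
  have point: "(LINT s:{1..1::real}|lborel. h s) = 0" for h :: "real \<Rightarrow> complex"
    unfolding set_lebesgue_integral_def
  proof (rule integral_eq_zero_AE)
    show "AE s in lborel. indicator {1..1::real} s *\<^sub>R h s = 0"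
      using AE_lborel_singleton[of 1] by eventually_elim (auto simp: indicator_def)
  qed
  have F1: "F 1 = c p" unfolding F_def by (simp only: point diff_zero)
  have Fc: "continuous_on {0<..1} F"
    unfolding F_def[abs_def] by (intro continuous_on_diff continuous_on_const continuous_on_tail_integral Ai)
  obtain C0 where C0: "\<And>r. r \<in> {0<..1} \<Longrightarrow> norm (F r) * sqrt (r ^ (?d - 2)) \<le> C0"
    using growth_of_primitive[OF d As A2] unfolding F_def by metis
  have C0': "r ^ (j - 1) * norm (F r) \<le> C0" if r: "r \<in> {0<..1}" for r
  proof -
    have "r ^ (j - 1) \<le> r ^ (?d - 2)"
      using r d by (intro power_decreasing) (auto simp: j_def)
    also have "\<dots> \<le> sqrt (r ^ (?d - 2))"
    proof -
      have "r ^ (?d - 2) \<le> 1" "0 \<le> r ^ (?d - 2)" using r by (auto intro: power_le_one)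
      then have "(r ^ (?d - 2))\<^sup>2 \<le> r ^ (?d - 2)" by (simp add: power2_eq_square mult_left_le_one_le)
      then show ?thesis by (rule real_le_rsqrt)
    qed
    finally have "r ^ (j - 1) * norm (F r) \<le> sqrt (r ^ (?d - 2)) * norm (F r)" by (rule mult_right_mono) auto
    also have "\<dots> \<le> C0" using C0[OF r] by (simp add: mult.commute)
    finally show ?thesis .
  qed
  define b where "b r = of_real (r ^ j) * V r * F r" for r
  define Q0 where "Q0 r = of_real (r ^ j) * A r - of_real (real k * r ^ (j - 1)) * F r" for r
  define Fi where "Fi = (\<lambda>r. indicator {0<..1} r *\<^sub>R F r)"
  have [measurable]: "Fi \<in> borel_measurable borel"
    using borel_measurable_continuous_on_indicator[OF _ Fc] by (simp add: Fi_def)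
  note [measurable] = V(1)
  have bi: "set_integrable lborel {0<..1} b"
    unfolding set_integrable_def
  proof (rule Bochner_Integration.integrable_bound)
    show "integrable lborel (\<lambda>r. C0 *\<^sub>R (indicator {0<..<1} r *\<^sub>R (of_real r * V r)))"
      using V(2) unfolding set_integrable_def by (rule integrable_scaleR_right)
    have "(\<lambda>r. of_real (r ^ j) * V r * Fi r) \<in> borel_measurable lborel" by measurable
    also have "(\<lambda>r. of_real (r ^ j) * V r * Fi r) = (\<lambda>r. indicator {0<..1} r *\<^sub>R b r)"
      by (simp add: Fi_def b_def fun_eq_iff)
    finally show "(\<lambda>r. indicator {0<..1} r *\<^sub>R b r) \<in> borel_measurable lborel" .
    show "AE r in lborel. norm (indicator {0<..1} r *\<^sub>R b r) \<le> norm (C0 *\<^sub>R (indicator {0<..<1} r *\<^sub>R (of_real r * V r)))"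
      using AE_lborel_singleton[of "1::real"]
    proof eventually_elim
      fix r :: real assume r1: "r \<noteq> 1"
      show "norm (indicator {0<..1} r *\<^sub>R b r) \<le> norm (C0 *\<^sub>R (indicator {0<..<1} r *\<^sub>R (of_real r * V r)))"
      proof (cases "r \<in> {0<..1}")
        case True
        have "norm (b r) = (r * norm (V r)) * (r ^ (j - 1) * norm (F r))"
          using True by (subst j1) (simp add: b_def norm_mult norm_power j1[symmetric] flip: power_Suc, subst j1, simp)
        also have "\<dots> \<le> (r * norm (V r)) * \<bar>C0\<bar>"
          using C0'[OF True] True by (intro mult_left_mono) auto
        finally show ?thesis using True r1 by (simp add: norm_mult mult_ac)
      qed auto
    qed
  qed
  have Q0i: "set_integrable lborel {0<..<1} Q0"
    unfolding set_integrable_def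
  proof (rule Bochner_Integration.integrable_bound)
    have const: "set_integrable lborel {0<..<1::real} (\<lambda>_. x)" for x :: real
      unfolding set_integrable_def by (rule integrableI_bounded_set_indicator[where B="\<bar>x\<bar>"]) auto
    have "set_integrable lborel {0<..<1} (\<lambda>r. (1 + real k * \<bar>C0\<bar>) + r ^ (?d - 1) * (norm (A r))\<^sup>2)"
      by (intro set_integral_add(1) A2 const)
    then show "integrable lborel (\<lambda>r. indicator {0<..<1} r *\<^sub>R ((1 + real k * \<bar>C0\<bar>) + r ^ (?d - 1) * (norm (A r))\<^sup>2))"
      by (simp add: set_integrable_def)
    have "(\<lambda>r. indicator {0<..<1} r *\<^sub>R (of_real (r ^ j) * A r - of_real (real k * r ^ (j - 1)) * Fi r)) \<in> borel_measurable lborel" by measurable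
    also have "(\<lambda>r. indicator {0<..<1} r *\<^sub>R (of_real (r ^ j) * A r - of_real (real k * r ^ (j - 1)) * Fi r)) = (\<lambda>r. indicator {0<..<1} r *\<^sub>R Q0 r)"
      by (auto simp: Fi_def Q0_def fun_eq_iff indicator_def)
    finally show "(\<lambda>r. indicator {0<..<1} r *\<^sub>R Q0 r) \<in> borel_measurable lborel" .
    have "norm (Q0 r) \<le> (1 + real k * \<bar>C0\<bar>) + r ^ (?d - 1) * (norm (A r))\<^sup>2" if r: "r \<in> {0<..<1}" for r
    proof -
      have "norm (Q0 r) \<le> r ^ j * norm (A r) + real k * (r ^ (j - 1) * norm (F r))"
        unfolding Q0_def using r by (intro order.trans[OF norm_triangle_ineq4]) (simp add: norm_mult norm_power)
      moreover have "real k * (r ^ (j - 1) * norm (F r)) \<le> real k * \<bar>C0\<bar>"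
        using C0'[of r] r by (intro mult_left_mono) auto
      moreover have "r ^ j * norm (A r) \<le> 1 + r ^ (?d - 1) * (norm (A r))\<^sup>2"
      proof -
        have "r ^ j \<le> r ^ (?d - 1)" using r by (intro power_decreasing) (auto simp: j_def)
        then have "r ^ j * norm (A r) \<le> r ^ (?d - 1) * norm (A r)" by (rule mult_right_mono) auto
        also have "\<dots> \<le> r ^ (?d - 1) * (1 + (norm (A r))\<^sup>2)"
        proof (rule mult_left_mono)
          have "0 \<le> (norm (A r) - 1)\<^sup>2 + (norm (A r))\<^sup>2 + 1" by (intro add_nonneg_nonneg) auto
          then show "norm (A r) \<le> 1 + (norm (A r))\<^sup>2" by (simp add: power2_diff)
        qed (use r in auto)
        also have "\<dots> \<le> 1 + r ^ (?d - 1) * (norm (A r))\<^sup>2"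
          using r by (simp add: distrib_left power_le_one)
        finally show ?thesis .
      qed
      ultimately show ?thesis by linarith
    qed
    then show "AE r in lborel. norm (indicator {0<..<1} r *\<^sub>R Q0 r) \<le> norm (indicator {0<..<1} r *\<^sub>R ((1 + real k * \<bar>C0\<bar>) + r ^ (?d - 1) * (norm (A r))\<^sup>2))"
      by (intro AE_I2) (auto simp: indicator_def intro: order.trans[OF _ abs_ge_self])
  qed
  have si: "sphere_integral (angular_weight q z) r = (LINT w|?S. z (r *\<^sub>R w) * q w)" if "0 < r" for q r
    unfolding sphere_integral_def using that
    by (intro Bochner_Integration.integral_cong refl) (auto simp: space_sphere_measure angular_weight_ray)
  have weak: "(LINT r:{0<..<1}|lborel. Q0 r * of_real (2 * r * g (r\<^sup>2))) = - (LINT r:{0<..<1}|lborel. b r * of_real (f (r\<^sup>2)))"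
    if f: "\<And>t. (f has_real_derivative g t) (at t)" and s: "smooth1 f" "smooth1 g" and ac: "0 < a" "a' < 1"
      and supp: "\<And>t. t \<notin> {a..a'} \<Longrightarrow> f t = 0" for f g :: "real \<Rightarrow> real" and a a'
  proof -
    obtain g' where g': "\<And>t. (g has_real_derivative g' t) (at t)" "smooth1 g'"
      using smooth1_derivative[OF s(2)] by metis
    have g0: "g t = 0" if t: "t \<notin> {a..a'}" for t
    proof -
      have "(f has_real_derivative 0) (at t)"
        by (rule has_field_derivative_transform_within_open[of "\<lambda>_. 0" _ _ "- {a..a'}"]) (use t supp in auto)
      from DERIV_unique[OF f this] show ?thesis .
    qed
    \<comment> \<open>For \<open>r \<le> e\<close> the square \<open>r\<^sup>2 < r \<le> a\<close> lies to the left of the support.\<close>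
    define e where "e = min a (1/2)"
    have e: "0 < e" "e \<le> a" "e \<le> 1" using ac by (auto simp: e_def)
    have low: "r\<^sup>2 \<notin> {a..a'}" if "0 < r" "r \<le> e" for r
    proof -
      have "r\<^sup>2 < r * 1" using that e_def unfolding power2_eq_square by (intro mult_strict_left_mono) auto
      then show ?thesis using that e by auto
    qed
    define \<phi> where "\<phi> = (\<lambda>x::'a. of_real (f (x \<bullet> x)) * p x)"
    have \<phi>: "\<phi> \<in> test_functions" unfolding \<phi>_def by (rule radial_times_poly_test_function[OF p s(1) supp ac(2)])
    \<comment> \<open>The factor of \<open>p\<close> in the Laplacian of \<open>\<phi>\<close>.\<close>
    define K where "K r = 4 * r\<^sup>2 * g' (r\<^sup>2) + (2 * real ?d + 4 * real k) * g (r\<^sup>2)" for r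
    have lap\<phi>: "laplacian \<phi> x = of_real (f (x \<bullet> x)) * laplacian p x + of_real (K (norm x)) * p x" for x
      unfolding \<phi>_def K_def using laplacian_radial_times_homogeneous[OF p f g'(1) s, of x]
      by (simp add: power2_norm_eq_inner)
    have cr: "continuous_on UNIV (\<lambda>x::'a. complex_of_real (h (x \<bullet> x)))" if "smooth1 h" for h
      by (intro continuous_on_of_real continuous_on_compose2[OF smooth1_continuous[OF that, of UNIV]] continuous_intros) auto
    have cK: "continuous_on UNIV (\<lambda>x::'a. complex_of_real (K (norm x)))"
    proof -
      have "continuous_on UNIV (\<lambda>x::'a. 4 * complex_of_real (x \<bullet> x) * complex_of_real (g' (x \<bullet> x)) + complex_of_real (2 * real ?d + 4 * real k) * complex_of_real (g (x \<bullet> x)))"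
        by (intro continuous_on_add continuous_on_mult continuous_on_const cr s g'(2) continuous_on_of_real continuous_on_inner continuous_on_id)
      then show ?thesis by (simp add: K_def power2_norm_eq_inner)
    qed
    define h1 where "h1 x = z x * (of_real (f (x \<bullet> x)) * laplacian p x)" for x
    define h2 where "h2 x = z x * (of_real (K (norm x)) * p x)" for x
    define h3 where "h3 x = V (norm x) * z x * \<phi> x" for x
    have c1: "continuous_on UNIV (\<lambda>x. of_real (f (x \<bullet> x)) * laplacian p x)"
      by (intro continuous_on_mult cr s smooth_continuous slp)
    have c2: "continuous_on UNIV (\<lambda>x. of_real (K (norm x)) * p x)"
      by (intro continuous_on_mult cK smooth_continuous sp)
    have i1: "integrable ?B h1" "integrable ?B h2"
      unfolding h1_def[abs_def] h2_def[abs_def] by (intro integrable_mult_continuous_unit_ball zi c1 c2)+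
    have i3: "integrable ?B h3" unfolding h3_def[abs_def] by (rule zt(1)[OF \<phi>])
    have \<phi>b[measurable]: "\<phi> \<in> borel_measurable borel"
      using \<phi> by (intro borel_measurable_smooth) (simp add: test_functions_def)
    have m: "h1 \<in> borel_measurable borel" "h2 \<in> borel_measurable borel" "h3 \<in> borel_measurable borel"
      unfolding h1_def[abs_def] h2_def[abs_def] h3_def[abs_def]
      using borel_measurable_continuous_onI[OF c1] borel_measurable_continuous_onI[OF c2] by measurable
    have eq: "(LINT x|?B. h1 x) + (LINT x|?B. h2 x) = (LINT x|?B. h3 x)"
    proof -
      have "(LINT x|?B. h1 x) + (LINT x|?B. h2 x) = (LINT x|?B. z x * laplacian \<phi> x)"
      proof -
        have zl: "(\<lambda>x. z x * laplacian \<phi> x) = (\<lambda>x. h1 x + h2 x)"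
          by (simp add: h1_def h2_def lap\<phi> distrib_left fun_eq_iff)
        show ?thesis unfolding zl by (rule Bochner_Integration.integral_add[OF i1, symmetric])
      qed
      then show ?thesis unfolding h3_def using zt(2)[OF \<phi>] by simp
    qed
    have pol: "(LINT x|?B. h x) = (LINT r:{0<..<1}|lborel. H r)"
      if h: "h \<in> borel_measurable borel" "integrable ?B h" and Hm: "(\<lambda>r. indicator {0<..<1} r *\<^sub>R H r) \<in> borel_measurable lborel"
        and H: "AE r in lborel. r \<in> {0<..<1} \<longrightarrow> r ^ (?d - 1) *\<^sub>R (LINT w|?S. h (r *\<^sub>R w)) = H r" for h :: "'a \<Rightarrow> complex" and H :: "real \<Rightarrow> complex"
      unfolding polar_coordinates(3)[OF h] set_lebesgue_integral_def
    proof (rule integral_cong_AE[OF _ Hm])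
      show "(\<lambda>r. indicator {0<..<1} r *\<^sub>R r ^ (?d - 1) *\<^sub>R (LINT w|?S. h (r *\<^sub>R w))) \<in> borel_measurable lborel"
        using borel_measurable_integrable[OF polar_coordinates(2)[OF h, unfolded set_integrable_def]] .
      show "AE r in lborel. indicator {0<..<1} r *\<^sub>R r ^ (?d - 1) *\<^sub>R (LINT w|?S. h (r *\<^sub>R w)) = indicator {0<..<1} r *\<^sub>R H r"
        using H by eventually_elim (auto simp: indicator_def)
    qed
    have rj: "t ^ j = t ^ (?d - 1) * t ^ k" for t :: real by (simp only: j_def power_add)
    have rw: "(r *\<^sub>R w) \<bullet> (r *\<^sub>R w) = r\<^sup>2" if "norm w = 1" for r and w :: 'a
      using that by (simp add: power2_eq_square flip: power2_norm_eq_inner)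
    have H1: "(LINT x|?B. h1 x) = 0"
    proof -
      have "(LINT x|?B. h1 x) = (LINT r:{0<..<1::real}|lborel. 0)"
      proof (rule pol[OF m(1) i1(1)])
        show "AE r in lborel. r \<in> {0<..<1} \<longrightarrow> r ^ (?d - 1) *\<^sub>R (LINT w|?S. h1 (r *\<^sub>R w)) = 0"
          using lap0
        proof eventually_elim
          fix r :: real assume *: "r \<in> {0<..<1} \<longrightarrow> sphere_integral (angular_weight (laplacian p) z) r = 0"
          show "r \<in> {0<..<1} \<longrightarrow> r ^ (?d - 1) *\<^sub>R (LINT w|?S. h1 (r *\<^sub>R w)) = 0"
          proof
            assume r: "r \<in> {0<..<1}"
            have "(LINT w|?S. h1 (r *\<^sub>R w)) = (LINT w|?S. of_real (f (r\<^sup>2) * r ^ (k - 2)) * (z (r *\<^sub>R w) * laplacian p w))"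
              by (intro Bochner_Integration.integral_cong refl)
                (auto simp: space_sphere_measure h1_def rw homogeneous_poly_scaleR[OF lp] simp del: inner_scaleR_left inner_scaleR_right)
            also have "\<dots> = of_real (f (r\<^sup>2) * r ^ (k - 2)) * (LINT w|?S. z (r *\<^sub>R w) * laplacian p w)"
              by (rule integral_mult_right_zero)
            also have "(LINT w|?S. z (r *\<^sub>R w) * laplacian p w) = 0" using * si[of r "laplacian p"] r by simp
            finally show "r ^ (?d - 1) *\<^sub>R (LINT w|?S. h1 (r *\<^sub>R w)) = 0" by simp
          qed
        qed
      qed simp
      then show ?thesis by (simp add: set_lebesgue_integral_def)
    qed
    have FiF: "Fi r = F r" if "r \<in> {0<..1}" for r using that by (simp add: Fi_def)
    have siF: "AE r in lborel. r \<in> {0<..<1} \<longrightarrow> (LINT w|?S. z (r *\<^sub>R w) * p w) = F r"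
      using FA by eventually_elim (auto simp: si[symmetric] F_def)
    have Kb[measurable]: "K \<in> borel_measurable borel" "(\<lambda>r. f (r\<^sup>2)) \<in> borel_measurable borel"
    proof -
      have "continuous_on UNIV K" "continuous_on UNIV (\<lambda>r. f (r\<^sup>2))" unfolding K_def[abs_def]
        by (intro continuous_intros continuous_on_compose2[OF smooth1_continuous[OF g'(2), of UNIV]]
          continuous_on_compose2[OF smooth1_continuous[OF s(2), of UNIV]] continuous_on_compose2[OF smooth1_continuous[OF s(1), of UNIV]]; simp)+
      then show "K \<in> borel_measurable borel" "(\<lambda>r. f (r\<^sup>2)) \<in> borel_measurable borel"
        by (auto intro: borel_measurable_continuous_onI)
    qed
    have H2: "(LINT x|?B. h2 x) = (LINT r:{0<..<1}|lborel. F r * of_real (r ^ j * K r))"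
    proof (rule pol[OF m(2) i1(2)])
      have "(\<lambda>r. indicator {0<..<1} r *\<^sub>R (Fi r * of_real (r ^ j * K r))) \<in> borel_measurable lborel" by measurable
      also have "(\<lambda>r. indicator {0<..<1} r *\<^sub>R (Fi r * of_real (r ^ j * K r))) = (\<lambda>r. indicator {0<..<1} r *\<^sub>R (F r * of_real (r ^ j * K r)))"
        by (auto simp: FiF indicator_def fun_eq_iff)
      finally show "(\<lambda>r. indicator {0<..<1} r *\<^sub>R (F r * of_real (r ^ j * K r))) \<in> borel_measurable lborel" .
      show "AE r in lborel. r \<in> {0<..<1} \<longrightarrow> r ^ (?d - 1) *\<^sub>R (LINT w|?S. h2 (r *\<^sub>R w)) = F r * of_real (r ^ j * K r)"
        using siF
      proof eventually_elim
        fix r :: real assume *: "r \<in> {0<..<1} \<longrightarrow> (LINT w|?S. z (r *\<^sub>R w) * p w) = F r"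
        show "r \<in> {0<..<1} \<longrightarrow> r ^ (?d - 1) *\<^sub>R (LINT w|?S. h2 (r *\<^sub>R w)) = F r * of_real (r ^ j * K r)"
        proof
          assume r: "r \<in> {0<..<1}"
          have "(LINT w|?S. h2 (r *\<^sub>R w)) = (LINT w|?S. of_real (K r * r ^ k) * (z (r *\<^sub>R w) * p w))"
            using r by (intro Bochner_Integration.integral_cong refl)
              (auto simp: space_sphere_measure h2_def homogeneous_poly_scaleR[OF p])
          also have "\<dots> = of_real (K r * r ^ k) * (LINT w|?S. z (r *\<^sub>R w) * p w)"
            by (rule integral_mult_right_zero)
          also have "(LINT w|?S. z (r *\<^sub>R w) * p w) = F r" using * r by simp
          finally show "r ^ (?d - 1) *\<^sub>R (LINT w|?S. h2 (r *\<^sub>R w)) = F r * of_real (r ^ j * K r)"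
            by (simp add: rj scaleR_conv_of_real mult_ac)
        qed
      qed
    qed
    have H3: "(LINT x|?B. h3 x) = (LINT r:{0<..<1}|lborel. b r * of_real (f (r\<^sup>2)))"
    proof (rule pol[OF m(3) i3])
      have "(\<lambda>r. indicator {0<..<1} r *\<^sub>R (of_real (r ^ j) * V r * Fi r * of_real (f (r\<^sup>2)))) \<in> borel_measurable lborel" by measurable
      also have "(\<lambda>r. indicator {0<..<1} r *\<^sub>R (of_real (r ^ j) * V r * Fi r * of_real (f (r\<^sup>2)))) = (\<lambda>r. indicator {0<..<1} r *\<^sub>R (b r * of_real (f (r\<^sup>2))))"
        by (auto simp: FiF b_def indicator_def fun_eq_iff)
      finally show "(\<lambda>r. indicator {0<..<1} r *\<^sub>R (b r * of_real (f (r\<^sup>2)))) \<in> borel_measurable lborel" .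
      show "AE r in lborel. r \<in> {0<..<1} \<longrightarrow> r ^ (?d - 1) *\<^sub>R (LINT w|?S. h3 (r *\<^sub>R w)) = b r * of_real (f (r\<^sup>2))"
        using siF
      proof eventually_elim
        fix r :: real assume *: "r \<in> {0<..<1} \<longrightarrow> (LINT w|?S. z (r *\<^sub>R w) * p w) = F r"
        show "r \<in> {0<..<1} \<longrightarrow> r ^ (?d - 1) *\<^sub>R (LINT w|?S. h3 (r *\<^sub>R w)) = b r * of_real (f (r\<^sup>2))"
        proof
          assume r: "r \<in> {0<..<1}"
          have "(LINT w|?S. h3 (r *\<^sub>R w)) = (LINT w|?S. (V r * of_real (f (r\<^sup>2) * r ^ k)) * (z (r *\<^sub>R w) * p w))"
            using r by (intro Bochner_Integration.integral_cong refl)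
              (auto simp: space_sphere_measure h3_def \<phi>_def rw homogeneous_poly_scaleR[OF p] simp del: inner_scaleR_left inner_scaleR_right)
          also have "\<dots> = (V r * of_real (f (r\<^sup>2) * r ^ k)) * (LINT w|?S. z (r *\<^sub>R w) * p w)"
            by (rule integral_mult_right_zero)
          also have "(LINT w|?S. z (r *\<^sub>R w) * p w) = F r" using * r by simp
          finally show "r ^ (?d - 1) *\<^sub>R (LINT w|?S. h3 (r *\<^sub>R w)) = b r * of_real (f (r\<^sup>2))"
            unfolding b_def rj by (simp add: scaleR_conv_of_real mult_ac)
        qed
      qed
    qed
    \<comment> \<open>\<open>?Y\<close> is the primitive of \<open>r\<^sup>j K(r)\<close> up to the term \<open>?m\<close>, which becomes the second part of the flux.\<close>
    let ?Y = "\<lambda>r. complex_of_real (2 * r ^ (j + 1) * g (r\<^sup>2))"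
    let ?m = "\<lambda>r. complex_of_real (2 * real k * (r ^ j * g (r\<^sup>2)))"
    let ?Y' = "\<lambda>r. complex_of_real (r ^ j * K r - 2 * real k * (r ^ j * g (r\<^sup>2)))"
    have Y: "(?Y has_vector_derivative ?Y' r) (at r within {e..1})" for r
    proof (rule has_vector_derivative_of_real)
      have dg: "((\<lambda>r. g (r\<^sup>2)) has_real_derivative g' (r\<^sup>2) * (2 * r)) (at r within {e..1})"
        by (rule DERIV_chain2[OF g'(1)]) (auto intro!: derivative_eq_intros)
      have dp: "((\<lambda>r. 2 * r ^ (j + 1)) has_real_derivative 2 * ((real (j + 1)) * r ^ j)) (at r within {e..1})"
        using DERIV_cmult[OF DERIV_pow[of "j + 1" r "{e..1}"], of 2] by simp
      have "((\<lambda>r. 2 * r ^ (j + 1) * g (r\<^sup>2)) has_real_derivative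
          2 * ((real (j + 1)) * r ^ j) * g (r\<^sup>2) + g' (r\<^sup>2) * (2 * r) * (2 * r ^ (j + 1))) (at r within {e..1})"
        by (rule DERIV_mult[OF dp dg])
      moreover have jd: "real (j + 1) = real ?d + real k" using d by (simp add: j_def of_nat_diff)
      have "2 * ((real (j + 1)) * r ^ j) * g (r\<^sup>2) + g' (r\<^sup>2) * (2 * r) * (2 * r ^ (j + 1))
          = r ^ j * K r - 2 * real k * (r ^ j * g (r\<^sup>2))"
        unfolding jd K_def by (simp add: algebra_simps power2_eq_square)
      ultimately show "((\<lambda>r. 2 * r ^ (j + 1) * g (r\<^sup>2)) has_real_derivative r ^ j * K r - 2 * real k * (r ^ j * g (r\<^sup>2))) (at r within {e..1})"
        by (simp only:)
    qed
    have cg: "continuous_on {e..1} (\<lambda>r. g (r\<^sup>2))" "continuous_on {e..1} (\<lambda>r. g' (r\<^sup>2))"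
      by (intro continuous_intros continuous_on_compose2[OF smooth1_continuous[OF s(2), of UNIV]] continuous_on_compose2[OF smooth1_continuous[OF g'(2), of UNIV]]; simp)+
    have cK': "continuous_on {e..1} K" unfolding K_def[abs_def] by (intro continuous_intros cg)
    have cY': "continuous_on {e..1} ?Y'" and cm: "continuous_on {e..1} ?m" and cY: "continuous_on {e..1} ?Y"
      by (intro continuous_on_of_real continuous_intros cg cK')+
    have cF: "continuous_on {e..1} F" by (rule continuous_on_subset[OF Fc]) (use e in auto)
    have Y0: "?Y e = 0" "?Y 1 = 0" using g0[OF low[of e]] g0[of 1] e ac by auto
    have FYi: "set_integrable lborel {e..1} (\<lambda>r. F r * ?Y' r)" and Fmi: "set_integrable lborel {e..1} (\<lambda>r. F r * ?m r)"
      by (intro borel_integrable_atLeastAtMost' continuous_on_mult cF cY' cm)+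
    have Y'i: "set_integrable lborel {e..1} ?Y'" by (rule borel_integrable_atLeastAtMost'[OF cY'])
    have AYi: "set_integrable lborel {e..1} (\<lambda>r. A r * ?Y r)" by (rule set_integrable_mult_continuous[OF Ai[OF e(1)] cY order.refl])
    have "(LINT r:{e..1}|lborel. ?Y' r) = ?Y 1 - ?Y e"
      unfolding set_lebesgue_integral_def by (rule integral_FTC_atLeastAtMost[OF e(3)]) (use Y cY' in auto)
    then have Y'0: "(LINT r:{e..1}|lborel. ?Y' r) = 0" by (simp only: Y0 diff_zero)
    have AY: "(LINT r:{e..1}|lborel. (LINT s:{r..1}|lborel. A s) * ?Y' r) = (LINT r:{e..1}|lborel. A r * ?Y r)"
      using integral_by_parts_indefinite[OF e(3) Ai[OF e(1)] Y cY'] by (simp only: Y0 diff_zero)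
    have tail: "(LINT s:{r..1}|lborel. A s) * ?Y' r = c p * ?Y' r - F r * ?Y' r" for r
      by (simp add: F_def left_diff_distrib)
    have FY: "(LINT r:{e..1}|lborel. F r * ?Y' r) = - (LINT r:{e..1}|lborel. A r * ?Y r)"
    proof -
      have "(LINT r:{e..1}|lborel. A r * ?Y r) = (LINT r:{e..1}|lborel. c p * ?Y' r - F r * ?Y' r)"
        unfolding AY[symmetric] tail ..
      also have "\<dots> = c p * (LINT r:{e..1}|lborel. ?Y' r) - (LINT r:{e..1}|lborel. F r * ?Y' r)"
        by (subst set_integral_diff(2)[OF _ FYi]) (intro set_integrable_mult_right impI Y'i, simp only: set_integral_mult_right)
      finally show ?thesis unfolding Y'0 by simp
    qed
    have "(LINT r:{0<..<1}|lborel. F r * of_real (r ^ j * K r)) = (LINT r:{e..1}|lborel. F r * of_real (r ^ j * K r))"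
    proof (rule set_integral_Ioo_eq_Icc[OF less_imp_le[OF e(1)] e(3)])
      show "set_integrable lborel {e..1} (\<lambda>r. F r * of_real (r ^ j * K r))"
        by (intro borel_integrable_atLeastAtMost' continuous_on_mult cF continuous_on_of_real continuous_intros cK')
      have g'0: "g' t = 0" if t: "t \<notin> {a..a'}" for t
      proof -
        have "(g has_real_derivative 0) (at t)"
          by (rule has_field_derivative_transform_within_open[of "\<lambda>_. 0" _ _ "- {a..a'}"]) (use t g0 in auto)
        from DERIV_unique[OF g'(1) this] show ?thesis .
      qed
      show "F r * of_real (r ^ j * K r) = 0" if "0 < r" "r < e" for r
        using g0[OF low[of r]] g'0[OF low[of r]] that by (simp add: K_def)
    qed
    also have "\<dots> = (LINT r:{e..1}|lborel. F r * ?Y' r + F r * ?m r)"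
      by (simp only: distrib_left[symmetric] of_real_add[symmetric] diff_add_cancel)
    also have "\<dots> = - (LINT r:{e..1}|lborel. A r * ?Y r) + (LINT r:{e..1}|lborel. F r * ?m r)"
      unfolding set_integral_add(2)[OF FYi Fmi] FY ..
    also have "\<dots> = - ((LINT r:{e..1}|lborel. A r * ?Y r) - (LINT r:{e..1}|lborel. F r * ?m r))" by simp
    also have "(LINT r:{e..1}|lborel. A r * ?Y r) - (LINT r:{e..1}|lborel. F r * ?m r) = (LINT r:{e..1}|lborel. A r * ?Y r - F r * ?m r)"
      by (rule set_integral_diff(2)[OF AYi Fmi, symmetric])
    also have AYQ: "(\<lambda>r. A r * ?Y r - F r * ?m r) = (\<lambda>r. Q0 r * of_real (2 * r * g (r\<^sup>2)))"
    proof
      fix r :: real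
      have "r ^ j = r * r ^ (j - 1)" by (subst j1) simp
      then show "A r * ?Y r - F r * ?m r = Q0 r * of_real (2 * r * g (r\<^sup>2))"
        by (simp add: Q0_def algebra_simps)
    qed
    also have "(LINT r:{e..1}|lborel. Q0 r * of_real (2 * r * g (r\<^sup>2))) = (LINT r:{0<..<1}|lborel. Q0 r * of_real (2 * r * g (r\<^sup>2)))"
    proof (rule set_integral_Ioo_eq_Icc[OF less_imp_le[OF e(1)] e(3), symmetric])
      show "set_integrable lborel {e..1} (\<lambda>r. Q0 r * of_real (2 * r * g (r\<^sup>2)))"
        unfolding AYQ[symmetric] by (rule set_integral_diff(1)[OF AYi Fmi])
      show "Q0 r * of_real (2 * r * g (r\<^sup>2)) = 0" if "0 < r" "r < e" for r
        using g0[OF low[of r]] that by simp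
    qed
    finally have "(LINT x|?B. h2 x) = - (LINT r:{0<..<1}|lborel. Q0 r * of_real (2 * r * g (r\<^sup>2)))"
      unfolding H2 .
    then have "- (LINT r:{0<..<1}|lborel. Q0 r * of_real (2 * r * g (r\<^sup>2))) = (LINT r:{0<..<1}|lborel. b r * of_real (f (r\<^sup>2)))"
      using eq unfolding H1 H3 by simp
    then show ?thesis by (rule minus_equation_iff[THEN iffD1, symmetric])
  qed
  have b1: "set_integrable lborel {e..1} b" if "0 < e" for e
  proof -
    have "{e..1} \<subseteq> {0<..1}" using that by auto
    from set_integrable_subset[OF bi _ this] show ?thesis by simp
  qed
  obtain C where C: "AE r in lborel. r \<in> {0<..<1} \<longrightarrow> Q0 r = C - (LINT s:{r..1}|lborel. b s)"
  proof (rule du_bois_reymond[OF Q0i bi])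
    fix f g :: "real \<Rightarrow> real" and a a' :: real
    assume "\<And>t. (f has_real_derivative g t) (at t)" "smooth1 f" "smooth1 g" "0 < a" "a' < 1" "\<And>t. t \<notin> {a..a'} \<Longrightarrow> f t = 0"
    then show "(LINT r:{0<..<1}|lborel. Q0 r * of_real (2 * r * g (r\<^sup>2))) = - (LINT r:{0<..<1}|lborel. b r * of_real (f (r\<^sup>2)))"
      using weak[of f g a a'] by blast
  qed (rule that)
  define Q where "Q r = C - (LINT s:{r..1}|lborel. b s)" for r
  have Q1: "Q 1 = C" unfolding Q_def by (simp only: point diff_zero)
  have Qc: "continuous_on {0<..1} Q"
    unfolding Q_def[abs_def] by (intro continuous_on_diff continuous_on_const continuous_on_tail_integral b1)
  have slope: "AE r in lborel. r \<in> {0<..<1} \<longrightarrow> radial_slope ?d k F Q r = A r"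
    using C
  proof eventually_elim
    fix r :: real assume *: "r \<in> {0<..<1} \<longrightarrow> Q0 r = C - (LINT s:{r..1}|lborel. b s)"
    show "r \<in> {0<..<1} \<longrightarrow> radial_slope ?d k F Q r = A r"
    proof
      assume r: "r \<in> {0<..<1}"
      then have "Q r = Q0 r" using * by (simp add: Q_def)
      moreover have "r ^ j = r * r ^ (j - 1)" by (subst j1) simp
      ultimately show "radial_slope ?d k F Q r = A r"
        using r unfolding radial_slope_def j_def[symmetric] Q0_def
        by (simp add: field_simps)
    qed
  qed
  have sc: "continuous_on {0<..1} (radial_slope ?d k F Q)"
    unfolding radial_slope_def by (intro continuous_intros continuous_on_of_real Fc Qc) auto
  have sm: "set_borel_measurable borel {0<..<1} (radial_slope ?d k F Q)"
    by (rule set_borel_measurable_continuous_subset[OF sc]) auto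
  have "radial_solution ?d k V F Q"
    unfolding radial_solution_def
  proof (intro conjI ballI Fc Qc)
    fix r :: real assume r: "r \<in> {0<..1}"
    have "(LINT s:{r..1}|lborel. radial_slope ?d k F Q s) = (LINT s:{r..1}|lborel. A s)"
      unfolding set_lebesgue_integral_def
    proof (rule integral_cong_AE)
      have "set_borel_measurable borel {r..1} (radial_slope ?d k F Q)"
        by (rule set_borel_measurable_continuous_subset[OF sc]) (use r in auto)
      then show "(\<lambda>s. indicator {r..1} s *\<^sub>R radial_slope ?d k F Q s) \<in> borel_measurable lborel"
        by (simp add: set_borel_measurable_def)
      show "(\<lambda>s. indicator {r..1} s *\<^sub>R A s) \<in> borel_measurable lborel" by measurable
      show "AE s in lborel. indicator {r..1} s *\<^sub>R radial_slope ?d k F Q s = indicator {r..1} s *\<^sub>R A s"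
        using slope AE_lborel_singleton[of "1::real"] by eventually_elim (use r in \<open>auto simp: indicator_def\<close>)
    qed
    then show "F r = F 1 - (LINT s:{r..1}|lborel. radial_slope ?d k F Q s)"
      unfolding F1 by (simp only: F_def)
    show "Q r = Q 1 - (LINT s:{r..1}|lborel. of_real (s ^ (?d - 1 + k)) * V s * F s)"
      unfolding Q1 by (simp only: Q_def b_def j_def)
  next
    show "set_integrable lborel {0<..<1} (\<lambda>r. r ^ (?d - 1) * (norm (radial_slope ?d k F Q r))\<^sup>2)"
      unfolding set_integrable_def
    proof (rule integrable_cong_AE_imp[OF A2[unfolded set_integrable_def]])
      define h where "h = (\<lambda>r. indicator {0<..<1} r *\<^sub>R radial_slope ?d k F Q r)"
      have [measurable]: "h \<in> borel_measurable borel" using sm by (simp add: h_def set_borel_measurable_def)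
      have "(\<lambda>r. r ^ (?d - 1) * (norm (h r))\<^sup>2) \<in> borel_measurable lborel" by measurable
      also have "(\<lambda>r. r ^ (?d - 1) * (norm (h r))\<^sup>2) = (\<lambda>r. indicator {0<..<1} r *\<^sub>R (r ^ (?d - 1) * (norm (radial_slope ?d k F Q r))\<^sup>2))"
        by (auto simp: h_def indicator_def fun_eq_iff)
      finally show "(\<lambda>r. indicator {0<..<1} r *\<^sub>R (r ^ (?d - 1) * (norm (radial_slope ?d k F Q r))\<^sup>2)) \<in> borel_measurable lborel" .
      show "AE r in lborel. indicator {0<..<1} r *\<^sub>R (r ^ (?d - 1) * (norm (A r))\<^sup>2) = indicator {0<..<1} r *\<^sub>R (r ^ (?d - 1) * (norm (radial_slope ?d k F Q r))\<^sup>2)"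
        using slope by eventually_elim (auto simp: indicator_def)
    qed
  qed
  then show ?thesis using that[of F Q] F1 FA by (simp add: F_def)
qed

section \<open>Moments of weak solutions\<close>

lemma test_function_smooth: "\<phi> \<in> test_functions \<Longrightarrow> smooth \<phi>"
  by (simp add: test_functions_def)

lemma test_function_dir_deriv:
  assumes \<phi>: "\<phi> \<in> test_functions" and b: "b \<in> Basis"
  shows "dir_deriv \<phi> b \<in> test_functions"
proof -
  obtain K where K: "compact K" "K \<subseteq> ball 0 1" "\<And>x. x \<notin> K \<Longrightarrow> \<phi> x = 0"
    using \<phi> unfolding test_functions_def by blast
  have "dir_deriv \<phi> b x = 0" if x: "x \<notin> K" for x
  proof -
    have "(\<phi> has_derivative (\<lambda>_. 0)) (at x)"
      by (rule has_derivative_transform_within_open[of "\<lambda>_. 0" _ _ _ "- K"])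
        (use x K in \<open>auto intro: compact_imp_closed\<close>)
    then show ?thesis by (simp add: dir_deriv_eq)
  qed
  then show ?thesis using K smooth_dir_deriv[OF test_function_smooth[OF \<phi>] b] unfolding test_functions_def by blast
qed

text \<open>By polar coordinates, the radii of almost all points avoid a null set. This allows the potential
  to be changed on a null set of radii.\<close>

lemma AE_norm_not_in_null_set:
  assumes N: "N \<in> null_sets lborel"
  shows "AE x in (unit_ball_measure :: 'a::euclidean_space measure). norm x \<notin> N"
proof -
  interpret B: finite_measure "unit_ball_measure :: 'a measure" by (rule finite_measure_unit_ball)
  have [measurable]: "N \<in> sets borel" using N by auto
  let ?f = "\<lambda>x::'a. indicator N (norm x) :: real"
  have fb: "?f \<in> borel_measurable borel" by measurable
  have fi: "integrable unit_ball_measure ?f"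
    by (rule B.integrable_const_bound[where B=1]) (use borel_measurable_lebesgue_onI[OF fb] in \<open>auto simp: indicator_def\<close>)
  have "(LINT x|unit_ball_measure. ?f x) = 0"
    unfolding polar_coordinates(3)[OF fb fi] set_lebesgue_integral_def
  proof (rule integral_eq_zero_AE)
    show "AE r in lborel. indicator {0<..<1} r *\<^sub>R r ^ (DIM('a) - 1) *\<^sub>R (LINT w|sphere_measure. ?f (r *\<^sub>R w)) = 0"
      using AE_not_in[OF N]
    proof eventually_elim
      fix r assume r: "r \<notin> N"
      show "indicator {0<..<1} r *\<^sub>R r ^ (DIM('a) - 1) *\<^sub>R (LINT w|sphere_measure. ?f (r *\<^sub>R w)) = 0"
      proof (cases "r \<in> {0<..<1}")
        case True
        have "(LINT w|sphere_measure. ?f (r *\<^sub>R w)) = (LINT w|(sphere_measure :: 'a measure). 0)"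
          using r True by (intro Bochner_Integration.integral_cong refl) (auto simp: space_sphere_measure)
        then show ?thesis by simp
      qed auto
    qed
  qed
  then have "AE x in unit_ball_measure. ?f x = 0"
    using integral_nonneg_eq_0_iff_AE[OF fi] by auto
  then show ?thesis by eventually_elim (auto simp: indicator_def split: if_splits)
qed

lemma AE_lebesgue_on_imp_AE_lborel:
  assumes "AE x in lebesgue_on S. P x" "S \<in> sets lebesgue"
  shows "AE x in lborel. x \<in> S \<longrightarrow> P x"
proof -
  have "AE x in lebesgue. x \<in> S \<longrightarrow> P x"
    using assms by (subst (asm) AE_restrict_space_iff) auto
  then show ?thesis by (simp add: AE_completion_iff)
qed

lemma AE_unit_ball_norm:
  assumes "AE r in lborel. r \<in> {0<..<1} \<longrightarrow> P r"
  shows "AE x in (unit_ball_measure :: 'a::euclidean_space measure). P (norm x)"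
proof -
  obtain N where N: "N \<in> null_sets lborel" "{r \<in> space lborel. \<not> (r \<in> {0<..<1} \<longrightarrow> P r)} \<subseteq> N"
    using assms unfolding eventually_ae_filter by blast
  have P: "P r" if "0 < r" "r < 1" "r \<notin> N" for r using N(2) that by auto
  have "insert 0 N \<in> null_sets lborel"
    using null_sets.Un[OF N(1), of "{0}"] by (simp add: null_setsI)
  from AE_norm_not_in_null_set[OF this] AE_space show ?thesis
    by eventually_elim (auto simp: space_restrict_space intro!: P)
qed

text \<open>A partial derivative of a test function is again a test function, so the definition of the weak
  gradient moves the second derivative to the test function as well.\<close>

lemma solution_moment_solution:
  fixes u f :: "'a::euclidean_space \<Rightarrow> complex"
  assumes d: "3 \<le> DIM('a)" and u: "u \<in> Sol V0" and tr: "has_trace u f"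
    and V: "V \<in> borel_measurable borel" "AE r in lborel. r \<in> {0<..<1} \<longrightarrow> V0 r = V r"
  obtains z where "AE x in unit_ball_measure. u x = z x" "moment_solution V z (\<lambda>p. LINT w|sphere_measure. f w * p w)"
proof -
  let ?B = "unit_ball_measure :: 'a measure"
  interpret B: finite_measure ?B by (rule finite_measure_unit_ball)
  obtain G where G: "has_weak_gradient u G"
    and weak: "\<And>\<phi>. \<phi> \<in> test_functions \<Longrightarrow> has_bochner_integral ?B (\<lambda>x. (\<Sum>b\<in>Basis. G b x * dir_deriv \<phi> b x) + V0 (norm x) * u x * \<phi> x) 0"
    using u unfolding Sol_def by blast
  have wp: "has_weak_partial u b (G b)" if "b \<in> Basis" for b using G that by (simp add: has_weak_gradient_def)
  have uL: "u \<in> L2 ?B" using wp[OF SOME_Basis] by (simp add: has_weak_partial_def)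
  have GL: "G b \<in> L2 ?B" if "b \<in> Basis" for b using wp[OF that] by (simp add: has_weak_partial_def)
  have um: "u \<in> borel_measurable ?B" and u2: "integrable ?B (\<lambda>x. (norm (u x))\<^sup>2)" using uL by (auto simp: L2_def)
  obtain z where z: "z \<in> borel_measurable borel" "AE x in ?B. u x = z x"
    using ex_borel_representative[OF um] by auto
  have zm: "z \<in> borel_measurable ?B" by (rule borel_measurable_lebesgue_onI[OF z(1)])
  have z2: "integrable ?B (\<lambda>x. (norm (z x))\<^sup>2)"
  proof (rule integrable_cong_AE_imp[OF u2])
    show "(\<lambda>x. (norm (z x))\<^sup>2) \<in> borel_measurable ?B" using zm by measurable
    show "AE x in ?B. (norm (u x))\<^sup>2 = (norm (z x))\<^sup>2" using z(2) by eventually_elim simp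
  qed
  have Gi: "integrable ?B (G b)" if "b \<in> Basis" for b
    using GL[OF that] by (auto simp: L2_def intro: B.integrable_norm_if_square)
  have ui: "integrable ?B u" by (rule B.integrable_norm_if_square[OF um u2])
  have Vae: "AE x in ?B. V0 (norm x) = V (norm x)" by (rule AE_unit_ball_norm[OF V(2)])
  have test: "integrable ?B (\<lambda>x. V (norm x) * z x * \<phi> x) \<and>
      (LINT x|?B. z x * laplacian \<phi> x) = (LINT x|?B. V (norm x) * z x * \<phi> x)" if \<phi>: "\<phi> \<in> test_functions" for \<phi>
  proof -
    note s = test_function_smooth[OF \<phi>]
    note sb = smooth_dir_deriv[OF s]
    have si: "integrable ?B (\<lambda>x. \<Sum>b\<in>Basis. G b x * dir_deriv \<phi> b x)"
      by (intro Bochner_Integration.integrable_sum integrable_mult_continuous_unit_ball Gi smooth_continuous sb)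
    have wi: "integrable ?B (\<lambda>x. (\<Sum>b\<in>Basis. G b x * dir_deriv \<phi> b x) + V0 (norm x) * u x * \<phi> x)"
      and w0: "(LINT x|?B. (\<Sum>b\<in>Basis. G b x * dir_deriv \<phi> b x) + V0 (norm x) * u x * \<phi> x) = 0"
      using weak[OF \<phi>] by (auto simp: has_bochner_integral_iff)
    have Vi: "integrable ?B (\<lambda>x. V0 (norm x) * u x * \<phi> x)"
      using Bochner_Integration.integrable_diff[OF wi si] by simp
    have "(LINT x|?B. V0 (norm x) * u x * \<phi> x) = - (LINT x|?B. (\<Sum>b\<in>Basis. G b x * dir_deriv \<phi> b x))"
      using w0 Bochner_Integration.integral_add[OF si Vi] by (simp add: add_eq_0_iff2)
    also have "(LINT x|?B. (\<Sum>b\<in>Basis. G b x * dir_deriv \<phi> b x)) = (\<Sum>b\<in>Basis. LINT x|?B. G b x * dir_deriv \<phi> b x)"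
      by (intro Bochner_Integration.integral_sum integrable_mult_continuous_unit_ball Gi smooth_continuous sb)
    also have "\<dots> = (\<Sum>b\<in>Basis. - (LINT x|?B. u x * dir_deriv (dir_deriv \<phi> b) b x))"
    proof (intro sum.cong refl)
      fix b :: 'a assume b: "b \<in> Basis"
      show "(LINT x|?B. G b x * dir_deriv \<phi> b x) = - (LINT x|?B. u x * dir_deriv (dir_deriv \<phi> b) b x)"
        using wp[OF b] test_function_dir_deriv[OF \<phi> b] unfolding has_weak_partial_def by simp
    qed
    also have "- (\<Sum>b\<in>Basis. - (LINT x|?B. u x * dir_deriv (dir_deriv \<phi> b) b x)) = (\<Sum>b\<in>Basis. (LINT x|?B. u x * dir_deriv (dir_deriv \<phi> b) b x))" by (simp add: sum_negf)
    also have "\<dots> = (LINT x|?B. (\<Sum>b\<in>Basis. u x * dir_deriv (dir_deriv \<phi> b) b x))"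
      by (intro Bochner_Integration.integral_sum[symmetric] integrable_mult_continuous_unit_ball ui smooth_continuous smooth_dir_deriv sb)
    also have "\<dots> = (LINT x|?B. u x * laplacian \<phi> x)" by (simp add: laplacian_def sum_distrib_left)
    finally have 1: "(LINT x|?B. V0 (norm x) * u x * \<phi> x) = (LINT x|?B. u x * laplacian \<phi> x)" .
    have \<phi>m: "\<phi> \<in> borel_measurable borel" by (rule borel_measurable_smooth[OF s])
    have lm: "laplacian \<phi> \<in> borel_measurable borel"
      unfolding laplacian_def[abs_def] by (intro borel_measurable_sum borel_measurable_smooth smooth_dir_deriv sb)
    have hb: "(\<lambda>x. V (norm x) * z x * \<phi> x) \<in> borel_measurable borel" using V(1) z(1) \<phi>m by measurable
    have hm: "(\<lambda>x. V (norm x) * z x * \<phi> x) \<in> borel_measurable ?B" by (rule borel_measurable_lebesgue_onI[OF hb])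
    have ae: "AE x in ?B. V0 (norm x) * u x * \<phi> x = V (norm x) * z x * \<phi> x"
      using Vae z(2) by eventually_elim simp
    have "integrable ?B (\<lambda>x. V (norm x) * z x * \<phi> x)" by (rule integrable_cong_AE_imp[OF Vi hm ae])
    moreover have "(LINT x|?B. V0 (norm x) * u x * \<phi> x) = (LINT x|?B. V (norm x) * z x * \<phi> x)"
      by (rule integral_cong_AE[OF borel_measurable_integrable[OF Vi] hm ae])
    moreover have "(LINT x|?B. u x * laplacian \<phi> x) = (LINT x|?B. z x * laplacian \<phi> x)"
    proof (rule integral_cong_AE)
      show "(\<lambda>x. u x * laplacian \<phi> x) \<in> borel_measurable ?B" "(\<lambda>x. z x * laplacian \<phi> x) \<in> borel_measurable ?B"
        using um zm borel_measurable_lebesgue_onI[OF lm] by (intro borel_measurable_times; simp)+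
      show "AE x in ?B. u x * laplacian \<phi> x = z x * laplacian \<phi> x" using z(2) by eventually_elim simp
    qed
    ultimately show ?thesis using 1 by simp
  qed
  have "moment_solution V z (\<lambda>p. LINT w|sphere_measure. f w * p w)"
    unfolding moment_solution_def
  proof (intro conjI ballI allI impI z(1) z2)
    fix p :: "'a \<Rightarrow> complex" assume p: "continuous_on UNIV p"
    obtain A where "A \<in> borel_measurable borel"
      "set_integrable lborel {0<..<1} (\<lambda>r. r ^ (DIM('a) - 1) * (norm (A r))\<^sup>2)"
      "AE r in lborel. r \<in> {0<..<1} \<longrightarrow>
       sphere_integral (angular_weight p z) r = (LINT w|sphere_measure. f w * p w) - (LINT s:{r..1}|lborel. A s)"
      using trace_radial_moments[OF d tr z p] by blast
    then show "\<exists>A. A \<in> borel_measurable borel \<and> set_integrable lborel {0<..<1} (\<lambda>r. r ^ (DIM('a) - 1) * (norm (A r))\<^sup>2) \<and>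
      (AE r in lborel. r \<in> {0<..<1} \<longrightarrow>
       sphere_integral (angular_weight p z) r = (LINT w|sphere_measure. f w * p w) - (LINT s:{r..1}|lborel. A s))" by blast
  qed (use test in auto)
  then show ?thesis using that z(2) by blast
qed

lemma moment_solution_diff:
  fixes z y :: "'a::euclidean_space \<Rightarrow> complex"
  assumes d: "3 \<le> DIM('a)" and z: "moment_solution V z c" and y: "moment_solution V y e"
  shows "moment_solution V (\<lambda>x. z x - y x) (\<lambda>p. c p - e p)"
proof -
  let ?B = "unit_ball_measure :: 'a measure"
  interpret B: finite_measure ?B by (rule finite_measure_unit_ball)
  have b: "z \<in> borel_measurable borel" "y \<in> borel_measurable borel"
    and L2: "integrable ?B (\<lambda>x. (norm (z x))\<^sup>2)" "integrable ?B (\<lambda>x. (norm (y x))\<^sup>2)"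
    using z y by (auto simp: moment_solution_def)
  note m = borel_measurable_lebesgue_onI[OF b(1)] borel_measurable_lebesgue_onI[OF b(2)]
  have i: "integrable ?B z" "integrable ?B y" using m L2 by (auto intro: B.integrable_norm_if_square)
  show ?thesis
    unfolding moment_solution_def
  proof (intro conjI ballI allI impI)
    show "(\<lambda>x. z x - y x) \<in> borel_measurable borel" using b by measurable
    show "integrable ?B (\<lambda>x. (norm (z x - y x))\<^sup>2)" by (rule integrable_diff_square[OF m L2])
  next
    fix \<phi> :: "'a \<Rightarrow> complex" assume \<phi>: "\<phi> \<in> test_functions"
    have Vi: "integrable ?B (\<lambda>x. V (norm x) * z x * \<phi> x)" "integrable ?B (\<lambda>x. V (norm x) * y x * \<phi> x)"
      and eq: "(LINT x|?B. z x * laplacian \<phi> x) = (LINT x|?B. V (norm x) * z x * \<phi> x)"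
          "(LINT x|?B. y x * laplacian \<phi> x) = (LINT x|?B. V (norm x) * y x * \<phi> x)"
      using z y \<phi> unfolding moment_solution_def by blast+
    have split: "(\<lambda>x. V (norm x) * (z x - y x) * \<phi> x) = (\<lambda>x. V (norm x) * z x * \<phi> x - V (norm x) * y x * \<phi> x)"
      by (simp add: algebra_simps)
    show "integrable ?B (\<lambda>x. V (norm x) * (z x - y x) * \<phi> x)"
      unfolding split by (rule Bochner_Integration.integrable_diff[OF Vi])
    have lc: "continuous_on UNIV (laplacian \<phi>)"
      unfolding laplacian_def[abs_def]
      by (intro continuous_on_sum smooth_continuous smooth_dir_deriv test_function_smooth[OF \<phi>])
    have "(LINT x|?B. (z x - y x) * laplacian \<phi> x) = (LINT x|?B. z x * laplacian \<phi> x) - (LINT x|?B. y x * laplacian \<phi> x)"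
      unfolding left_diff_distrib by (intro Bochner_Integration.integral_diff integrable_mult_continuous_unit_ball i lc)
    also have "\<dots> = (LINT x|?B. V (norm x) * (z x - y x) * \<phi> x)"
      unfolding eq split by (rule Bochner_Integration.integral_diff[OF Vi, symmetric])
    finally show "(LINT x|?B. (z x - y x) * laplacian \<phi> x) = (LINT x|?B. V (norm x) * (z x - y x) * \<phi> x)" .
  next
    fix p :: "'a \<Rightarrow> complex" assume p: "continuous_on UNIV p"
    let ?w = "\<lambda>A::real\<Rightarrow>complex. \<lambda>r. r ^ (DIM('a) - 1) * (norm (A r))\<^sup>2"
    obtain A1 where A1[measurable]: "A1 \<in> borel_measurable borel" and A1i: "set_integrable lborel {0<..<1} (?w A1)"
      and A1e: "AE r in lborel. r \<in> {0<..<1} \<longrightarrow> sphere_integral (angular_weight p z) r = c p - (LINT s:{r..1}|lborel. A1 s)"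
      using z p unfolding moment_solution_def by blast
    obtain A2 where A2[measurable]: "A2 \<in> borel_measurable borel" and A2i: "set_integrable lborel {0<..<1} (?w A2)"
      and A2e: "AE r in lborel. r \<in> {0<..<1} \<longrightarrow> sphere_integral (angular_weight p y) r = e p - (LINT s:{r..1}|lborel. A2 s)"
      using y p unfolding moment_solution_def by blast
    let ?A = "\<lambda>r. A1 r - A2 r"
    have tail: "set_integrable lborel {r..1} A" if "A \<in> borel_measurable borel" "set_integrable lborel {0<..<1} (?w A)" "r \<in> {0<..<1}" for r A
    proof (rule weighted_square_integrable_tail(1)[OF d _ that(2)])
      show "set_borel_measurable borel {0<..<1} A" using that(1) unfolding set_borel_measurable_def by measurable
    qed (use that(3) in auto)
    have pb: "p \<in> borel_measurable borel" by (rule borel_measurable_continuous_onI[OF p])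
    have ai: "AE r in lborel. r \<in> {0<..<1} \<longrightarrow> integrable sphere_measure (\<lambda>w. angular_weight p h (r *\<^sub>R w))"
      if "h \<in> borel_measurable borel" "integrable ?B (\<lambda>x. (norm (h x))\<^sup>2)" for h
      by (intro polar_coordinates(1) B.integrable_norm_if_square borel_measurable_lebesgue_onI borel_measurable_angular_weight pb that angular_weight_square p)
    show "\<exists>A. A \<in> borel_measurable borel \<and> set_integrable lborel {0<..<1} (?w A) \<and>
          (AE r in lborel. r \<in> {0<..<1} \<longrightarrow>
             sphere_integral (angular_weight p (\<lambda>x. z x - y x)) r = (c p - e p) - (LINT s:{r..1}|lborel. A s))"
    proof (intro exI[of _ ?A] conjI)
      show "?A \<in> borel_measurable borel" by measurable
      show "set_integrable lborel {0<..<1} (?w ?A)"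
        unfolding set_integrable_def
      proof (rule Bochner_Integration.integrable_bound)
        have "set_integrable lborel {0<..<1} (\<lambda>r. 2 * ?w A1 r + 2 * ?w A2 r)"
          by (intro set_integral_add(1) set_integrable_mult_right impI A1i A2i)
        then show "integrable lborel (\<lambda>r. indicator {0<..<1} r *\<^sub>R (2 * ?w A1 r + 2 * ?w A2 r))"
          by (simp add: set_integrable_def)
        show "(\<lambda>r. indicator {0<..<1} r *\<^sub>R ?w ?A r) \<in> borel_measurable lborel" by measurable
        have "?w ?A r \<le> 2 * ?w A1 r + 2 * ?w A2 r" if "0 < r" for r
        proof -
          have "?w ?A r \<le> r ^ (DIM('a) - 1) * (2 * (norm (A1 r))\<^sup>2 + 2 * (norm (A2 r))\<^sup>2)"
            using that by (intro mult_left_mono norm_diff_square_le) auto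
          then show ?thesis by (simp add: algebra_simps)
        qed
        then show "AE r in lborel. norm (indicator {0<..<1} r *\<^sub>R ?w ?A r) \<le> norm (indicator {0<..<1} r *\<^sub>R (2 * ?w A1 r + 2 * ?w A2 r))"
          by (intro AE_I2) (auto simp: indicator_def)
      qed
      show "AE r in lborel. r \<in> {0<..<1} \<longrightarrow> sphere_integral (angular_weight p (\<lambda>x. z x - y x)) r = (c p - e p) - (LINT s:{r..1}|lborel. ?A s)"
        using A1e A2e ai[OF b(1) L2(1)] ai[OF b(2) L2(2)]
      proof eventually_elim
        case (elim r)
        show ?case
        proof
          assume r: "r \<in> {0<..<1}"
          have "sphere_integral (angular_weight p (\<lambda>x. z x - y x)) r = (LINT w|sphere_measure. angular_weight p z (r *\<^sub>R w) - angular_weight p y (r *\<^sub>R w))"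
            unfolding sphere_integral_def by (simp add: angular_weight_def left_diff_distrib)
          also have "\<dots> = sphere_integral (angular_weight p z) r - sphere_integral (angular_weight p y) r"
            unfolding sphere_integral_def using elim r by (intro Bochner_Integration.integral_diff) auto
          also have "\<dots> = (c p - e p) - ((LINT s:{r..1}|lborel. A1 s) - (LINT s:{r..1}|lborel. A2 s))"
            using elim r by simp
          also have "(LINT s:{r..1}|lborel. A1 s) - (LINT s:{r..1}|lborel. A2 s) = (LINT s:{r..1}|lborel. ?A s)"
            by (rule set_integral_diff(2)[symmetric, OF tail[OF A1 A1i r] tail[OF A2 A2i r]])
          finally show "sphere_integral (angular_weight p (\<lambda>x. z x - y x)) r = (c p - e p) - (LINT s:{r..1}|lborel. ?A s)" .
        qed
      qed
    qed
  qed
qed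

section \<open>Completeness of the moments\<close>

inductive sum_of_homogeneous :: "('a::euclidean_space \<Rightarrow> complex) \<Rightarrow> bool" where
  base: "homogeneous_poly k p \<Longrightarrow> sum_of_homogeneous p"
| add: "sum_of_homogeneous p \<Longrightarrow> sum_of_homogeneous q \<Longrightarrow> sum_of_homogeneous (\<lambda>x. p x + q x)"

lemma homogeneous_poly_mult:
  assumes q: "homogeneous_poly l q"
  shows "homogeneous_poly k p \<Longrightarrow> homogeneous_poly (k + l) (\<lambda>x. p x * q x)"
proof (induction rule: homogeneous_poly.induct)
  case (const c)
  then show ?case using homogeneous_poly_cmult[OF q] by simp
next
  case (add k p p')
  then show ?case using homogeneous_poly.add[of "k + l"] by (simp add: distrib_right)
next
  case (coord k p b)
  then show ?case using homogeneous_poly.coord[of "k + l", where c=b] by (simp add: mult.assoc)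
qed

lemma sum_of_homogeneous_mult:
  assumes "sum_of_homogeneous p" "sum_of_homogeneous q"
  shows "sum_of_homogeneous (\<lambda>x. p x * q x)"
  using assms(1)
proof (induction rule: sum_of_homogeneous.induct)
  case (base k p)
  note p = base
  show ?case using assms(2)
  proof (induction rule: sum_of_homogeneous.induct)
    case (base l q)
    show ?case by (rule sum_of_homogeneous.base[OF homogeneous_poly_mult[OF base p]])
  next
    case (add q q')
    then show ?case using sum_of_homogeneous.add by (fastforce simp: distrib_left)
  qed
next
  case (add p p')
  then show ?case using sum_of_homogeneous.add by (fastforce simp: distrib_right)
qed

lemma real_polynomial_sum_of_homogeneous:
  "real_polynomial_function q \<Longrightarrow> sum_of_homogeneous (\<lambda>x. complex_of_real (q x))"
proof (induction rule: real_polynomial_function.induct)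
  case (linear f)
  have coord: "homogeneous_poly (Suc 0) (\<lambda>x. complex_of_real (x \<bullet> b))" for b :: 'a
    using homogeneous_poly.coord[OF homogeneous_poly.const[of 1], of b] by simp
  have "homogeneous_poly 1 (\<lambda>x. \<Sum>b\<in>Basis. of_real (f b) * (of_real (x \<bullet> b) * 1))"
    by (intro homogeneous_poly_sum homogeneous_poly_cmult) (auto simp: coord)
  also have "(\<lambda>x. \<Sum>b\<in>Basis. of_real (f b) * (of_real (x \<bullet> b) * 1)) = (\<lambda>x. complex_of_real (f x))"
  proof
    fix x
    have "f x = f (\<Sum>b\<in>Basis. (x \<bullet> b) *\<^sub>R b)" by (simp add: euclidean_representation)
    also have "\<dots> = (\<Sum>b\<in>Basis. (x \<bullet> b) * f b)"
      unfolding linear_sum[OF bounded_linear.linear[OF linear]] by (simp add: linear_cmul[OF bounded_linear.linear[OF linear]])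
    finally show "(\<Sum>b\<in>Basis. of_real (f b) * (of_real (x \<bullet> b) * 1)) = complex_of_real (f x)" by (simp add: mult.commute)
  qed
  finally show ?case by (rule sum_of_homogeneous.base)
next
  case (const c)
  show ?case by (rule sum_of_homogeneous.base[OF homogeneous_poly.const])
next
  case (add f g)
  then show ?case using sum_of_homogeneous.add by fastforce
next
  case (mult f g)
  then show ?case using sum_of_homogeneous_mult by fastforce
qed

text \<open>By polar coordinates \<open>z\<close> is orthogonal to all homogeneous polynomials, by Weierstrass to all
  continuous functions, and by dominated convergence to the indicator functions of boxes.\<close>

lemma vanishing_moments_imp_AE_zero:
  fixes z :: "'a::euclidean_space \<Rightarrow> complex"
  assumes zb: "z \<in> borel_measurable borel" and z2: "integrable unit_ball_measure (\<lambda>x. (norm (z x))\<^sup>2)"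
    and moments: "\<And>k p. homogeneous_poly k p \<Longrightarrow> AE r in lborel. r \<in> {0<..<1} \<longrightarrow> sphere_integral (angular_weight p z) r = 0"
  shows "AE x in unit_ball_measure. z x = 0"
proof -
  let ?B = "unit_ball_measure :: 'a measure" and ?S = "sphere_measure :: 'a measure"
  interpret B: finite_measure ?B by (rule finite_measure_unit_ball)
  have zi: "integrable ?B z" by (intro B.integrable_norm_if_square borel_measurable_lebesgue_onI zb z2)
  have hom: "(LINT x|?B. z x * p x) = 0" if p: "homogeneous_poly k p" for k p
  proof -
    have sp: "smooth p" by (rule smooth_alg_smooth[OF homogeneous_poly_smooth_alg[OF p]])
    have m: "(\<lambda>x. z x * p x) \<in> borel_measurable borel" using zb borel_measurable_smooth[OF sp] by measurable
    have i: "integrable ?B (\<lambda>x. z x * p x)" by (intro integrable_mult_continuous_unit_ball zi smooth_continuous sp)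
    show ?thesis unfolding polar_coordinates(3)[OF m i] set_lebesgue_integral_def
    proof (rule integral_eq_zero_AE)
      show "AE r in lborel. indicator {0<..<1} r *\<^sub>R r ^ (DIM('a) - 1) *\<^sub>R (LINT w|?S. z (r *\<^sub>R w) * p (r *\<^sub>R w)) = 0"
        using moments[OF p]
      proof eventually_elim
        case (elim r)
        show ?case
        proof (cases "r \<in> {0<..<1}")
          case True
          have "(LINT w|?S. z (r *\<^sub>R w) * p (r *\<^sub>R w)) = (LINT w|?S. of_real (r ^ k) * angular_weight p z (r *\<^sub>R w))"
            using True by (intro Bochner_Integration.integral_cong refl)
              (auto simp: space_sphere_measure angular_weight_ray homogeneous_poly_scaleR[OF p])
          also have "\<dots> = of_real (r ^ k) * sphere_integral (angular_weight p z) r"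
            unfolding sphere_integral_def by (rule integral_mult_right_zero)
          also have "\<dots> = 0" using elim True by simp
          finally show ?thesis by simp
        qed auto
      qed
    qed
  qed
  have sum: "(LINT x|?B. z x * q x) = 0 \<and> continuous_on UNIV q" if "sum_of_homogeneous q" for q
    using that
  proof (induction rule: sum_of_homogeneous.induct)
    case (base k p)
    then show ?case using hom smooth_continuous smooth_alg_smooth homogeneous_poly_smooth_alg by blast
  next
    case (add p q)
    then have "(LINT x|?B. z x * (p x + q x)) = (LINT x|?B. z x * p x) + (LINT x|?B. z x * q x)"
      unfolding distrib_left by (intro Bochner_Integration.integral_add integrable_mult_continuous_unit_ball zi) auto
    then show ?case using add by (auto intro: continuous_on_add)
  qed
  have cont: "(LINT x|?B. z x * of_real (g x)) = 0" if g: "continuous_on UNIV g" for g :: "'a \<Rightarrow> real"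
  proof (rule ccontr)
    assume ne: "(LINT x|?B. z x * of_real (g x)) \<noteq> 0"
    define I where "I = (LINT x|?B. norm (z x))"
    have I: "0 \<le> I" by (simp add: I_def)
    \<comment> \<open>An error of \<open>e\<close> in the weight changes the integral by at most \<open>e * I\<close>, less than its supposed size.\<close>
    define e where "e = norm (LINT x|?B. z x * of_real (g x)) / (2 * (I + 1))"
    have e: "0 < e" using ne I by (simp add: e_def add_nonneg_pos)
    obtain q where q: "real_polynomial_function q" "\<And>x. x \<in> cball 0 1 \<Longrightarrow> \<bar>g x - q x\<bar> < e"
      using Stone_Weierstrass_real_polynomial_function[of "cball 0 1" g e] continuous_on_subset[OF g] e by auto
    have q0: "(LINT x|?B. z x * of_real (q x)) = 0" and qc: "continuous_on UNIV (\<lambda>x. complex_of_real (q x))"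
      using sum[OF real_polynomial_sum_of_homogeneous[OF q(1)]] by auto
    have gc: "continuous_on UNIV (\<lambda>x. complex_of_real (g x))" by (rule continuous_on_of_real[OF g])
    note ig = integrable_mult_continuous_unit_ball[OF zi gc] and iq = integrable_mult_continuous_unit_ball[OF zi qc]
    have "(LINT x|?B. z x * of_real (g x)) = (LINT x|?B. z x * of_real (g x) - z x * of_real (q x))"
      using Bochner_Integration.integral_diff[OF ig iq] q0 by simp
    also have "norm \<dots> \<le> (LINT x|?B. norm (z x * of_real (g x) - z x * of_real (q x)))" by (rule integral_norm_bound)
    also have "\<dots> \<le> (LINT x|?B. e * norm (z x))"
    proof (rule integral_mono)
      show "integrable ?B (\<lambda>x. norm (z x * of_real (g x) - z x * of_real (q x)))" using ig iq by auto
      show "integrable ?B (\<lambda>x. e * norm (z x))" using zi by auto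
      fix x assume "x \<in> space ?B"
      then have "\<bar>g x - q x\<bar> \<le> e" using q(2)[of x] by (simp add: less_imp_le)
      then have "norm (z x) * \<bar>g x - q x\<bar> \<le> norm (z x) * e" by (rule mult_left_mono) auto
      moreover have "norm (z x * of_real (g x) - z x * of_real (q x)) = norm (z x) * \<bar>g x - q x\<bar>"
        by (simp only: right_diff_distrib[symmetric] of_real_diff[symmetric] norm_mult norm_of_real)
      ultimately show "norm (z x * of_real (g x) - z x * of_real (q x)) \<le> e * norm (z x)" by (simp add: mult.commute)
    qed
    also have "\<dots> = e * I" by (simp add: I_def)
    finally have "norm (LINT x|?B. z x * of_real (g x)) \<le> e * I" .
    also have "\<dots> < e * (2 * (I + 1))" using e I by (intro mult_strict_left_mono) auto
    also have "\<dots> = norm (LINT x|?B. z x * of_real (g x))" using I by (simp add: e_def)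
    finally show False by simp
  qed
  have box: "(LINT x|?B. z x * of_real (indicator (box a b) x)) = 0" for a b :: 'a
  proof -
    define g where "g n x = min 1 (real n * infdist x (- box a b))" for n x
    have "bounded (box a b)" by simp
    then have "box a b \<noteq> UNIV" using not_bounded_UNIV[where 'a='a] by metis
    then have ne: "- box a b \<noteq> {}" by blast
    have gc: "continuous_on UNIV (g n)" for n unfolding g_def[abs_def] by (intro continuous_intros)
    have g01: "0 \<le> g n x" "g n x \<le> 1" for n x by (auto simp: g_def infdist_nonneg)
    have glim: "(\<lambda>n. g n x) \<longlonglongrightarrow> indicator (box a b) x" for x
    proof (cases "x \<in> box a b")
      case True
      have pos: "infdist x (- box a b) > 0"
        using infdist_pos_not_in_closed[of "- box a b" x] ne True by auto
      then obtain N :: nat where N: "real N * infdist x (- box a b) > 1" using reals_Archimedean3 by blast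
      have "g n x = 1" if "n \<ge> N" for n
      proof -
        have "1 < real N * infdist x (- box a b)" by (rule N)
        also have "\<dots> \<le> real n * infdist x (- box a b)" using that pos by (intro mult_right_mono) auto
        finally show ?thesis by (simp add: g_def)
      qed
      then show ?thesis using True by (intro tendsto_eventually) (auto simp: eventually_sequentially)
    next
      case False
      then have "g n x = 0" for n by (simp add: g_def)
      then show ?thesis using False by simp
    qed
    have "(\<lambda>n. LINT x|?B. z x * of_real (g n x)) \<longlonglongrightarrow> (LINT x|?B. z x * of_real (indicator (box a b) x))"
    proof (rule integral_dominated_convergence[where w="\<lambda>x. norm (z x)"])
      show "(\<lambda>x. z x * of_real (indicator (box a b) x)) \<in> borel_measurable ?B"
        using zb by (intro borel_measurable_lebesgue_onI borel_measurable_times borel_measurable_of_real borel_measurable_indicator) auto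
      show "(\<lambda>x. z x * of_real (g n x)) \<in> borel_measurable ?B" for n
        using zb borel_measurable_continuous_onI[OF gc[of n]] by (intro borel_measurable_lebesgue_onI borel_measurable_times borel_measurable_of_real) auto
      show "integrable ?B (\<lambda>x. norm (z x))" using zi by auto
      show "AE x in ?B. (\<lambda>n. z x * of_real (g n x)) \<longlonglongrightarrow> z x * of_real (indicator (box a b) x)"
        by (intro AE_I2 tendsto_mult tendsto_const tendsto_of_real glim)
      show "AE x in ?B. norm (z x * of_real (g n x)) \<le> norm (z x)" for n
        using g01 by (intro AE_I2) (auto simp: norm_mult intro!: mult_left_le)
    qed
    moreover have "(LINT x|?B. z x * of_real (g n x)) = 0" for n by (rule cont[OF gc])
    ultimately show ?thesis by (simp add: LIMSEQ_const_iff)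
  qed
  have "AE x in lborel. indicator (ball 0 1) x *\<^sub>R z x = 0"
  proof (rule AE_zero_if_box_integrals_zero)
    show "integrable lborel (\<lambda>x. indicator (ball 0 1) x *\<^sub>R z x)"
      using zi integrable_lebesgue_on_iff_lborel(1)[OF zb, of "ball 0 1"] by (simp add: set_integrable_def)
    fix a b :: 'a
    have m: "(\<lambda>x. z x * of_real (indicator (box a b) x)) \<in> borel_measurable borel"
      using zb by (intro borel_measurable_times borel_measurable_of_real borel_measurable_indicator) auto
    have "(LINT x:box a b|lborel. indicator (ball 0 1) x *\<^sub>R z x) = (LINT x:ball 0 1|lborel. z x * of_real (indicator (box a b) x))"
      unfolding set_lebesgue_integral_def by (intro Bochner_Integration.integral_cong refl) (auto simp: indicator_def)
    also have "\<dots> = 0" using box[of a b] integrable_lebesgue_on_iff_lborel(2)[OF m, of "ball 0 1"] by simp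
    finally show "(LINT x:box a b|lborel. indicator (ball 0 1) x *\<^sub>R z x) = 0" .
  qed
  then have "AE x in lebesgue. indicator (ball 0 1) x *\<^sub>R z x = 0" by (rule AE_completion)
  then show ?thesis by (subst AE_restrict_space_iff) (auto elim!: eventually_mono)
qed

section \<open>Smooth functions have their restriction as trace\<close>

lemma smooth_mult_test_function:
  assumes u: "smooth u" and \<phi>: "\<phi> \<in> test_functions"
  shows "(\<lambda>x. u x * \<phi> x) \<in> test_functions"
proof -
  obtain K where "compact K" "K \<subseteq> ball 0 1" "\<And>x. x \<notin> K \<Longrightarrow> \<phi> x = 0"
    using \<phi> unfolding test_functions_def by blast
  then show ?thesis using smooth_mult[OF u test_function_smooth[OF \<phi>]] unfolding test_functions_def by auto
qed

lemma integral_lborel_translation: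
  fixes f :: "'a::euclidean_space \<Rightarrow> complex"
  assumes "f \<in> borel_measurable borel"
  shows "(LINT x|lborel. f (c + x)) = (LINT x|lborel. f x)"
proof -
  have "(LINT x|lborel. f x) = (LINT x|distr lborel borel ((+) c). f x)" by (simp add: lborel_distr_plus)
  also have "\<dots> = (LINT x|lborel. f (c + x))" using assms by (subst integral_distr) auto
  finally show ?thesis by simp
qed

text \<open>The integral of \<open>\<psi>(b + x) - \<psi>(x)\<close> over the whole space vanishes by translation invariance. By
  Fubini's theorem it is also the mean over \<open>t \<in> {0..1}\<close> of the integrals of \<open>\<partial>\<^sub>b\<psi>(t b + x)\<close>, which do not
  depend on \<open>t\<close>.\<close>

lemma integral_dir_deriv_test_function:
  assumes \<psi>: "\<psi> \<in> test_functions" and b: "b \<in> Basis"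
  shows "(LINT x|(unit_ball_measure :: 'a::euclidean_space measure). dir_deriv \<psi> b x) = 0"
proof -
  let ?D = "dir_deriv \<psi> b"
  have s: "smooth \<psi>" "smooth ?D" using test_function_smooth[OF \<psi>] smooth_dir_deriv b by auto
  have zero: "\<psi> x = 0" "?D x = 0" if "\<not> norm x < 1" for x
    using \<psi> test_function_dir_deriv[OF \<psi> b] that unfolding test_functions_def by (fastforce simp: subset_iff)+
  have Db[measurable]: "?D \<in> borel_measurable borel" and \<psi>b[measurable]: "\<psi> \<in> borel_measurable borel"
    using s by (auto intro: borel_measurable_smooth)
  obtain M where M: "0 < M" "\<And>x. norm x \<le> 1 \<Longrightarrow> norm (?D x) \<le> M" using sphere_bound[OF smooth_continuous[OF s(2)]] by metis
  have Mb: "norm (?D x) \<le> M" for x using M zero(2)[of x] by (cases "norm x < 1") auto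
  define k where "k t x = indicator {0..1} t *\<^sub>R ?D (t *\<^sub>R b + x)" for t :: real and x
  have supp: "k t x = 0" if "\<not> (t \<in> {0..1} \<and> norm x < 2)" for t x
  proof (cases "t \<in> {0..1}")
    case True
    then have "2 \<le> norm x" "norm (t *\<^sub>R b) \<le> 1" using that b by auto
    then have "\<not> norm (t *\<^sub>R b + x) < 1" using norm_triangle_ineq4[of "t *\<^sub>R b + x" "t *\<^sub>R b"] by simp
    then show ?thesis by (simp add: k_def zero)
  qed (simp add: k_def)
  have ki: "integrable (lborel \<Otimes>\<^sub>M lborel) (case_prod k)"
  proof (rule integrableI_bounded_set[where A="{0..1} \<times> ball 0 2" and B=M])
    show "{0..1::real} \<times> ball 0 2 \<in> sets (lborel \<Otimes>\<^sub>M (lborel :: 'a measure))" by (rule pair_measureI) auto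
    show "case_prod k \<in> borel_measurable (lborel \<Otimes>\<^sub>M lborel)"
      unfolding k_def case_prod_unfold by measurable
    show "emeasure (lborel \<Otimes>\<^sub>M (lborel :: 'a measure)) ({0..1::real} \<times> ball 0 2) < \<infinity>"
      using emeasure_lborel_ball_finite[of "0::'a" 2]
      by (subst lborel.emeasure_pair_measure_Times) (auto simp: ennreal_mult_eq_top_iff less_top[symmetric])
    show "AE x in lborel \<Otimes>\<^sub>M lborel. x \<in> {0..1} \<times> ball 0 2 \<longrightarrow> norm (case_prod k x) \<le> M"
      using Mb M by (intro AE_I2) (auto simp: k_def indicator_def)
    show "AE x in lborel \<Otimes>\<^sub>M lborel. x \<notin> {0..1} \<times> ball 0 2 \<longrightarrow> case_prod k x = 0"
    proof (intro AE_I2 impI)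
      fix x :: "real \<times> 'a" assume "x \<notin> {0..1} \<times> ball 0 2"
      then show "case_prod k x = 0" using supp[of "fst x" "snd x"] by (cases x) auto
    qed
  qed
  have der: "((\<lambda>t. \<psi> (t *\<^sub>R b + x)) has_vector_derivative ?D (t *\<^sub>R b + x)) (at t within S)" for t x S
  proof -
    let ?F = "frechet_derivative \<psi> (at (t *\<^sub>R b + x))"
    have D: "(\<psi> has_derivative ?F) (at (t *\<^sub>R b + x))"
      by (rule differentiable_has_derivative[OF smooth_differentiable[OF s(1)]])
    have "((\<lambda>t. t *\<^sub>R b + x) has_derivative (\<lambda>t. t *\<^sub>R b)) (at t within S)"
      by (auto intro!: derivative_eq_intros)
    from has_derivative_compose[OF this D] show ?thesis
      by (simp add: has_vector_derivative_def dir_deriv_def linear_cmul[OF has_derivative_linear[OF D]])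
  qed
  have FTC: "(LINT t|lborel. k t x) = \<psi> (b + x) - \<psi> x" for x
  proof -
    have "(LINT t|lborel. indicator {0..1} t *\<^sub>R ?D (t *\<^sub>R b + x)) = \<psi> (1 *\<^sub>R b + x) - \<psi> (0 *\<^sub>R b + x)"
      by (intro integral_FTC_atLeastAtMost der continuous_on_compose2[OF smooth_continuous[OF s(2), of UNIV]] continuous_intros) auto
    then show ?thesis by (simp add: k_def)
  qed
  obtain P where P: "0 < P" "\<And>x. norm x \<le> 1 \<Longrightarrow> norm (\<psi> x) \<le> P" using sphere_bound[OF smooth_continuous[OF s(1)]] by metis
  have \<psi>i: "integrable lborel \<psi>"
  proof (rule integrableI_bounded_set[where A="ball 0 1" and B=P])
    show "AE x in lborel. x \<in> ball 0 1 \<longrightarrow> norm (\<psi> x) \<le> P" using P by (intro AE_I2) auto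
    show "AE x in lborel. x \<notin> ball 0 1 \<longrightarrow> \<psi> x = 0" using zero by (intro AE_I2) auto
  qed (use emeasure_lborel_ball_finite[of "0::'a" 1] in auto)
  have \<psi>ib: "integrable lborel (\<lambda>x. \<psi> (b + x))"
  proof -
    have "integrable (distr lborel borel ((+) b)) \<psi>" using \<psi>i by (simp add: lborel_distr_plus)
    then show ?thesis by (subst (asm) integrable_distr_eq) auto
  qed
  have "(LINT x|lborel. LINT t|lborel. k t x) = (LINT t|lborel. LINT x|lborel. k t x)"
    by (rule lborel_pair.Fubini_integral[OF ki])
  moreover have "(LINT x|lborel. LINT t|lborel. k t x) = 0"
    unfolding FTC using \<psi>i \<psi>ib by (simp add: integral_lborel_translation)
  moreover have "(LINT t|lborel. LINT x|lborel. k t x) = (LINT t|lborel. indicator {0..1::real} t *\<^sub>R (LINT x|lborel. ?D x))"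
    unfolding k_def by (simp add: integral_lborel_translation)
  moreover have "(LINT t|lborel. indicator {0..1::real} t *\<^sub>R (LINT x|lborel. ?D x)) = (LINT x|lborel. ?D x)"
    by simp
  ultimately have D0: "(LINT x|lborel. ?D x) = 0" by simp
  have "(LINT x|unit_ball_measure. ?D x) = (LINT x:ball 0 1|lborel. ?D x)"
    by (rule integrable_lebesgue_on_iff_lborel(2)) auto
  also have "\<dots> = (LINT x|lborel. ?D x)"
    unfolding set_lebesgue_integral_def
    by (intro Bochner_Integration.integral_cong refl) (use zero in \<open>auto simp: indicator_def\<close>)
  finally show ?thesis using D0 by simp
qed

lemma smooth_in_L2_ball: "smooth u \<Longrightarrow> u \<in> L2 unit_ball_measure"
  unfolding L2_def by (auto intro: integrable_smooth_square borel_measurable_lebesgue_onI borel_measurable_smooth)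

lemma has_weak_gradient_smooth:
  assumes u: "smooth u" shows "has_weak_gradient u (dir_deriv u)"
  unfolding has_weak_gradient_def has_weak_partial_def
proof (intro ballI conjI smooth_in_L2_ball u smooth_dir_deriv)
  interpret B: finite_measure "unit_ball_measure :: 'a measure" by (rule finite_measure_unit_ball)
  fix b :: 'a and \<phi> :: "'a \<Rightarrow> complex" assume b: "b \<in> Basis" and \<phi>: "\<phi> \<in> test_functions"
  note s\<phi> = test_function_smooth[OF \<phi>]
  have i: "integrable unit_ball_measure v" if "smooth v" for v :: "'a \<Rightarrow> complex"
    using smooth_in_L2_ball[OF that] by (auto simp: L2_def intro: B.integrable_norm_if_square)
  have "0 = (LINT x|unit_ball_measure. dir_deriv (\<lambda>x. u x * \<phi> x) b x)"
    by (rule integral_dir_deriv_test_function[OF smooth_mult_test_function[OF u \<phi>] b, symmetric])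
  also have "\<dots> = (LINT x|unit_ball_measure. u x * dir_deriv \<phi> b x + dir_deriv u b x * \<phi> x)"
    by (simp add: dir_deriv_mult smooth_differentiable u s\<phi>)
  also have "\<dots> = (LINT x|unit_ball_measure. u x * dir_deriv \<phi> b x) + (LINT x|unit_ball_measure. dir_deriv u b x * \<phi> x)"
    by (intro Bochner_Integration.integral_add i smooth_mult smooth_dir_deriv u s\<phi> b)
  finally show "(LINT x|unit_ball_measure. u x * dir_deriv \<phi> b x) = - (LINT x|unit_ball_measure. dir_deriv u b x * \<phi> x)"
    by (simp add: eq_neg_iff_add_eq_0)
qed

lemma has_trace_smooth:
  assumes u: "smooth u" shows "has_trace u u"
  unfolding has_trace_def
proof (intro conjI exI[of _ "dir_deriv u"] exI[of _ "\<lambda>_. u"])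
  show "u \<in> W12" unfolding W12_def using has_weak_gradient_smooth[OF u] by blast
qed (use has_weak_gradient_smooth[OF u] smooth_in_L2_sphere[OF u] u in auto)

text \<open>Otherwise polar coordinates give a polynomial that vanishes almost everywhere in the ball;
  but its zeros lie in the hyperplane \<open>x \<bullet> a = 0\<close>.\<close>

lemma planar_harmonic_sphere_norm:
  assumes ab: "a \<in> Basis" "b \<in> Basis"
  shows "(LINT w|(sphere_measure :: 'a::euclidean_space measure). cnj (planar_harmonic a b k w) * planar_harmonic a b k w) \<noteq> 0"
proof
  let ?h = "planar_harmonic a b k" and ?B = "unit_ball_measure :: 'a measure" and ?S = "sphere_measure :: 'a measure"
  interpret B: finite_measure ?B by (rule finite_measure_unit_ball)
  assume zero: "(LINT w|?S. cnj (?h w) * ?h w) = 0"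
  note hp = homogeneous_poly_planar_harmonic[of k a b]
  have sh: "smooth ?h" by (rule smooth_alg_smooth[OF homogeneous_poly_smooth_alg[OF hp]])
  have m: "(\<lambda>x. (norm (?h x))\<^sup>2) \<in> borel_measurable borel" using borel_measurable_smooth[OF sh] by measurable
  note i = integrable_smooth_square[OF sh]
  have sq: "(\<lambda>w. cnj (?h w) * ?h w) = (\<lambda>w. complex_of_real ((norm (?h w))\<^sup>2))"
    by (rule ext, subst mult.commute, rule complex_norm_square[symmetric])
  have z: "(LINT w|?S. (norm (?h w))\<^sup>2) = 0"
    using zero by (simp only: sq integral_complex_of_real of_real_eq_0_iff)
  have "(LINT x|?B. (norm (?h x))\<^sup>2) = 0"
    unfolding polar_coordinates(3)[OF m i] set_lebesgue_integral_def
  proof (rule integral_eq_zero_AE, rule AE_I2)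
    fix r :: real
    have "(LINT w|?S. (norm (?h (r *\<^sub>R w)))\<^sup>2) = (LINT w|?S. (r ^ k)\<^sup>2 * (norm (?h w))\<^sup>2)"
      by (simp add: homogeneous_poly_scaleR[OF hp] norm_mult power_mult_distrib del: of_real_power)
    also have "\<dots> = 0" using z by simp
    finally show "indicator {0<..<1} r *\<^sub>R r ^ (DIM('a) - 1) *\<^sub>R (LINT w|?S. (norm (?h (r *\<^sub>R w)))\<^sup>2) = 0" by simp
  qed
  then have "AE x in ?B. (norm (?h x))\<^sup>2 = 0"
    using integral_nonneg_eq_0_iff_AE[OF i] by auto
  then have "AE x in lborel. x \<in> ball 0 1 \<longrightarrow> (norm (?h x))\<^sup>2 = 0"
    by (rule AE_lebesgue_on_imp_AE_lborel) auto
  then have "AE x in lebesgue. x \<in> ball 0 1 \<longrightarrow> (norm (?h x))\<^sup>2 = 0" by (rule AE_completion)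
  moreover have "{x::'a. x \<bullet> a = 0} \<in> null_sets lebesgue"
    using negligible_standard_hyperplane[OF ab(1), of 0] by (simp add: negligible_iff_null_sets inner_commute)
  from AE_not_in[OF this] have "AE x in lebesgue. x \<bullet> a \<noteq> 0" by simp
  ultimately have "AE x in lebesgue. x \<notin> ball (0::'a) 1"
  proof eventually_elim
    case (elim x)
    have "?h x \<noteq> 0"
    proof -
      have "Re (of_real (x \<bullet> a) + \<i> * of_real (x \<bullet> b)) \<noteq> 0" using elim by simp
      then have "of_real (x \<bullet> a) + \<i> * of_real (x \<bullet> b) \<noteq> (0::complex)" by (metis zero_complex.sel(1))
      then show ?thesis by (simp add: planar_harmonic_def)
    qed
    then show ?case using elim by auto
  qed
  then have "ball (0::'a) 1 \<in> null_sets lebesgue" by (subst (asm) AE_iff_null_sets[symmetric]) auto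
  then have "negligible (ball (0::'a) 1)" by (simp add: negligible_iff_null_sets)
  then show False using open_not_negligible[of "ball (0::'a) 1"] by simp
qed

section \<open>Uniqueness from surjectivity\<close>

text \<open>The induction over the degree \<open>k\<close> compares the moments of \<open>v - u\<close> with those of a solution whose
  trace is the conjugate of the planar harmonic polynomial of the same degree.\<close>

theorem solutions_with_equal_trace_coincide:
  fixes v u :: "'a::euclidean_space \<Rightarrow> complex"
  assumes d: "3 \<le> DIM('a)"
    and meas: "V \<in> borel_measurable (lebesgue_on {0<..<1})"
    and int: "integrable (lebesgue_on {0<..<1}) (\<lambda>r. r * norm (V r))"
    and onto: "\<forall>\<phi>\<in>(W_half :: ('a \<Rightarrow> complex) set). \<exists>u\<in>Sol V. has_trace u \<phi>"
    and u: "u \<in> Sol V" "has_trace u \<phi>" and v: "v \<in> Sol V" "has_trace v \<phi>"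
  shows "AE x in unit_ball_measure. v x = u x"
proof -
  let ?B = "unit_ball_measure :: 'a measure"
  \<comment> \<open>Polar coordinates are available for Borel functions, so the potential is replaced by a Borel
    representative.\<close>
  obtain W where W: "W \<in> borel_measurable borel" "AE r in lebesgue_on {0<..<1}. V r = W r"
    using ex_borel_representative[OF meas] by auto
  have VW: "AE r in lborel. r \<in> {0<..<1} \<longrightarrow> V r = W r"
    by (rule AE_lebesgue_on_imp_AE_lborel[OF W(2)]) auto
  note [measurable] = W(1)
  have rW: "set_integrable lborel {0<..<1} (\<lambda>r. of_real r * W r)"
  proof -
    have b: "(\<lambda>r. of_real r * W r) \<in> borel_measurable borel" by measurable
    have "integrable (lebesgue_on {0<..<1}) (\<lambda>r. of_real r * W r)"
    proof (rule Bochner_Integration.integrable_bound[OF int])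
      show "(\<lambda>r. of_real r * W r) \<in> borel_measurable (lebesgue_on {0<..<1})" by (rule borel_measurable_lebesgue_onI[OF b])
      show "AE r in lebesgue_on {0<..<1}. norm (of_real r * W r) \<le> norm (r * norm (V r))"
        using W(2) by eventually_elim (simp add: norm_mult abs_mult)
    qed
    then show ?thesis by (simp add: integrable_lebesgue_on_iff_lborel(1)[OF b])
  qed
  obtain z1 where z1: "AE x in ?B. v x = z1 x" "moment_solution W z1 (\<lambda>p. LINT w|sphere_measure. \<phi> w * p w)"
    using solution_moment_solution[OF d v W(1) VW] by blast
  obtain z2 where z2: "AE x in ?B. u x = z2 x" "moment_solution W z2 (\<lambda>p. LINT w|sphere_measure. \<phi> w * p w)"
    using solution_moment_solution[OF d u W(1) VW] by blast
  let ?z = "\<lambda>x. z1 x - z2 x"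
  have z: "moment_solution W ?z (\<lambda>_. 0)"
    using moment_solution_diff[OF d z1(2) z2(2)] by simp
  have "card (Basis :: 'a set) \<noteq> 1" "Basis \<noteq> ({} :: 'a set)" using d by auto
  then obtain a b :: 'a where ab: "a \<in> Basis" "b \<in> Basis" "a \<noteq> b"
    by (metis card_1_singleton_iff is_singletonI' is_singleton_altdef)
  have moments: "AE r in lborel. r \<in> {0<..<1} \<longrightarrow> sphere_integral (angular_weight p ?z) r = 0" if "homogeneous_poly k p" for k p
    using that
  proof (induction k arbitrary: p rule: less_induct)
    case (less k p)
    have lap: "AE r in lborel. r \<in> {0<..<1} \<longrightarrow> sphere_integral (angular_weight (laplacian p) ?z) r = 0"
    proof (cases "k < 2")
      case True
      then show ?thesis using homogeneous_poly_laplacian(2)[OF less.prems]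
        by (simp add: sphere_integral_def angular_weight_def)
    next
      case False
      then show ?thesis using less.IH[OF _ homogeneous_poly_laplacian(1)[OF less.prems]] by simp
    qed
    obtain F1 Q1 where F1: "radial_solution DIM('a) k W F1 Q1" "F1 1 = 0"
      "AE r in lborel. r \<in> {0<..<1} \<longrightarrow> sphere_integral (angular_weight p ?z) r = F1 r"
      using moment_radial_solution[OF d W(1) rW z less.prems lap] by metis
    let ?h = "planar_harmonic a b k"
    let ?c = "\<lambda>x. cnj (?h x)"
    have sc: "smooth ?c" by (rule smooth_alg_smooth[OF smooth_alg_cnj_planar_harmonic])
    then have "?c \<in> W_half" using has_trace_smooth[OF sc] unfolding W_half_def has_trace_def by blast
    then obtain y where y: "y \<in> Sol V" "has_trace y ?c" using onto by blast
    obtain z3 where z3: "moment_solution W z3 (\<lambda>p. LINT w|sphere_measure. ?c w * p w)"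
      using solution_moment_solution[OF d y W(1) VW] by blast
    have lap2: "AE r in lborel. r \<in> {0<..<1} \<longrightarrow> sphere_integral (angular_weight (laplacian ?h) z3) r = 0"
      unfolding laplacian_planar_harmonic[OF ab] by (simp add: sphere_integral_def angular_weight_def)
    obtain F2 Q2 where F2: "radial_solution DIM('a) k W F2 Q2" "F2 1 = (LINT w|sphere_measure. ?c w * ?h w)"
      using moment_radial_solution[OF d W(1) rW z3 homogeneous_poly_planar_harmonic lap2] by metis
    have "F2 1 \<noteq> 0" unfolding F2(2) by (rule planar_harmonic_sphere_norm[OF ab(1,2)])
    from radial_solution_unique[OF d W(1) rW F1(1) F2(1) F1(2) this]
    have "\<forall>r\<in>{0<..1}. F1 r = 0" .
    with F1(3) show ?case by (auto elim!: eventually_mono)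
  qed
  have "AE x in ?B. ?z x = 0"
    using z moments unfolding moment_solution_def by (intro vanishing_moments_imp_AE_zero) auto
  with z1(1) z2(1) show ?thesis by eventually_elim simp
qed

theorem theorem19:
  fixes V :: "real \<Rightarrow> complex"
  assumes dim: "CARD('n::finite) \<ge> 3"
    and meas: "V \<in> borel_measurable (lebesgue_on {0<..<1})"
    and int: "integrable (lebesgue_on {0<..<1}) (\<lambda>r. r * norm (V r))"
    and Ls: "V \<in> weighted_Lp (max 2 (real CARD('n) / 2)) (real CARD('n) - 1)"
    and below: "almost_bounded_below V"
  shows
    "(\<forall>\<phi>\<in>(W_half :: ((real ^ 'n) \<Rightarrow> complex) set).
        \<exists>u\<in>Sol V. has_trace u \<phi> \<and>
          (\<forall>v\<in>Sol V. has_trace v \<phi> \<longrightarrow> (AE x in lebesgue_on (ball 0 1). v x = u x)))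
     \<longleftrightarrow>
     (\<forall>\<phi>\<in>(W_half :: ((real ^ 'n) \<Rightarrow> complex) set). \<exists>u\<in>Sol V. has_trace u \<phi>)"
proof
  assume onto: "\<forall>\<phi>\<in>(W_half :: ((real ^ 'n) \<Rightarrow> complex) set). \<exists>u\<in>Sol V. has_trace u \<phi>"
  have d: "3 \<le> DIM(real ^ 'n)" using dim by simp
  show "\<forall>\<phi>\<in>(W_half :: ((real ^ 'n) \<Rightarrow> complex) set).
        \<exists>u\<in>Sol V. has_trace u \<phi> \<and>
          (\<forall>v\<in>Sol V. has_trace v \<phi> \<longrightarrow> (AE x in lebesgue_on (ball 0 1). v x = u x))"
  proof
    fix \<phi> :: "real ^ 'n \<Rightarrow> complex" assume "\<phi> \<in> W_half"
    then obtain u where u: "u \<in> Sol V" "has_trace u \<phi>" using onto by blast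
    then show "\<exists>u\<in>Sol V. has_trace u \<phi> \<and> (\<forall>v\<in>Sol V. has_trace v \<phi> \<longrightarrow> (AE x in lebesgue_on (ball 0 1). v x = u x))"
      using solutions_with_equal_trace_coincide[OF d meas int onto u] by blast
  qed
qed blast

end
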